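(* Let $q$ be an odd prime power, let $n \equiv 2 \pmod 4$, and let $g \in SO^{\pm}_n(q)$ (either type). Then $g$ is real in $SO^{\pm}_n(q)$ if and only if $g$ is strongly real in $SO_n^{\pm}(q)$, and $g$ is real in $SO_n^{\pm}(q)$ if and only if it has an elementary divisor of the form $(t-1)^k$ or $(t+1)^k$ with $k$ odd.
   Context: An element $g$ of a group $G$ is real in $G$ if $hgh^{-1}=g^{-1}$ for some $h\in G$, and strongly real in $G$ if such an $h$ can be chosen with $h^2=1$. For $q$ odd, $O_n^{\pm}(q)$ is the subgroup of $GL_n(q)$ stabilizing a non-degenerate (split $+$ or non-split $-$) symmetric form on $\mathbb{F}_q^n$, and $SO_n^\pm(q)$ is its subgroup of determinant $1$ elements. Elementary divisors are those of $g$ as a matrix over $\mathbb{F}_q$. *)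

theory Defs
  imports
    "Jordan_Normal_Form.Char_Poly"
    "HOL-Computational_Algebra.Polynomial_Factorial"
    "HOL-Library.Cardinality"
begin

definition real_in :: "('g, 'm) monoid_scheme \<Rightarrow> 'g \<Rightarrow> bool" where
  "real_in G g \<longleftrightarrow>
     (\<exists>h\<in>carrier G. h \<otimes>\<^bsub>G\<^esub> g \<otimes>\<^bsub>G\<^esub> inv\<^bsub>G\<^esub> h = inv\<^bsub>G\<^esub> g)"

definition strongly_real_in :: "('g, 'm) monoid_scheme \<Rightarrow> 'g \<Rightarrow> bool" where
  "strongly_real_in G g \<longleftrightarrow>
     (\<exists>h\<in>carrier G. h [^]\<^bsub>G\<^esub> (2::nat) = \<one>\<^bsub>G\<^esub> \<and>
        h \<otimes>\<^bsub>G\<^esub> g \<otimes>\<^bsub>G\<^esub> inv\<^bsub>G\<^esub> h = inv\<^bsub>G\<^esub> g)"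

(* A bilinear form on column vectors of length n is given by its n x n Gram matrix B. *)
definition bform :: "'a::comm_ring_1 mat \<Rightarrow> 'a vec \<Rightarrow> 'a vec \<Rightarrow> 'a" where
  "bform B x y = x \<bullet> (B *\<^sub>v y)"

definition nondegenerate_symmetric_form :: "nat \<Rightarrow> 'a::comm_ring_1 mat \<Rightarrow> bool" where
  "nondegenerate_symmetric_form n B \<longleftrightarrow>
     B \<in> carrier_mat n n \<and>
     (\<forall>x\<in>carrier_vec n. \<forall>y\<in>carrier_vec n. bform B x y = bform B y x) \<and>
     (\<forall>x\<in>carrier_vec n. (\<forall>y\<in>carrier_vec n. bform B x y = 0) \<longrightarrow> x = 0\<^sub>v n)"

definition GL_group :: "'a::comm_ring_1 itself \<Rightarrow> nat \<Rightarrow> 'a mat monoid" where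
  "GL_group T n = units_of (ring_mat T n ())"

definition O_group :: "nat \<Rightarrow> 'a::comm_ring_1 mat \<Rightarrow> 'a mat monoid" where
  "O_group n B = (GL_group TYPE('a) n)
     \<lparr>carrier := {g \<in> carrier (GL_group TYPE('a) n).
        \<forall>x\<in>carrier_vec n. \<forall>y\<in>carrier_vec n.
          bform B (g *\<^sub>v x) (g *\<^sub>v y) = bform B x y}\<rparr>"

(* For n even and a finite field of odd order, the groups of both types + and - are obtained
   as B runs through all non-degenerate symmetric forms: each such form is split (Witt index
   n/2) or non-split. *)
definition SO_group :: "nat \<Rightarrow> 'a::comm_ring_1 mat \<Rightarrow> 'a mat monoid" where
  "SO_group n B = (O_group n B)\<lparr>carrier := {g \<in> carrier (O_group n B). det g = 1}\<rparr>"

lemma GL_group_is_group: "group (GL_group TYPE('a::comm_ring_1) n)"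
proof -
  interpret ring "ring_mat TYPE('a) n ()" by (rule ring_mat)
  show ?thesis unfolding GL_group_def by (rule units_group)
qed

lemma GL_group_simps:
  "carrier (GL_group TYPE('a::comm_ring_1) n) = Units (ring_mat TYPE('a) n ())"
  "\<one>\<^bsub>GL_group TYPE('a) n\<^esub> = 1\<^sub>m n"
  "x \<otimes>\<^bsub>GL_group TYPE('a) n\<^esub> y = x * y"
  by (simp_all add: GL_group_def units_of_def ring_mat_def)

lemma GL_group_carrierD:
  "g \<in> carrier (GL_group TYPE('a::comm_ring_1) n) \<Longrightarrow> g \<in> carrier_mat n n"
  by (auto simp: GL_group_simps Units_def ring_mat_def)

lemma O_group_subgroup:
  fixes B :: "'a::comm_ring_1 mat"
  shows "subgroup (carrier (O_group n B)) (GL_group TYPE('a) n)"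
proof -
  let ?G = "GL_group TYPE('a) n"
  interpret group ?G by (rule GL_group_is_group)
  note C = GL_group_carrierD[where 'a = 'a and n = n]
  show ?thesis
  proof (rule subgroupI)
    show "carrier (O_group n B) \<subseteq> carrier ?G" by (auto simp: O_group_def)
    have "\<one>\<^bsub>?G\<^esub> \<in> carrier (O_group n B)"
      using one_closed by (simp add: O_group_def GL_group_simps)
    then show "carrier (O_group n B) \<noteq> {}" by blast
  next
    fix a assume a: "a \<in> carrier (O_group n B)"
    let ?i = "inv\<^bsub>?G\<^esub> a"
    from a have aG: "a \<in> carrier ?G" by (simp add: O_group_def)
    have iG: "?i \<in> carrier ?G" using aG by simp
    have ai: "a * ?i = 1\<^sub>m n" using r_inv[OF aG] by (simp add: GL_group_simps)
    { fix x y :: "'a vec" assume x: "x \<in> carrier_vec n" and y: "y \<in> carrier_vec n"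
      have e: "a *\<^sub>v (?i *\<^sub>v z) = z" if "z \<in> carrier_vec n" for z
        using ai C[OF aG] C[OF iG] that
        by (metis assoc_mult_mat_vec one_mult_mat_vec)
      have "?i *\<^sub>v x \<in> carrier_vec n" "?i *\<^sub>v y \<in> carrier_vec n"
        using C[OF iG] x y by auto
      then have "bform B (?i *\<^sub>v x) (?i *\<^sub>v y) = bform B x y"
        using a e[OF x] e[OF y] by (fastforce simp: O_group_def) }
    then show "?i \<in> carrier (O_group n B)" using iG by (simp add: O_group_def)
  next
    fix a b assume a: "a \<in> carrier (O_group n B)" and b: "b \<in> carrier (O_group n B)"
    from a b have aG: "a \<in> carrier ?G" and bG: "b \<in> carrier ?G"
      by (simp_all add: O_group_def)
    { fix x y :: "'a vec" assume x: "x \<in> carrier_vec n" and y: "y \<in> carrier_vec n"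
      have e: "(a * b) *\<^sub>v z = a *\<^sub>v (b *\<^sub>v z)" if "z \<in> carrier_vec n" for z
        using C[OF aG] C[OF bG] that by (rule assoc_mult_mat_vec)
      have "b *\<^sub>v x \<in> carrier_vec n" "b *\<^sub>v y \<in> carrier_vec n"
        using C[OF bG] x y by auto
      then have "bform B ((a * b) *\<^sub>v x) ((a * b) *\<^sub>v y) = bform B x y"
        using a b x y by (simp add: e O_group_def) }
    then show "a \<otimes>\<^bsub>?G\<^esub> b \<in> carrier (O_group n B)"
      using m_closed[OF aG bG] by (simp add: O_group_def GL_group_simps)
  qed
qed

lemma SO_group_subgroup:
  fixes B :: "'a::comm_ring_1 mat"
  shows "subgroup (carrier (SO_group n B)) (GL_group TYPE('a) n)"
proof -
  let ?G = "GL_group TYPE('a) n"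
  interpret group ?G by (rule GL_group_is_group)
  interpret O: subgroup "carrier (O_group n B)" ?G by (rule O_group_subgroup)
  note C = GL_group_carrierD[where 'a = 'a and n = n]
  show ?thesis
  proof (rule subgroupI)
    show "carrier (SO_group n B) \<subseteq> carrier ?G"
      using O.subset by (auto simp: SO_group_def)
    have "\<one>\<^bsub>?G\<^esub> \<in> carrier (SO_group n B)"
      using O.one_closed by (simp add: SO_group_def GL_group_simps)
    then show "carrier (SO_group n B) \<noteq> {}" by blast
  next
    fix a assume a: "a \<in> carrier (SO_group n B)"
    let ?i = "inv\<^bsub>?G\<^esub> a"
    from a have aO: "a \<in> carrier (O_group n B)" and da: "det a = 1"
      by (simp_all add: SO_group_def)
    have aG: "a \<in> carrier ?G" using aO O.subset by blast
    have iG: "?i \<in> carrier ?G" using aG by simp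
    have "a * ?i = 1\<^sub>m n" using r_inv[OF aG] by (simp add: GL_group_simps)
    then have "det ?i = 1"
      using det_mult[OF C[OF aG] C[OF iG]] da by simp
    then show "?i \<in> carrier (SO_group n B)"
      using O.m_inv_closed[OF aO] by (simp add: SO_group_def)
  next
    fix a b assume a: "a \<in> carrier (SO_group n B)" and b: "b \<in> carrier (SO_group n B)"
    then have aO: "a \<in> carrier (O_group n B)" and bO: "b \<in> carrier (O_group n B)"
      and d: "det a = 1" "det b = 1" by (simp_all add: SO_group_def)
    have aG: "a \<in> carrier ?G" and bG: "b \<in> carrier ?G" using aO bO O.subset by blast+
    show "a \<otimes>\<^bsub>?G\<^esub> b \<in> carrier (SO_group n B)"
      using O.m_closed[OF aO bO] d det_mult[OF C[OF aG] C[OF bG]]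
      by (simp add: SO_group_def GL_group_simps)
  qed
qed

lemma SO_group_is_group: "group (SO_group n (B::'a::comm_ring_1 mat))"
proof -
  have "SO_group n B = (GL_group TYPE('a) n)\<lparr>carrier := carrier (SO_group n B)\<rparr>"
    by (simp add: SO_group_def O_group_def)
  then show ?thesis
    using subgroup.subgroup_is_group[OF SO_group_subgroup GL_group_is_group, of n B] by simp
qed

(* For monic p of degree d: the matrix of multiplication by t on F[t]/(p) with respect to the
   basis 1, t, ..., t^(d-1). *)
definition companion_mat :: "'a::comm_ring_1 poly \<Rightarrow> 'a mat" where
  "companion_mat p = mat (degree p) (degree p)
     (\<lambda>(i, j). if Suc j = degree p then - coeff p i else if i = Suc j then 1 else 0)"

(* Similarity to the block diagonal matrix says that F^n, with t acting as A, is isomorphic as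
   an F[t]-module to the direct sum of the cyclic modules F[t]/(d) for d in ds. *)
definition elementary_divisors :: "'a::field mat \<Rightarrow> 'a poly list \<Rightarrow> bool" where
  "elementary_divisors A ds \<longleftrightarrow>
     (\<forall>d\<in>set ds. \<exists>p k. monic p \<and> irreducible p \<and> 0 < k \<and> d = p ^ k) \<and>
     similar_mat A (diag_block_mat (map companion_mat ds))"

(* The list above is unique up to order, so "some list" and "every list" agree here. *)
definition elementary_divisor :: "'a::field mat \<Rightarrow> 'a poly \<Rightarrow> bool" where
  "elementary_divisor A d \<longleftrightarrow> (\<exists>ds. elementary_divisors A ds \<and> d \<in> set ds)"

end

(* With x = g + 1/g self-adjoint and S = g - 1/g skew-adjoint, an isometry inverts g and is an
   involution precisely when it is +1 on P and -1 on N for an orthogonal decomposition into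
   x-invariant subspaces P, N that S interchanges. Such decompositions are built from self-adjoint
   projections onto cyclic F[x]-modules. Except where an odd Jordan block of g with eigenvalue 1 or -1
   is split off, dim P = dim N. An odd block allows P and N to be exchanged on an odd-dimensional
   summand, which makes the determinant 1. Without odd blocks the involution has determinant
   (-1)^(n/2) = -1, and every isometry commuting with g has determinant 1: otherwise the
   -1-eigenspace of a suitable odd power would be an odd-dimensional g-invariant nondegenerate
   subspace, for which dim P = dim N is impossible. So no element of SO inverts g. *)

theory Submission
  imports Defs "HOL-Library.Function_Algebras" "HOL-Library.FuncSet"
begin

section \<open>Linear operators on sequences\<close>

text \<open>Passing from \<open>g\<close> to the self-adjoint \<open>x\<close> is what makes
  orthogonal splitting possible. On a component killed by p(x)^k but not by p(x)^(k-1), polarization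
  finds v with b(v, p(x)^(k-1) v) nonzero, and then F[x]v is nondegenerate. With \<open>g\<close> in
  place of \<open>x\<close> this breaks down on even Jordan blocks, where the pairing b(v, (g -
  \<epsilon>)^(k-1) v) is alternating. As \<open>S\<close> is skew and commutes with
  \<open>x\<close>, the space F[x]Sv is orthogonal to F[x]v and is its natural partner. The obstacle
  is S^2 = x^2 - 4, which degenerates where x - 2\<epsilon> is nilpotent. If \<open>S\<close> kills
  the socle of F[x]v, the partner is smaller by one dimension: an odd block. If it does not, F[x]Sv
  is degenerate, and two pieces on each side have to be interlaced. Finiteness of the field replaces
  minimal polynomials: powers of an operator on a finite space repeat, which yields annihilating
  polynomials, Fitting idempotents and odd powers of 2-power order.\<close>

declare plus_fun_apply [simp del] zero_fun_apply [simp del]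

lemmas fun_apply = plus_fun_apply zero_fun_apply minus_apply uminus_apply

text \<open>Vectors of all dimensions live in the single type of sequences, so that operators form a
  ring at the level of type classes; an \<open>n \<times> n\<close> matrix acts on the first \<open>n\<close> coordinates and
  fixes the others.\<close>

typedef (overloaded) 'a::field endo =
  "{f :: (nat \<Rightarrow> 'a) \<Rightarrow> (nat \<Rightarrow> 'a).
     (\<forall>u v. f (u + v) = f u + f v) \<and> (\<forall>c u. f (\<lambda>i. c * u i) = (\<lambda>i. c * f u i))}"
  morphisms app Endo
  by (rule exI[of _ id]) simp

notation app (infixr "\<rhd>" 75)

lemma app_add [simp]: "X \<rhd> (u + v) = X \<rhd> u + X \<rhd> v"
  using app[of X] by blast

lemma app_cmult: "X \<rhd> (\<lambda>i. c * u i) = (\<lambda>i. c * (X \<rhd> u) i)"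
  using app[of X] by blast

lemma app_Endo:
  assumes "\<And>u v. f (u + v) = f u + f v" "\<And>c u. f (\<lambda>i. c * u i) = (\<lambda>i. c * f u i)"
  shows "Endo f \<rhd> u = f u"
  using Endo_inverse[of f] assms by simp

lemma app_zero [simp]: "X \<rhd> 0 = 0"
  using app_add[of X 0 0] by simp

lemma app_minus [simp]: "X \<rhd> (- u) = - (X \<rhd> u)"
  using app_add[of X u "- u"] by (simp add: eq_neg_iff_add_eq_0 add.commute)

lemma app_diff [simp]: "X \<rhd> (u - v) = X \<rhd> u - X \<rhd> v"
  using app_add[of X u "- v"] by simp

lemma app_sum: "X \<rhd> sum f A = (\<Sum>i\<in>A. X \<rhd> f i)"
  by (induction A rule: infinite_finite_induct) auto

lemma endo_eqI: "(\<And>u. X \<rhd> u = Y \<rhd> u) \<Longrightarrow> X = Y"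
  by (simp add: app_inject[symmetric] fun_eq_iff)

instantiation endo :: (field) ring_1
begin

definition "0 = Endo (\<lambda>u. 0)"
definition "1 = Endo (\<lambda>u. u)"
definition "X + Y = Endo (\<lambda>u. X \<rhd> u + Y \<rhd> u)"
definition "X - Y = Endo (\<lambda>u. X \<rhd> u - Y \<rhd> u)"
definition "- X = Endo (\<lambda>u. - (X \<rhd> u))"
definition "X * Y = Endo (\<lambda>u. X \<rhd> Y \<rhd> u)"

lemma app_endo_simps [simp]:
  "0 \<rhd> u = 0" "1 \<rhd> u = u"
  "(X + Y) \<rhd> u = X \<rhd> u + Y \<rhd> u" "(X - Y) \<rhd> u = X \<rhd> u - Y \<rhd> u" "(- X) \<rhd> u = - (X \<rhd> u)"
  "(X * Y) \<rhd> u = X \<rhd> Y \<rhd> u"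
  unfolding zero_endo_def one_endo_def plus_endo_def minus_endo_def uminus_endo_def times_endo_def
  by (subst app_Endo; auto simp: app_cmult fun_eq_iff fun_apply algebra_simps)+

instance
proof
  show "(0::'a endo) \<noteq> 1"
  proof
    assume "(0::'a endo) = 1"
    then have "(0::'a endo) \<rhd> (\<lambda>i. 1) = 1 \<rhd> (\<lambda>i. 1)" by simp
    then show False by (simp add: fun_eq_iff fun_apply)
  qed
qed (rule endo_eqI; simp add: algebra_simps)+

end

definition sc :: "'a::field \<Rightarrow> 'a endo" where
  "sc c = Endo (\<lambda>u i. c * u i)"

lemma app_sc: "sc c \<rhd> u = (\<lambda>i. c * u i)"
  unfolding sc_def by (subst app_Endo) (auto simp: fun_eq_iff fun_apply algebra_simps)

lemma sc_apply [simp]: "(sc c \<rhd> u) i = c * u i"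
  by (simp add: app_sc)

lemma app_sc_commute: "X \<rhd> sc c \<rhd> u = sc c \<rhd> X \<rhd> u"
  by (simp add: app_sc app_cmult)

lemma sc_commute: "X * sc c = sc c * X"
  by (rule endo_eqI) (simp add: app_sc_commute)

lemma sc_left_commute: "X * (sc c * Y) = sc c * (X * Y)"
  by (rule endo_eqI) (simp add: app_sc_commute[of X])

lemma sc_simps [simp]:
  "sc 0 = 0" "sc 1 = 1" "sc (- c) = - sc c" "sc (c + d) = sc c + sc d" "sc (c - d) = sc c - sc d"
  "sc (c * d) = sc c * sc d"
  by (rule endo_eqI; simp add: fun_eq_iff fun_apply algebra_simps)+

lemma sc_of_nat: "sc (of_nat m) = of_nat m"
  by (induction m) auto

lemma sc_numeral: "sc (numeral m) = numeral m"
  using sc_of_nat[of "numeral m"] by simp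

lemma sc_sum: "sc (sum f A) = (\<Sum>i\<in>A. sc (f i))"
  by (induction A rule: infinite_finite_induct) auto

lemma sc_eq_0_iff [simp]: "sc c \<rhd> u = 0 \<longleftrightarrow> c = 0 \<or> u = 0"
  by (auto simp: fun_eq_iff fun_apply)

lemma app_sum_endo: "sum F A \<rhd> u = (\<Sum>i\<in>A. F i \<rhd> u)"
  by (induction A rule: infinite_finite_induct) auto

lemma sum_fun_apply: "sum f A i = (\<Sum>a\<in>A. f a i)"
  for f :: "'b \<Rightarrow> nat \<Rightarrow> 'a::comm_monoid_add"
  by (induction A rule: infinite_finite_induct) (auto simp: fun_apply)

section \<open>Linear functionals and operators of rank one\<close>

definition functional :: "((nat \<Rightarrow> 'a::field) \<Rightarrow> 'a) \<Rightarrow> bool" where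
  "functional \<phi> \<longleftrightarrow> (\<forall>u v. \<phi> (u + v) = \<phi> u + \<phi> v) \<and> (\<forall>c u. \<phi> (sc c \<rhd> u) = c * \<phi> u)"

lemma functional_simps:
  assumes "functional \<phi>"
  shows "\<phi> (u + v) = \<phi> u + \<phi> v" "\<phi> (sc c \<rhd> u) = c * \<phi> u" "\<phi> 0 = 0" "\<phi> (- u) = - \<phi> u"
    "\<phi> (u - v) = \<phi> u - \<phi> v"
proof -
  show a: "\<phi> (u + v) = \<phi> u + \<phi> v" for u v using assms by (simp add: functional_def)
  show s: "\<phi> (sc c \<rhd> u) = c * \<phi> u" for c u using assms by (simp add: functional_def)
  show z: "\<phi> 0 = 0" using s[of 0] by simp
  show m: "\<phi> (- u) = - \<phi> u" for u using s[of "-1" u] by simp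
  show "\<phi> (u - v) = \<phi> u - \<phi> v" using a[of u "- v"] m by simp
qed

lemma functional_sum: "functional \<phi> \<Longrightarrow> \<phi> (sum f A) = (\<Sum>i\<in>A. \<phi> (f i))"
  by (induction A rule: infinite_finite_induct) (simp_all add: functional_simps[of \<phi>])

lemma functional_comp: "functional \<phi> \<Longrightarrow> functional (\<lambda>u. \<phi> (X \<rhd> u))"
  by (simp add: functional_def app_sc_commute)

lemma functional_coordinate: "functional (\<lambda>u. u i)"
  by (simp add: functional_def fun_apply)

lemma functional_lincomb:
  "(\<And>i. i \<in> A \<Longrightarrow> functional (q i)) \<Longrightarrow> functional (\<lambda>u. \<Sum>i\<in>A. c i * q i u)"
  by (induction A rule: infinite_finite_induct)
    (auto simp: functional_def algebra_simps)

definition rank1 :: "((nat \<Rightarrow> 'a::field) \<Rightarrow> 'a) \<Rightarrow> (nat \<Rightarrow> 'a) \<Rightarrow> 'a endo" where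
  "rank1 \<phi> p = Endo (\<lambda>u. sc (\<phi> u) \<rhd> p)"

lemma app_rank1:
  assumes "functional \<phi>"
  shows "rank1 \<phi> p \<rhd> u = sc (\<phi> u) \<rhd> p"
  unfolding rank1_def
proof (subst app_Endo)
  note \<phi> = functional_simps[OF assms]
  show "sc (\<phi> (u + v)) \<rhd> p = sc (\<phi> u) \<rhd> p + sc (\<phi> v) \<rhd> p" for u v by (simp add: \<phi>)
  show "sc (\<phi> (\<lambda>i. c * u i)) \<rhd> p = (\<lambda>i. c * (sc (\<phi> u) \<rhd> p) i)" for c u
    using \<phi>(2)[of c u] by (simp add: app_sc algebra_simps)
qed simp

subsection \<open>Polynomials in an operator\<close>

text \<open>Horner evaluation in a noncommutative ring; multiplicativity rests on the coefficients
  \<open>sc a\<close> being central.\<close>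

definition pev :: "'a::field poly \<Rightarrow> 'a endo \<Rightarrow> 'a endo" where
  "pev p X = fold_coeffs (\<lambda>a Y. sc a + X * Y) p 0"

lemma pev_0 [simp]: "pev 0 X = 0"
  by (simp add: pev_def)

lemma pev_pCons [simp]: "pev (pCons a p) X = sc a + X * pev p X"
  by (cases "p = 0 \<and> a = 0") (auto simp: pev_def)

lemma pev_1 [simp]: "pev 1 X = 1"
  by (simp add: one_pCons)

lemma pev_add [simp]: "pev (p + q) X = pev p X + pev q X"
  by (induction p q rule: poly_induct2) (auto simp: algebra_simps)

lemma pev_minus [simp]: "pev (- p) X = - pev p X"
  using pev_add[of p "- p" X] by (simp add: eq_neg_iff_add_eq_0 add.commute)

lemma pev_diff [simp]: "pev (p - q) X = pev p X - pev q X"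
  using pev_add[of p "- q" X] by simp

lemma pev_smult [simp]: "pev (Polynomial.smult c p) X = sc c * pev p X"
proof (induction p)
  case (pCons a p)
  have "X * (sc c * pev p X) = sc c * (X * pev p X)"
    using sc_commute[of X c] by (metis mult.assoc)
  then show ?case using pCons by (simp add: distrib_left)
qed simp

lemma pev_mult [simp]: "pev (p * q) X = pev p X * pev q X"
  by (induction p) (auto simp: algebra_simps)

lemma pev_power [simp]: "pev (p ^ m) X = pev p X ^ m"
  by (induction m) auto

lemma pev_commute: "Y * X = X * Y \<Longrightarrow> Y * pev p X = pev p X * Y"
proof (induction p)
  case (pCons a p)
  have "Y * (X * pev p X) = X * (Y * pev p X)" using pCons.prems by (metis mult.assoc)
  then show ?case using pCons sc_commute[of Y a] by (simp add: distrib_left distrib_right mult.assoc)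
qed auto

lemma pev_eq_sum: "(\<And>i. i \<ge> m \<Longrightarrow> coeff p i = 0) \<Longrightarrow> pev p X = (\<Sum>i<m. sc (coeff p i) * X ^ i)"
proof (induction p arbitrary: m)
  case (pCons a p)
  show ?case
  proof (cases m)
    case 0
    then have "pCons a p = 0" using pCons.prems by (intro poly_eqI) auto
    then show ?thesis using 0 by (simp only: pev_0) simp
  next
    case (Suc m')
    have *: "X * (sc c * Y) = sc c * (X * Y)" for c Y
      using sc_commute[of X c] by (metis mult.assoc)
    have "pev p X = (\<Sum>i<m'. sc (coeff p i) * X ^ i)"
      using pCons.prems[of "Suc i" for i] Suc by (intro pCons.IH) fastforce
    then show ?thesis
      by (simp add: Suc sum.lessThan_Suc_shift sum_distrib_left * del: sum.lessThan_Suc)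
  qed
qed auto

lemma pev_eq_0_degree:
  assumes "degree p < m"
  shows "pev p X = (\<Sum>i<m. sc (coeff p i) * X ^ i)"
  using assms by (intro pev_eq_sum coeff_eq_0) auto

lemma pev_monom: "pev (monom 1 j) A = A ^ j"
  by (induction j) (simp_all add: monom_0 monom_Suc)

subsection \<open>Bezout identities over a field\<close>

text \<open>An element of least degree in the ideal generated by \<open>c\<close> and
  \<open>p\<close> divides both. It is a unit, since otherwise \<open>p\<close> would divide it and
  hence \<open>c\<close>.\<close>

lemma poly_bezout_irreducible:
  fixes p c :: "'a::field poly"
  assumes p: "irreducible p" and c: "\<not> p dvd c"
  shows "\<exists>a b. a * c + b * p = 1"
proof -
  let ?I = "{a * c + b * p |a b. True}"
  have cI: "c \<in> ?I" by (rule CollectI, rule exI[of _ 1], rule exI[of _ 0]) simp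
  have pI: "p \<in> ?I" by (rule CollectI, rule exI[of _ 0], rule exI[of _ 1]) simp
  have "c \<noteq> 0" using c by auto
  then obtain m where m: "m \<in> ?I" "m \<noteq> 0"
    and min: "\<And>r. r \<in> ?I \<Longrightarrow> r \<noteq> 0 \<Longrightarrow> degree m \<le> degree r"
    using ex_has_least_nat[of "\<lambda>m. m \<in> ?I \<and> m \<noteq> 0" c degree] cI by blast
  obtain a b where ab: "m = a * c + b * p" using m by blast
  have dvd: "m dvd r" if rI: "r \<in> ?I" for r
  proof -
    obtain a' b' where r: "r = a' * c + b' * p" using rI by blast
    have "r mod m = r - r div m * m" by (simp add: minus_div_mult_eq_mod)
    also have "\<dots> = (a' - r div m * a) * c + (b' - r div m * b) * p"
      by (simp add: r ab algebra_simps)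
    finally have "r mod m \<in> ?I" by blast
    then show ?thesis
      using min[of "r mod m"] degree_mod_less[of m r] m(2) by fastforce
  qed
  have "is_unit m"
    using dvd[OF pI] dvd[OF cI] p c by (metis dvd_trans irreducibleD')
  then obtain u where "m * u = 1" by (metis dvdE)
  then have "(u * a) * c + (u * b) * p = 1" by (simp add: ab algebra_simps)
  then show ?thesis by blast
qed

lemma irreducible_linear_poly: "irreducible [:a, 1:]" for a :: "'a::field"
proof (rule irreducibleI)
  fix c d assume cd: "[:a, 1:] = c * d"
  then have nz: "c \<noteq> 0" "d \<noteq> 0" by auto
  have "degree c + degree d = 1" using arg_cong[OF cd, of degree] nz by (simp add: degree_mult_eq)
  then show "c dvd 1 \<or> d dvd 1" using nz by (auto simp: is_unit_iff_degree)
qed (auto simp: is_unit_iff_degree)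

text \<open>Raise 1 - ac = bp to the power \<open>k\<close>: the left side is congruent to 1 modulo
  \<open>c\<close>.\<close>

lemma poly_bezout_power:
  fixes p c :: "'a::field poly"
  assumes "irreducible p" "\<not> p dvd c"
  shows "\<exists>a b. a * c + b * p ^ k = 1"
proof -
  obtain a b where ab: "a * c + b * p = 1" using poly_bezout_irreducible[OF assms] by blast
  have "1 - a * c = b * p" unfolding ab[symmetric] by simp
  then have "(1 - a * c) ^ k = b ^ k * p ^ k" by (simp add: power_mult_distrib)
  moreover have "c dvd 1 - (1 - a * c) ^ k" by (simp add: one_diff_power_eq)
  ultimately obtain d where "1 - b ^ k * p ^ k = c * d" by (metis dvdE)
  then have "d * c + b ^ k * p ^ k = 1" by (simp add: algebra_simps)
  then show ?thesis by blast
qed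

text \<open>Factors \<open>p\<close> are stripped from \<open>c\<close>, each lowering
  \<open>k\<close> by one, until \<open>c\<close> is prime to \<open>p\<close> and thus invertible
  modulo the remaining power. The degree bound guarantees that this happens before \<open>k\<close>
  reaches 0.\<close>

lemma poly_bezout_socle:
  fixes p c :: "'a::field poly"
  assumes p: "irreducible p" and "c \<noteq> 0" and "degree c < degree (p ^ k)"
  shows "\<exists>r b. r * c + b * p ^ k = p ^ (k - 1)"
  using assms(2,3)
proof (induction k arbitrary: c)
  case (Suc k)
  show ?case
  proof (cases "p dvd c")
    case True
    then obtain d where d: "c = p * d" by blast
    have p0: "p \<noteq> 0" using p by auto
    have "d \<noteq> 0" "degree d < degree (p ^ k)"
      using Suc.prems p0 by (auto simp: d degree_mult_eq)
    then obtain r b where rb: "r * d + b * p ^ k = p ^ (k - 1)" using Suc.IH by blast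
    have "k \<noteq> 0" using \<open>degree d < degree (p ^ k)\<close> by (cases k) auto
    have "r * c + b * p ^ Suc k = p * (r * d + b * p ^ k)"
      by (simp add: d algebra_simps)
    also have "\<dots> = p * p ^ (k - 1)" by (simp add: rb)
    finally have "r * c + b * p ^ Suc k = p * p ^ (k - 1)" .
    then show ?thesis using \<open>k \<noteq> 0\<close> by (cases k) auto
  next
    case False
    then obtain a b where "a * c + b * p ^ Suc k = 1" using poly_bezout_power[OF p] by blast
    then have "(p ^ k * a) * c + (p ^ k * b) * p ^ Suc k = p ^ k"
      by (metis distrib_left mult.assoc mult.right_neutral)
    then show ?thesis by (metis diff_Suc_1)
  qed
qed simp

subsection \<open>Coordinates on the image of an idempotent\<close>

text \<open>A dual basis with \<open>E\<close> as the sum of the rank-one operators q_i(.) b_i. It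
  forces \<open>E\<close> to be idempotent with image of dimension \<open>d\<close>, so that
  subspaces are handled through projections onto them.\<close>

definition basis_of ::
  "'a::field endo \<Rightarrow> nat \<Rightarrow> (nat \<Rightarrow> nat \<Rightarrow> 'a) \<Rightarrow> (nat \<Rightarrow> (nat \<Rightarrow> 'a) \<Rightarrow> 'a) \<Rightarrow> bool" where
  "basis_of E d b q \<longleftrightarrow> (\<forall>i<d. functional (q i)) \<and>
     (\<forall>i<d. \<forall>j<d. q i (b j) = (if i = j then 1 else 0)) \<and>
     (\<forall>u. E \<rhd> u = (\<Sum>i<d. sc (q i u) \<rhd> b i))"

definition has_rank :: "'a::field endo \<Rightarrow> nat \<Rightarrow> bool" where
  "has_rank E d \<longleftrightarrow> (\<exists>b q. basis_of E d b q)"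

text \<open>The image of \<open>E\<close> is \<open>A\<close>-invariant, but the kernel need not be;
  commutation of \<open>A\<close> with \<open>E\<close> is therefore stated separately where it
  matters.\<close>

definition acts_as :: "'a::field endo \<Rightarrow> 'a endo \<Rightarrow> 'a mat \<Rightarrow> bool" where
  "acts_as A E D \<longleftrightarrow> (\<exists>d b q. basis_of E d b q \<and> D \<in> carrier_mat d d \<and>
     (\<forall>j<d. A \<rhd> b j = (\<Sum>i<d. sc (D $$ (i, j)) \<rhd> b i)))"

lemma sum_if_eq_sc:
  fixes d j :: nat
  shows "(\<Sum>i<d. sc (if i = j then 1 else 0) \<rhd> (b i :: nat \<Rightarrow> 'a::field)) = (if j < d then b j else 0)"
proof -
  have "(\<Sum>i<d. sc (if i = j then 1 else 0) \<rhd> b i) = (\<Sum>i<d. if i = j then b i else 0)"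
    by (intro sum.cong) auto
  then show ?thesis using sum.delta[of "{..<d}" j b] by simp
qed

lemma basis_of_fix:
  assumes "basis_of E d b q" "j < d"
  shows "E \<rhd> b j = b j"
proof -
  have "E \<rhd> b j = (\<Sum>i<d. sc (if i = j then 1 else 0) \<rhd> b i)"
    using assms unfolding basis_of_def by simp
  then show ?thesis using assms(2) by (simp add: sum_if_eq_sc)
qed

lemma basis_of_idem:
  assumes "basis_of E d b q"
  shows "E * E = E"
proof (rule endo_eqI)
  fix u
  have "E \<rhd> u = (\<Sum>i<d. sc (q i u) \<rhd> b i)" using assms by (simp add: basis_of_def)
  moreover have "E \<rhd> \<dots> = \<dots>"
    using basis_of_fix[OF assms] by (simp add: app_sum app_sc_commute)
  ultimately show "(E * E) \<rhd> u = E \<rhd> u" by simp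
qed

lemma basis_of_coord:
  assumes "basis_of E d b q" "i < d"
  shows "q i (E \<rhd> u) = q i u"
proof -
  have f: "functional (q i)" using assms by (simp add: basis_of_def)
  have "q i (E \<rhd> u) = (\<Sum>j<d. q j u * q i (b j))"
    using assms by (simp add: basis_of_def functional_sum[OF f] functional_simps[OF f])
  also have "\<dots> = (\<Sum>j<d. if j = i then q j u else 0)"
    using assms by (intro sum.cong) (auto simp: basis_of_def)
  finally show ?thesis using assms(2) by simp
qed

lemma basis_of_add:
  assumes 1: "basis_of E d b q" and 2: "basis_of F d' b' q'" and o: "E * F = 0" "F * E = 0"
  shows "basis_of (E + F) (d + d') (\<lambda>i. if i < d then b i else b' (i - d))
     (\<lambda>i. if i < d then q i else q' (i - d))"
proof -
  have z: "q i (b' j) = 0" if "i < d" "j < d'" for i j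
  proof -
    have "q i (b' j) = q i (E \<rhd> F \<rhd> b' j)"
      using basis_of_coord[OF 1 that(1)] basis_of_fix[OF 2 that(2)] by simp
    also have "E \<rhd> F \<rhd> b' j = 0" using o(1) by (metis app_endo_simps(1,6))
    finally show ?thesis using 1 that by (simp add: basis_of_def functional_simps(3))
  qed
  have z': "q' i (b j) = 0" if "i < d'" "j < d" for i j
  proof -
    have "q' i (b j) = q' i (F \<rhd> E \<rhd> b j)"
      using basis_of_coord[OF 2 that(1)] basis_of_fix[OF 1 that(2)] by simp
    also have "F \<rhd> E \<rhd> b j = 0" using o(2) by (metis app_endo_simps(1,6))
    finally show ?thesis using 2 that by (simp add: basis_of_def functional_simps(3))
  qed
  have split: "(\<Sum>i<d + d'. f i) = (\<Sum>i<d. f i) + (\<Sum>i<d'. f (d + i))" for f :: "nat \<Rightarrow> nat \<Rightarrow> 'a"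
    by (induction d') (auto simp: algebra_simps)
  show ?thesis
    unfolding basis_of_def
    using 1 2 z z' by (auto simp: basis_of_def split)
qed

lemma has_rank_add:
  "has_rank E d \<Longrightarrow> has_rank F d' \<Longrightarrow> E * F = 0 \<Longrightarrow> F * E = 0 \<Longrightarrow> has_rank (E + F) (d + d')"
  unfolding has_rank_def using basis_of_add by blast

lemma has_rank_0: "has_rank 0 0"
  by (simp add: has_rank_def basis_of_def)

lemma has_rank_idem: "has_rank E d \<Longrightarrow> E * E = E"
  unfolding has_rank_def using basis_of_idem by blast

lemma acts_as_0: "acts_as A 0 (0\<^sub>m 0 0)"
  unfolding acts_as_def by (rule exI[of _ 0]) (simp add: basis_of_def)

lemma acts_as_add:
  assumes "acts_as A E D" "acts_as A F D'" and o: "E * F = 0" "F * E = 0"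
  shows "acts_as A (E + F) (four_block_mat D (0\<^sub>m (dim_row D) (dim_col D')) (0\<^sub>m (dim_row D') (dim_col D)) D')"
proof -
  obtain d b q where 1: "basis_of E d b q" "D \<in> carrier_mat d d"
    and A1: "\<And>j. j < d \<Longrightarrow> A \<rhd> b j = (\<Sum>i<d. sc (D $$ (i, j)) \<rhd> b i)"
    using assms(1) unfolding acts_as_def by blast
  obtain d' b' q' where 2: "basis_of F d' b' q'" "D' \<in> carrier_mat d' d'"
    and A2: "\<And>j. j < d' \<Longrightarrow> A \<rhd> b' j = (\<Sum>i<d'. sc (D' $$ (i, j)) \<rhd> b' i)"
    using assms(2) unfolding acts_as_def by blast
  have split: "(\<Sum>i<d + d'. f i) = (\<Sum>i<d. f i) + (\<Sum>i<d'. f (d + i))" for f :: "nat \<Rightarrow> nat \<Rightarrow> 'a"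
    by (induction d') (auto simp: algebra_simps)
  show ?thesis
    unfolding acts_as_def
  proof (intro exI conjI allI impI)
    show "basis_of (E + F) (d + d') (\<lambda>i. if i < d then b i else b' (i - d))
       (\<lambda>i. if i < d then q i else q' (i - d))" by (rule basis_of_add[OF 1(1) 2(1) o])
    show "four_block_mat D (0\<^sub>m (dim_row D) (dim_col D')) (0\<^sub>m (dim_row D') (dim_col D)) D'
        \<in> carrier_mat (d + d') (d + d')" using 1(2) 2(2) by auto
  next
    fix j assume "j < d + d'"
    then show "A \<rhd> (if j < d then b j else b' (j - d)) =
      (\<Sum>i<d + d'. sc (four_block_mat D (0\<^sub>m (dim_row D) (dim_col D')) (0\<^sub>m (dim_row D') (dim_col D)) D' $$ (i, j)) \<rhd>
        (if i < d then b i else b' (i - d)))"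
      using 1(2) 2(2) A1 A2 by (auto simp: split)
  qed
qed

text \<open>\<open>X\<close> is injective on the image of \<open>E\<close> with left inverse
  \<open>E * Y\<close>, so basis vectors move by \<open>X\<close> and coordinates pull back along
  \<open>Y\<close>.\<close>

lemma has_rank_transport:
  assumes E: "has_rank E d" and XY: "E * Y * X * E = E"
  shows "has_rank (X * E * Y) d"
proof -
  obtain b q where bq: "basis_of E d b q" using E by (auto simp: has_rank_def)
  have "basis_of (X * E * Y) d (\<lambda>i. X \<rhd> b i) (\<lambda>i u. q i (Y \<rhd> u))"
    unfolding basis_of_def
  proof (intro conjI allI impI)
    fix i j assume ij: "i < d" "j < d"
    have "q i (Y \<rhd> X \<rhd> b j) = q i (E \<rhd> Y \<rhd> X \<rhd> E \<rhd> b j)"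
      using basis_of_coord[OF bq ij(1)] basis_of_fix[OF bq ij(2)] by simp
    also have "E \<rhd> Y \<rhd> X \<rhd> E \<rhd> b j = E \<rhd> b j" by (metis XY app_endo_simps(6))
    finally show "q i (Y \<rhd> X \<rhd> b j) = (if i = j then 1 else 0)"
      using basis_of_fix[OF bq ij(2)] bq ij by (simp add: basis_of_def)
  qed (use bq in \<open>auto simp: basis_of_def functional_comp app_sum app_sc_commute\<close>)
  then show ?thesis by (auto simp: has_rank_def)
qed

subsection \<open>Projection onto a primary cyclic subspace\<close>

lemma app_power_add: "X ^ i \<rhd> X ^ j \<rhd> u = X ^ (i + j) \<rhd> u"
  by (metis app_endo_simps(6) power_add)

text \<open>Division with remainder by \<open>m\<close>: a functional vanishing on the image of m(A)
  sees only the moments below the degree of \<open>m\<close>.\<close>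

lemma functional_pev_reduce:
  assumes \<phi>: "functional \<phi>" and m: "m \<noteq> 0" "\<And>u. \<phi> (pev m A \<rhd> u) = 0"
    and z: "\<And>j. j < degree m \<Longrightarrow> \<phi> (A ^ j \<rhd> u) = 0"
  shows "\<phi> (pev c A \<rhd> u) = 0"
proof (cases "degree m = 0")
  case True
  then obtain a where a: "m = [:a:]" by (metis degree_eq_zeroE)
  then have "a * \<phi> (pev c A \<rhd> u) = 0"
    using m(2)[of "pev c A \<rhd> u"] by (simp add: functional_simps[OF \<phi>])
  then show ?thesis using a m(1) by simp
next
  case False
  have "c = m * (c div m) + c mod m" by simp
  then have "pev c A \<rhd> u = pev m A \<rhd> pev (c div m) A \<rhd> u + pev (c mod m) A \<rhd> u"
    by (metis app_endo_simps(3,6) pev_add pev_mult)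
  then have "\<phi> (pev c A \<rhd> u) = \<phi> (pev (c mod m) A \<rhd> u)"
    by (simp add: functional_simps[OF \<phi>] m(2))
  also have "degree (c mod m) < degree m"
    using False m(1) degree_mod_less'[of m c] by (cases "c mod m = 0") auto
  then have "\<phi> (pev (c mod m) A \<rhd> u) = (\<Sum>i<degree m. coeff (c mod m) i * \<phi> (A ^ i \<rhd> u))"
    by (simp add: pev_eq_0_degree app_sum_endo functional_sum[OF \<phi>] functional_simps[OF \<phi>])
  also have "\<dots> = 0" by (simp add: z)
  finally show ?thesis .
qed

lemma pev_vector_reduce:
  assumes "m \<noteq> 0" "pev m A \<rhd> v = 0"
  shows "\<exists>f. pev c A \<rhd> v = (\<Sum>i<degree m. sc (f i) \<rhd> A ^ i \<rhd> v)"
proof (cases "degree m = 0")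
  case True
  then obtain a where "m = [:a:]" by (metis degree_eq_zeroE)
  then have "v = 0" using assms by auto
  then show ?thesis by simp
next
  case False
  have "c = (c div m) * m + c mod m" by simp
  then have "pev c A \<rhd> v = pev (c mod m) A \<rhd> v"
    using assms(2) by (metis (no_types) add_0 app_endo_simps(3,6) app_zero pev_add pev_mult)
  moreover have "degree (c mod m) < degree m"
    using False assms(1) degree_mod_less'[of m c] by (cases "c mod m = 0") auto
  ultimately show ?thesis
    by (auto simp: pev_eq_0_degree app_sum_endo intro!: exI[of _ "coeff (c mod m)"])
qed

text \<open>In the cyclic module \<open>F[t]/(p\<^sup>k)\<close> every nonzero submodule contains the socle
  \<open>p\<^bsup>k-1\<^esup>\<close>, so a functional that does not vanish there makes the Hankel matrix
  of its moments invertible.\<close>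

locale hankel =
  fixes A :: "'a::field endo" and p :: "'a poly" and k :: nat and v :: "nat \<Rightarrow> 'a"
    and \<phi> :: "(nat \<Rightarrow> 'a) \<Rightarrow> 'a"
  assumes functional: "functional \<phi>" and irreducible: "irreducible p"
    and annihilates: "pev (p ^ k) A \<rhd> v = 0" "\<And>u. \<phi> (pev (p ^ k) A \<rhd> u) = 0"
    and socle: "\<phi> (pev (p ^ (k - 1)) A \<rhd> v) \<noteq> 0"
begin

abbreviation "d \<equiv> degree (p ^ k)"

lemma pk_nonzero: "p ^ k \<noteq> 0"
  using irreducible by auto

lemmas \<phi>_simps = functional_simps[OF functional]

text \<open>Otherwise a multiple of \<open>c\<close> equals p^(k-1) modulo p^k, and the vanishing
  moments of c(A)v would spread to the value of \<open>\<phi>\<close> on the socle.\<close>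

lemma nondegenerate:
  assumes c: "degree c < d" and z: "\<And>i. i < d \<Longrightarrow> \<phi> (A ^ i \<rhd> pev c A \<rhd> v) = 0"
  shows "c = 0"
proof (rule ccontr)
  assume "c \<noteq> 0"
  then obtain r s where rs: "r * c + s * p ^ k = p ^ (k - 1)"
    using poly_bezout_socle[OF irreducible _ c] by blast
  have "pev (p ^ (k - 1)) A \<rhd> v = pev r A \<rhd> pev c A \<rhd> v"
    using annihilates(1) unfolding rs[symmetric] by simp
  moreover have "\<phi> (pev r A \<rhd> pev c A \<rhd> v) = 0"
    by (rule functional_pev_reduce[OF functional pk_nonzero annihilates(2) z])
  ultimately show False using socle by simp
qed

definition H :: "'a mat" where
  "H = mat d d (\<lambda>(i, j). \<phi> (A ^ (i + j) \<rhd> v))"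

text \<open>A kernel vector, read as the coefficients of a polynomial of degree below
  \<open>d\<close>, would violate \<open>nondegenerate\<close>.\<close>

lemma det_H: "det H \<noteq> 0"
proof
  assume "det H = 0"
  moreover have H: "H \<in> carrier_mat d d" by (simp add: H_def)
  ultimately obtain w where w: "w \<in> carrier_vec d" "w \<noteq> 0\<^sub>v d" "H *\<^sub>v w = 0\<^sub>v d"
    using det_0_iff_vec_prod_zero_field[OF H] by auto
  have d0: "d > 0" using w by (cases d) auto
  let ?c = "\<Sum>j<d. monom (w $ j) j"
  have cc: "coeff ?c i = (if i < d then w $ i else 0)" for i
    by (simp add: coeff_sum if_distrib[of "\<lambda>x. x $ _"] cong: if_cong)
  have "degree ?c < d"
    using d0 by (intro degree_lessI) (auto simp: cc)
  moreover have "\<phi> (A ^ i \<rhd> pev ?c A \<rhd> v) = 0" if i: "i < d" for i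
  proof -
    have "\<phi> (A ^ i \<rhd> pev ?c A \<rhd> v) = (\<Sum>j<d. w $ j * \<phi> (A ^ (i + j) \<rhd> v))"
      using calculation
      by (simp add: pev_eq_0_degree cc app_sum_endo app_sum app_sc_commute app_power_add
          functional_sum[OF functional] \<phi>_simps)
    also have "\<dots> = (H *\<^sub>v w) $ i"
      using i w(1) by (simp add: H_def scalar_prod_def lessThan_atLeast0 mult.commute)
    finally show ?thesis using w(3) i by simp
  qed
  ultimately have "?c = 0" by (rule nondegenerate)
  have "w = 0\<^sub>v d"
  proof (rule eq_vecI)
    fix i assume "i < dim_vec (0\<^sub>v d :: 'a vec)"
    then show "w $ i = 0\<^sub>v d $ i" using cc[of i] \<open>?c = 0\<close> by simp
  qed (use w in auto)
  then show False using w(2) by simp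
qed

definition G :: "'a mat" where
  "G = (SOME G. G \<in> carrier_mat d d \<and> G * H = 1\<^sub>m d \<and> H * G = 1\<^sub>m d)"

lemma G: "G \<in> carrier_mat d d" "G * H = 1\<^sub>m d" "H * G = 1\<^sub>m d"
proof -
  have H: "H \<in> carrier_mat d d" by (simp add: H_def)
  have "\<exists>G. G \<in> carrier_mat d d \<and> G * H = 1\<^sub>m d \<and> H * G = 1\<^sub>m d"
    using det_non_zero_imp_unit[OF H det_H, of "()"] by (auto simp: Units_def ring_mat_def)
  from someI_ex[OF this] show "G \<in> carrier_mat d d" "G * H = 1\<^sub>m d" "H * G = 1\<^sub>m d"
    by (simp_all add: G_def)
qed

lemma G_H: "i < d \<Longrightarrow> j < d \<Longrightarrow> (\<Sum>l<d. G $$ (i, l) * \<phi> (A ^ (l + j) \<rhd> v)) = (if i = j then 1 else 0)"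
  using arg_cong[OF G(2), of "\<lambda>M. M $$ (i, j)"] G(1)
  by (simp add: H_def scalar_prod_def lessThan_atLeast0)

lemma H_G: "i < d \<Longrightarrow> j < d \<Longrightarrow> (\<Sum>l<d. \<phi> (A ^ (i + l) \<rhd> v) * G $$ (l, j)) = (if i = j then 1 else 0)"
  using arg_cong[OF G(3), of "\<lambda>M. M $$ (i, j)"] G(1)
  by (simp add: H_def scalar_prod_def lessThan_atLeast0)

text \<open>The inverse Hankel matrix turns moments into coordinates, making \<open>q\<close> dual
  to the vectors A^i v.\<close>

definition q :: "nat \<Rightarrow> (nat \<Rightarrow> 'a) \<Rightarrow> 'a" where
  "q i u = (\<Sum>l<d. G $$ (i, l) * \<phi> (A ^ l \<rhd> u))"

text \<open>Projection onto the cyclic subspace of \<open>v\<close> along the vectors all of whose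
  moments vanish.\<close>

definition E :: "'a endo" where
  "E = (\<Sum>i<d. rank1 (q i) (A ^ i \<rhd> v))"

lemma functional_q: "functional (q i)"
  unfolding q_def by (intro functional_lincomb functional_comp functional)

lemma app_E: "E \<rhd> u = (\<Sum>i<d. sc (q i u) \<rhd> A ^ i \<rhd> v)"
  by (simp add: E_def app_sum_endo app_rank1[OF functional_q])

lemma basis: "basis_of E d (\<lambda>i. A ^ i \<rhd> v) q"
  by (auto simp: basis_of_def functional_q app_E q_def app_power_add G_H)

lemma E_image: "\<exists>c. E \<rhd> u = pev c A \<rhd> v"
proof
  have "pev (\<Sum>i<m. monom (f i) i) A = (\<Sum>i<m. sc (f i) * A ^ i)" for m f
    by (subst pev_eq_sum[of m]) (auto simp: coeff_sum intro!: sum.cong)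
  then show "E \<rhd> u = pev (\<Sum>i<d. monom (q i u) i) A \<rhd> v"
    by (simp add: app_E app_sum_endo)
qed

lemma E_fix: "E \<rhd> pev c A \<rhd> v = pev c A \<rhd> v"
proof -
  obtain f where "pev c A \<rhd> v = (\<Sum>i<d. sc (f i) \<rhd> A ^ i \<rhd> v)"
    using pev_vector_reduce[OF pk_nonzero annihilates(1)] by blast
  then show ?thesis using basis_of_fix[OF basis] by (simp add: app_sum app_sc_commute)
qed

lemma E_v: "E \<rhd> v = v"
  using E_fix[of 1] by simp

lemma E_kill: "(\<And>j. \<phi> (A ^ j \<rhd> u) = 0) \<Longrightarrow> E \<rhd> u = 0"
  by (simp add: app_E q_def)

text \<open>The defect u - Eu has vanishing moments below \<open>d\<close> because H G = 1, and
  hence all its moments vanish.\<close>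

lemma \<phi>_E: "\<phi> (pev c A \<rhd> E \<rhd> u) = \<phi> (pev c A \<rhd> u)"
proof -
  have *: "\<phi> (A ^ j \<rhd> (u - E \<rhd> u)) = 0" if j: "j < d" for j
  proof -
    have "\<phi> (A ^ j \<rhd> E \<rhd> u) = (\<Sum>i<d. \<Sum>l<d. \<phi> (A ^ l \<rhd> u) * (\<phi> (A ^ (j + i) \<rhd> v) * G $$ (i, l)))"
      by (simp add: app_E app_sum app_sc_commute functional_sum[OF functional] \<phi>_simps app_power_add
          q_def sum_distrib_left sum_distrib_right mult_ac)
    also have "\<dots> = (\<Sum>l<d. \<phi> (A ^ l \<rhd> u) * (\<Sum>i<d. \<phi> (A ^ (j + i) \<rhd> v) * G $$ (i, l)))"
      by (subst sum.swap) (simp add: sum_distrib_left)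
    also have "\<dots> = (\<Sum>l<d. if j = l then \<phi> (A ^ l \<rhd> u) else 0)"
      using j by (intro sum.cong) (auto simp: H_G)
    also have "\<dots> = \<phi> (A ^ j \<rhd> u)" using j by simp
    finally show ?thesis by (simp add: \<phi>_simps)
  qed
  have "\<phi> (pev c A \<rhd> (u - E \<rhd> u)) = 0"
    by (rule functional_pev_reduce[OF functional pk_nonzero annihilates(2) *])
  then show ?thesis by (simp add: \<phi>_simps)
qed

lemma \<phi>_E_power: "\<phi> (A ^ j \<rhd> E \<rhd> u) = \<phi> (A ^ j \<rhd> u)"
  using \<phi>_E[of "monom 1 j" u] by (simp add: pev_monom)

text \<open>Image and kernel are both \<open>A\<close>-invariant: the kernel is cut out by moments,
  and \<open>A\<close> only shifts them.\<close>

lemma E_commute: "A * E = E * A"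
proof (rule endo_eqI)
  fix u
  obtain c where c: "E \<rhd> u = pev c A \<rhd> v" using E_image by blast
  have 1: "E \<rhd> A \<rhd> E \<rhd> u = A \<rhd> E \<rhd> u"
    using E_fix[of "pCons 0 c"] by (simp add: c)
  have "E \<rhd> A \<rhd> (u - E \<rhd> u) = 0"
  proof (rule E_kill)
    fix j
    have "A ^ j \<rhd> A \<rhd> w = A ^ Suc j \<rhd> w" for w by (simp add: power_commutes[symmetric] flip: app_endo_simps(6))
    then show "\<phi> (A ^ j \<rhd> A \<rhd> (u - E \<rhd> u)) = 0"
      by (metis \<phi>_E_power \<phi>_simps(5) app_diff right_minus_eq)
  qed
  then show "(A * E) \<rhd> u = (E * A) \<rhd> u" using 1 by simp
qed

lemma rank_E: "has_rank E d"
  using basis by (auto simp: has_rank_def)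

lemma E_nonzero: "E \<noteq> 0"
  using E_v socle by (auto simp: \<phi>_simps)

lemma acts_as_companion:
  assumes "monic p"
  shows "acts_as A E (companion_mat (p ^ k))"
  unfolding acts_as_def
proof (intro exI conjI allI impI)
  show "basis_of E d (\<lambda>i. A ^ i \<rhd> v) q" by (rule basis)
  show "companion_mat (p ^ k) \<in> carrier_mat d d" by (simp add: companion_mat_def)
  fix j assume j: "j < d"
  show "A \<rhd> A ^ j \<rhd> v = (\<Sum>i<d. sc (companion_mat (p ^ k) $$ (i, j)) \<rhd> A ^ i \<rhd> v)"
  proof (cases "Suc j = d")
    case True
    have "monic (p ^ k)" using assms by (rule monic_power)
    then have "0 = (\<Sum>i<Suc d. sc (coeff (p ^ k) i) * A ^ i) \<rhd> v" "lead_coeff (p ^ k) = 1"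
      using annihilates(1) pev_eq_0_degree[of "p ^ k" "Suc d" A] by simp_all
    then have "0 = (\<Sum>i<d. sc (coeff (p ^ k) i) \<rhd> A ^ i \<rhd> v) + A ^ d \<rhd> v"
      by (simp add: app_sum_endo)
    then have "A ^ d \<rhd> v = (\<Sum>i<d. sc (- coeff (p ^ k) i) \<rhd> A ^ i \<rhd> v)"
      by (simp add: sum_negf eq_neg_iff_add_eq_0 add.commute)
    also have "\<dots> = (\<Sum>i<d. sc (companion_mat (p ^ k) $$ (i, j)) \<rhd> A ^ i \<rhd> v)"
      using True j by (intro sum.cong) (auto simp: companion_mat_def)
    finally show ?thesis by (simp flip: True)
  next
    case False
    then have "(\<Sum>i<d. sc (companion_mat (p ^ k) $$ (i, j)) \<rhd> A ^ i \<rhd> v)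
        = (\<Sum>i<d. sc (if i = Suc j then 1 else 0) \<rhd> A ^ i \<rhd> v)"
      using j by (intro sum.cong) (auto simp: companion_mat_def)
    then show ?thesis using False j by (simp add: sum_if_eq_sc)
  qed
qed

end

subsection \<open>Operators with finite image\<close>

lemma idempotent_app: "E * E = E \<Longrightarrow> E \<rhd> E \<rhd> u = E \<rhd> u"
  by (metis app_endo_simps(6))

lemma commute_app: "X * Y = Y * X \<Longrightarrow> X \<rhd> Y \<rhd> u = Y \<rhd> X \<rhd> u"
  by (metis app_endo_simps(6))

text \<open>An operator in the corner of \<open>e\<close> is determined by its restriction to the
  finite image of \<open>e\<close>.\<close>

lemma finite_corner:
  fixes e :: "'a::field endo"
  assumes "e * e = e" "finite (range (app e))"
  shows "finite {X. e * X = X \<and> X * e = X}"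
proof (rule inj_on_finite)
  let ?R = "range (app e)"
  show "inj_on (\<lambda>X. restrict (app X) ?R) {X. e * X = X \<and> X * e = X}"
  proof (rule inj_onI, rule endo_eqI)
    fix X Y u
    assume X: "X \<in> {X. e * X = X \<and> X * e = X}" and Y: "Y \<in> {X. e * X = X \<and> X * e = X}"
      and eq: "restrict (app X) ?R = restrict (app Y) ?R"
    have "X \<rhd> e \<rhd> u = Y \<rhd> e \<rhd> u" using fun_cong[OF eq, of "e \<rhd> u"] by simp
    then show "X \<rhd> u = Y \<rhd> u" using X Y by (metis (mono_tags, lifting) app_endo_simps(6) mem_Collect_eq)
  qed
  show "(\<lambda>X. restrict (app X) ?R) ` {X. e * X = X \<and> X * e = X} \<subseteq> ?R \<rightarrow>\<^sub>E ?R"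
  proof (clarsimp simp: PiE_iff)
    fix X u assume "e * X = X"
    then show "X \<rhd> e \<rhd> u \<in> ?R" by (metis app_endo_simps(6) rangeI)
  qed
  show "finite (?R \<rightarrow>\<^sub>E ?R)" using assms(2) by (intro finite_PiE) auto
qed

lemma power_repeats:
  fixes e :: "'a::field endo"
  assumes e: "e * e = e" "finite (range (app e))" and X: "e * X = X * e"
  shows "\<exists>i j. i < j \<and> e * X ^ i = e * X ^ j"
proof -
  have c: "e * X ^ i = X ^ i * e" for i
    using X by (metis power_commuting_commutes)
  have "range (\<lambda>i. e * X ^ i) \<subseteq> {Y. e * Y = Y \<and> Y * e = Y}"
  proof (clarify, intro CollectI conjI)
    fix i
    show "e * (e * X ^ i) = e * X ^ i" by (simp add: mult.assoc[symmetric] e(1))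
    show "e * X ^ i * e = e * X ^ i" by (metis c e(1) mult.assoc)
  qed
  then have "finite (range (\<lambda>i. e * X ^ i))" using finite_corner[OF e] finite_subset by blast
  then have "\<not> inj (\<lambda>i. e * X ^ i)" using finite_imageD by auto
  then show ?thesis by (metis injI linorder_neqE_nat)
qed

text \<open>The usual argument in a finite monoid: from exponent \<open>i\<close> on the powers have
  period \<open>r\<close>, so a positive multiple of \<open>r\<close> that is at least
  \<open>i\<close>, such as \<open>Suc i * r\<close>, gives an idempotent.\<close>

lemma idempotent_power:
  fixes e :: "'a::field endo"
  assumes e: "e * e = e" "finite (range (app e))" and X: "e * X = X * e"
  shows "\<exists>M>0. e * X ^ (M + M) = e * X ^ M"
proof -
  obtain i j where ij: "i < j" "e * X ^ i = e * X ^ j" using power_repeats[OF assms] by blast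
  define r where "r = j - i"
  have step: "e * X ^ (m + r) = e * X ^ m" if im: "i \<le> m" for m
  proof -
    obtain l where m: "m = i + l" using im le_Suc_ex by blast
    have "m + r = j + l" using ij(1) by (simp add: m r_def)
    then have "e * X ^ (m + r) = (e * X ^ j) * X ^ l" by (simp only: power_add mult.assoc)
    also have "\<dots> = e * X ^ m" by (simp only: m ij(2)[symmetric] power_add mult.assoc)
    finally show ?thesis .
  qed
  have steps: "e * X ^ (m + t * r) = e * X ^ m" if "i \<le> m" for m t
  proof (induction t)
    case (Suc t)
    have "e * X ^ (m + Suc t * r) = e * X ^ ((m + t * r) + r)" by (simp add: algebra_simps)
    also have "\<dots> = e * X ^ m" using step[of "m + t * r"] Suc that by simp
    finally show ?case .
  qed simp
  have "r > 0" using ij by (simp add: r_def)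
  then have "i * 1 \<le> Suc i * r" by (intro mult_le_mono) auto
  then have "i \<le> Suc i * r" by simp
  then have "e * X ^ (Suc i * r + Suc i * r) = e * X ^ (Suc i * r)" by (rule steps)
  then show ?thesis using \<open>r > 0\<close> by (intro exI[of _ "Suc i * r"]) simp
qed

text \<open>Repetition of powers makes some t^j - t^i kill a nonzero vector. A polynomial
  \<open>m\<close> of least degree killing some nonzero vector in the image of \<open>E\<close>, the
  vector being free to vary, is irreducible: if m = ab with smaller degrees, either \<open>b\<close>
  kills \<open>u\<close> or \<open>a\<close> kills the nonzero vector b(A)u.\<close>

lemma exists_irreducible_annihilator:
  fixes E :: "'a::field endo"
  assumes E: "E * E = E" "finite (range (app E))" "E * A = A * E" "E \<noteq> 0"
  shows "\<exists>p u. monic p \<and> irreducible p \<and> u \<noteq> 0 \<and> E \<rhd> u = u \<and> pev p A \<rhd> u = 0"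
proof -
  let ?P = "\<lambda>m. monic m \<and> (\<exists>u. u \<noteq> 0 \<and> E \<rhd> u = u \<and> pev m A \<rhd> u = 0)"
  obtain w where w: "E \<rhd> w \<noteq> 0" using E(4) by (metis endo_eqI app_endo_simps(1))
  obtain i j where ij: "i < j" "E * A ^ i = E * A ^ j" using power_repeats[OF E(1-3)] by blast
  have c: "A ^ i \<rhd> E \<rhd> w = E \<rhd> A ^ i \<rhd> w" for i
    using E(3) by (metis power_commuting_commutes app_endo_simps(6))
  have "pev (monom 1 j - monom 1 i) A \<rhd> E \<rhd> w = 0"
    using ij(2) by (simp add: pev_monom c) (metis app_endo_simps(6))
  moreover have "monic (monom 1 j - monom 1 i :: 'a poly)"
  proof -
    have "degree (monom 1 j - monom 1 i :: 'a poly) = j"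
      using ij(1) by (intro antisym degree_le le_degree) auto
    then show ?thesis using ij(1) by simp
  qed
  ultimately have "?P (monom 1 j - monom 1 i)" using w idempotent_app[OF E(1), of w] by blast
  then obtain m where m: "?P m" and min: "\<And>r. ?P r \<Longrightarrow> degree m \<le> degree r"
    using ex_has_least_nat[of ?P _ degree] by blast
  obtain u where u: "u \<noteq> 0" "E \<rhd> u = u" "pev m A \<rhd> u = 0" and monic: "monic m" using m by blast
  then have m0: "m \<noteq> 0" by auto
  have nz: "pev r A \<rhd> u' \<noteq> 0" if "r \<noteq> 0" "degree r < degree m" "u' \<noteq> 0" "E \<rhd> u' = u'" for r u'
    using min[of "Polynomial.smult (inverse (lead_coeff r)) r"] that by auto
  have deg: "degree m > 0"
  proof (rule ccontr)
    assume "\<not> degree m > 0"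
    then obtain a where "m = [:a:]" by (metis degree_eq_zeroE gr0I)
    then show False using u m0 by auto
  qed
  have irr: "irreducible m"
  proof (rule irreducibleI)
    show "\<not> m dvd 1" using deg m0 by (metis is_unit_iff_degree gr_implies_not0)
    fix a b assume ab: "m = a * b"
    then have a0: "a \<noteq> 0" and b0: "b \<noteq> 0" using m0 by auto
    then have dab: "degree m = degree a + degree b" by (simp add: ab degree_mult_eq)
    have cE: "E \<rhd> pev b A \<rhd> u = pev b A \<rhd> u"
      using pev_commute[of E A b] E(3) u(2) by (metis app_endo_simps(6))
    have "\<not> (degree a < degree m \<and> degree b < degree m)"
      using nz[OF b0 _ u(1,2)] nz[OF a0 _ _ cE] u(3) by (auto simp: ab)
    then have "degree a = 0 \<or> degree b = 0" using dab by linarith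
    then show "a dvd 1 \<or> b dvd 1" using a0 b0 is_unit_iff_degree by blast
  qed (use m0 in simp)
  show ?thesis using monic irr u by blast
qed

text \<open>Fitting's lemma: some power of p(A) is idempotent on the image of \<open>E\<close>, and
  its complement projects onto the part where p(A) is nilpotent, which contains \<open>u\<close>.
  Written as \<open>pev c A * E\<close>, the projection commutes with whatever commutes with
  \<open>A\<close> and \<open>E\<close>.\<close>

lemma exists_primary_component:
  fixes E :: "'a::field endo"
  assumes E: "E * E = E" "finite (range (app E))" "E * A = A * E" "E \<noteq> 0"
  shows "\<exists>p k c. monic p \<and> irreducible p \<and> k > 0 \<and>
    pev c A * E * (pev c A * E) = pev c A * E \<and>
    pev (p ^ k) A * (pev c A * E) = 0 \<and> pev (p ^ (k - 1)) A * (pev c A * E) \<noteq> 0"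
proof -
  obtain p u where p: "monic p" "irreducible p" and u: "u \<noteq> 0" "E \<rhd> u = u" "pev p A \<rhd> u = 0"
    using exists_irreducible_annihilator[OF E] by blast
  define X where "X = pev p A"
  have X: "E * X = X * E" unfolding X_def by (rule pev_commute[OF E(3)])
  obtain M where M: "M > 0" "E * X ^ (M + M) = E * X ^ M"
    using idempotent_power[OF E(1,2) X] by blast
  have cX: "E * X ^ j = X ^ j * E" for j using X by (metis power_commuting_commutes)
  define E1 where "E1 = pev (1 - p ^ M) A * E"
  have E1: "E1 = E - X ^ M * E" by (simp add: E1_def X_def algebra_simps)
  have ZZ: "X ^ M * (X ^ M * E) = X ^ M * E"
    by (metis M(2) cX mult.assoc power_add)
  have EX: "E * (X ^ M * E) = X ^ M * E" by (metis cX E(1) mult.assoc)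
  have E1_idem: "E1 * E1 = E1"
    by (simp add: E1 algebra_simps E(1) mult.assoc EX ZZ)
  have null: "X ^ M * E1 = 0" by (simp add: E1 algebra_simps ZZ)
  have "X ^ M \<rhd> u = 0"
    using M(1) u(3) by (cases M) (simp_all add: X_def power_Suc2 del: power_Suc)
  then have "E1 \<rhd> u = u" using u(2) by (simp add: E1)
  then have "E1 \<noteq> 0" using u(1) by auto
  define k where "k = (LEAST k. X ^ k * E1 = 0)"
  have k: "X ^ k * E1 = 0" unfolding k_def by (rule LeastI[of "\<lambda>k. X ^ k * E1 = 0", OF null])
  have k0: "k > 0" using k \<open>E1 \<noteq> 0\<close> by (cases k) auto
  have "X ^ (k - 1) * E1 \<noteq> 0"
    using not_less_Least[of "k - 1" "\<lambda>k. X ^ k * E1 = 0"] k0 by (simp add: k_def)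
  then have "monic p \<and> irreducible p \<and> k > 0 \<and> E1 * E1 = E1 \<and>
      pev (p ^ k) A * E1 = 0 \<and> pev (p ^ (k - 1)) A * E1 \<noteq> 0"
    using p k k0 E1_idem by (simp add: X_def)
  then show ?thesis unfolding E1_def by blast
qed

text \<open>The size of the finite image serves as induction measure. It drops because
  \<open>F\<close> kills the image of \<open>E - F\<close> but not its own.\<close>

lemma card_range_diff_less:
  fixes E F :: "'a::field endo"
  assumes fin: "finite (range (app E))" and F: "F * F = F" "E * F = F" "F * E = F" "F \<noteq> 0"
  shows "card (range (app (E - F))) < card (range (app E))"
proof (rule psubset_card_mono[OF fin])
  obtain w where w: "F \<rhd> w \<noteq> 0" using F(4) by (metis endo_eqI app_endo_simps(1))
  have FEF: "F \<rhd> (E - F) \<rhd> u = 0" for u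
  proof -
    have "F * (E - F) = 0" using F by (simp add: algebra_simps)
    then show ?thesis by (metis app_endo_simps(1,6))
  qed
  have "F \<rhd> w \<in> range (app E)" using F(2) by (metis app_endo_simps(6) rangeI)
  moreover have "F \<rhd> w \<notin> range (app (E - F))"
    using w FEF idempotent_app[OF F(1), of w] by (metis imageE)
  moreover have "range (app (E - F)) \<subseteq> range (app E)"
  proof
    fix y assume "y \<in> range (app (E - F))"
    then obtain u where "y = (E - F) \<rhd> u" by blast
    moreover have "F \<rhd> u = E \<rhd> F \<rhd> u" using F(2) by (metis app_endo_simps(6))
    ultimately have "y = E \<rhd> (u - F \<rhd> u)" by simp
    then show "y \<in> range (app E)" by blast
  qed
  ultimately show "range (app (E - F)) \<subset> range (app E)" by blast
qed

lemma finite_range_diff: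
  assumes "finite (range (app E))" "E * F = F"
  shows "finite (range (app (E - F)))"
proof (rule finite_subset[OF _ assms(1)], rule subsetI)
  fix y assume "y \<in> range (app (E - F))"
  then obtain u where "y = (E - F) \<rhd> u" by blast
  moreover have "F \<rhd> u = E \<rhd> F \<rhd> u" using assms(2) by (metis app_endo_simps(6))
  ultimately have "y = E \<rhd> (u - F \<rhd> u)" by simp
  then show "y \<in> range (app E)" by blast
qed

text \<open>In a primary component a cyclic summand of the largest order splits off: some coordinate
  functional does not vanish on its socle, and the resulting Hankel projection has an
  \<open>A\<close>-invariant complement.\<close>

lemma acts_as_companions:
  fixes E :: "'a::field endo"
  assumes "E * E = E" "finite (range (app E))" "E * A = A * E"
  shows "\<exists>ds. (\<forall>d\<in>set ds. \<exists>p k. monic p \<and> irreducible p \<and> 0 < k \<and> d = p ^ k) \<and>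
    acts_as A E (diag_block_mat (map companion_mat ds))"
  using assms
proof (induction "card (range (app E))" arbitrary: E rule: less_induct)
  case less
  note E = less.prems
  show ?case
  proof (cases "E = 0")
    case True
    then show ?thesis by (intro exI[of _ "[]"]) (simp add: acts_as_0)
  next
    case False
    then obtain p k c where p: "monic p" "irreducible p" "k > 0"
      and idem: "pev c A * E * (pev c A * E) = pev c A * E"
      and null: "pev (p ^ k) A * (pev c A * E) = 0" "pev (p ^ (k - 1)) A * (pev c A * E) \<noteq> 0"
      using exists_primary_component[OF E] by blast
    define E1 where "E1 = pev c A * E"
    have cA: "E * pev c A = pev c A * E" by (rule pev_commute[OF E(3)])
    have E1: "E1 * E1 = E1" "E * E1 = E1" "E1 * E = E1"
      using idem cA E(1) by (simp_all add: E1_def mult.assoc) (metis mult.assoc)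
    have E1A: "E1 * A = A * E1"
      using E(3) pev_commute[of A A c] by (simp add: E1_def mult.assoc) (metis mult.assoc)
    obtain w where "(pev (p ^ (k - 1)) A * E1) \<rhd> w \<noteq> 0"
      using null(2) unfolding E1_def[symmetric] by (metis endo_eqI app_endo_simps(1))
    then obtain i where i: "(pev (p ^ (k - 1)) A \<rhd> E1 \<rhd> w) i \<noteq> 0"
      by (metis app_endo_simps(6) ext zero_fun_apply)
    have cE1: "E1 \<rhd> pev r A \<rhd> u = pev r A \<rhd> E1 \<rhd> u" for r u
      by (rule commute_app[OF pev_commute[OF E1A]])
    \<comment> \<open>Composing the coordinate with \<open>E1\<close> makes the functional vanish on
      the image of p^k(A).\<close>
    interpret hankel A p k "E1 \<rhd> w" "\<lambda>u. (E1 \<rhd> u) i"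
    proof
      show "functional (\<lambda>u. (E1 \<rhd> u) i)" by (rule functional_comp[OF functional_coordinate])
      have z: "pev (p ^ k) A \<rhd> E1 \<rhd> u = 0" for u
        using null(1) unfolding E1_def[symmetric] by (metis app_endo_simps(1,6))
      then show "pev (p ^ k) A \<rhd> E1 \<rhd> w = 0" "(E1 \<rhd> pev (p ^ k) A \<rhd> u) i = 0" for u
        by (simp_all add: cE1 zero_fun_apply del: pev_power)
      show "(E1 \<rhd> pev (p ^ (k - 1)) A \<rhd> E1 \<rhd> w) i \<noteq> 0"
        using i by (simp add: cE1 idempotent_app[OF E1(1)] del: pev_power)
    qed (rule p)
    define F where "F = local.E"
    have E1F: "E1 * F = F"
    proof (rule endo_eqI)
      fix u
      obtain c where "F \<rhd> u = pev c A \<rhd> E1 \<rhd> w" using E_image unfolding F_def by blast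
      then show "(E1 * F) \<rhd> u = F \<rhd> u" by (simp add: cE1 idempotent_app[OF E1(1)])
    qed
    have FE1: "F * E1 = F"
    proof (rule endo_eqI)
      fix u
      have "F \<rhd> (u - E1 \<rhd> u) = 0"
        unfolding F_def
      proof (rule E_kill)
        fix j
        have "E1 \<rhd> A ^ j \<rhd> (u - E1 \<rhd> u) = A ^ j \<rhd> E1 \<rhd> (u - E1 \<rhd> u)"
          using cE1[of "monom 1 j"] by (simp only: pev_monom)
        then show "(E1 \<rhd> A ^ j \<rhd> (u - E1 \<rhd> u)) i = 0"
          by (simp add: idempotent_app[OF E1(1)] zero_fun_apply)
      qed
      then show "(F * E1) \<rhd> u = F \<rhd> u" by simp
    qed
    have F: "F * F = F" "E * F = F" "F * E = F" "F \<noteq> 0" "F * A = A * F"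
      using has_rank_idem[OF rank_E] E_nonzero E_commute E1F FE1 E1
      unfolding F_def[symmetric] by (metis mult.assoc)+
    have "acts_as A F (companion_mat (p ^ k))"
      unfolding F_def by (rule acts_as_companion[OF p(1)])
    moreover obtain ds where ds: "\<forall>d\<in>set ds. \<exists>p k. monic p \<and> irreducible p \<and> 0 < k \<and> d = p ^ k"
      and ac: "acts_as A (E - F) (diag_block_mat (map companion_mat ds))"
      using less.hyps[of "E - F"] card_range_diff_less[OF E(2) F(1-4)] finite_range_diff[OF E(2) F(2)]
        E F by (auto simp: algebra_simps)
    moreover have "F * (E - F) = 0" "(E - F) * F = 0" using F by (simp_all add: algebra_simps)
    ultimately have "acts_as A E (diag_block_mat (map companion_mat (p ^ k # ds)))"
      using acts_as_add[of A F _ "E - F"] by (simp add: Let_def)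
    then show ?thesis using ds p by (intro exI[of _ "p ^ k # ds"]) auto
  qed
qed

section \<open>Isometries of a symmetric form\<close>

text \<open>The form is defined on all sequences; the last two assumptions make the kernel of
  \<open>e\<close> its radical.\<close>

locale form_space =
  fixes e :: "'a::field endo" and b :: "(nat \<Rightarrow> 'a) \<Rightarrow> (nat \<Rightarrow> 'a) \<Rightarrow> 'a"
  assumes two: "(2::'a) \<noteq> 0"
    and b_add: "b (u + v) w = b u w + b v w"
    and b_sc: "b (sc c \<rhd> u) w = c * b u w"
    and b_sym: "b u v = b v u"
    and e_idem: "e * e = e" and e_finite: "finite (range (app e))"
    and b_e: "b (e \<rhd> u) v = b u v"
    and nondegenerate: "(\<And>v. b u v = 0) \<Longrightarrow> e \<rhd> u = 0"
begin

lemma functional_b: "functional (b u)"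
  by (simp add: functional_def b_sym[of u] b_add b_sc)

lemmas b_right = functional_simps[OF functional_b]

lemma b_left: "b 0 w = 0" "b (- u) w = - b u w" "b (u - v) w = b u w - b v w"
  by (simp_all add: b_sym[of _ w] b_right)

lemmas b_simps = b_add b_sc b_right b_left

lemma b_e': "b u (e \<rhd> v) = b u v"
  using b_e[of v u] by (simp add: b_sym)

text \<open>A relation and not a function: adjoints are determined only modulo the kernel of
  \<open>e\<close>.\<close>

definition adjoint :: "'a endo \<Rightarrow> 'a endo \<Rightarrow> bool" where
  "adjoint X Y \<longleftrightarrow> (\<forall>u v. b (X \<rhd> u) v = b u (Y \<rhd> v))"

lemma adjoint_mult: "adjoint X X' \<Longrightarrow> adjoint Y Y' \<Longrightarrow> adjoint (X * Y) (Y' * X')"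
  by (simp add: adjoint_def)

lemma adjoint_add: "adjoint X X' \<Longrightarrow> adjoint Y Y' \<Longrightarrow> adjoint (X + Y) (X' + Y')"
  by (simp add: adjoint_def b_simps)

lemma adjoint_diff: "adjoint X X' \<Longrightarrow> adjoint Y Y' \<Longrightarrow> adjoint (X - Y) (X' - Y')"
  by (simp add: adjoint_def b_simps)

lemma adjoint_minus: "adjoint X X' \<Longrightarrow> adjoint (- X) (- X')"
  by (simp add: adjoint_def b_simps)

lemma adjoint_sc: "adjoint (sc c) (sc c)"
  by (simp add: adjoint_def b_simps)

lemma adjoint_0: "adjoint 0 0"
  by (simp add: adjoint_def b_simps)

lemma adjoint_1: "adjoint 1 1"
  by (simp add: adjoint_def)

lemma adjoint_e: "adjoint e e"
  by (simp add: adjoint_def b_e b_e')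

lemma adjoint_sym: "adjoint X Y \<Longrightarrow> adjoint Y X"
  by (metis adjoint_def b_sym)

lemma adjoint_power: "adjoint X Y \<Longrightarrow> adjoint (X ^ m) (Y ^ m)"
proof (induction m)
  case (Suc m)
  then have "adjoint (X * X ^ m) (Y ^ m * Y)" by (intro adjoint_mult) auto
  then show ?case by (simp add: power_commutes)
qed (simp add: adjoint_1)

lemma adjoint_unique:
  assumes "adjoint X Z" "adjoint Y Z"
  shows "e * X = e * Y"
proof (rule endo_eqI)
  fix u
  have "e \<rhd> (X \<rhd> u - Y \<rhd> u) = 0"
    using assms by (intro nondegenerate) (simp add: adjoint_def b_simps)
  then show "(e * X) \<rhd> u = (e * Y) \<rhd> u" by simp
qed

text \<open>Self-adjoint idempotents below \<open>e\<close>, that is, orthogonal projections onto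
  nondegenerate subspaces of its image.\<close>

definition sai :: "'a endo \<Rightarrow> bool" where
  "sai E \<longleftrightarrow> E * E = E \<and> e * E = E \<and> E * e = E \<and> adjoint E E"

lemma saiD:
  assumes "sai E"
  shows "E * E = E" "e * E = E" "E * e = E" "adjoint E E" "E \<rhd> E \<rhd> u = E \<rhd> u" "e \<rhd> E \<rhd> u = E \<rhd> u"
    "b (E \<rhd> u) v = b u (E \<rhd> v)"
proof -
  show E: "E * E = E" "e * E = E" "E * e = E" "adjoint E E" using assms unfolding sai_def by blast+
  show "E \<rhd> E \<rhd> u = E \<rhd> u" "e \<rhd> E \<rhd> u = E \<rhd> u" using E(1,2) by (metis app_endo_simps(6))+
  show "b (E \<rhd> u) v = b u (E \<rhd> v)" using E(4) unfolding adjoint_def by blast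
qed

lemma sai_0: "sai 0"
  by (simp add: sai_def adjoint_0)

lemma sai_e: "sai e"
  by (simp add: sai_def e_idem adjoint_e)

text \<open>Taking adjoints reverses products, so one-sided relations between such projections
  become two-sided.\<close>

lemma sai_swap:
  assumes "sai E" "sai F" "E * F = 0"
  shows "F * E = 0"
proof -
  have "adjoint (E * F) (F * E)" using assms by (intro adjoint_mult) (auto dest: saiD)
  then have "e * (F * E) = e * 0"
    using assms(3) adjoint_0 by (intro adjoint_unique[of _ 0]) (auto intro: adjoint_sym)
  then show ?thesis using saiD(2)[OF assms(2)] by (simp add: mult.assoc[symmetric])
qed

lemma sai_absorb:
  assumes "sai E" "sai F" "E * F = F"
  shows "F * E = F"
proof -
  have "adjoint (E * F) (F * E)" using assms by (intro adjoint_mult) (auto dest: saiD)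
  then have "e * (F * E) = e * F"
    using assms(3) saiD(4)[OF assms(2)] by (intro adjoint_unique[of _ F]) (auto intro: adjoint_sym)
  then show ?thesis using saiD(2)[OF assms(2)] by (simp add: mult.assoc[symmetric])
qed

lemma sai_add:
  assumes "sai E" "sai F" "E * F = 0"
  shows "sai (E + F)"
  using assms sai_swap[OF assms] by (auto simp: sai_def algebra_simps intro: adjoint_add)

lemma sai_diff:
  assumes "sai E" "sai F" "E * F = F"
  shows "sai (E - F)"
  using assms sai_absorb[OF assms] by (auto simp: sai_def algebra_simps intro: adjoint_diff)

lemma finite_range_sai: "sai E \<Longrightarrow> finite (range (app E))"
  by (rule finite_subset[OF _ e_finite]) (metis image_subsetI rangeI saiD(6))

text \<open>b(u, Yu) is the quadratic form of the symmetric form b(Yu, w), and polarization recovers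
  the latter because 2 is invertible.\<close>

lemma nonisotropic_vector:
  assumes Y: "adjoint Y Y" "e * Y = Y" "Y \<noteq> 0"
  shows "\<exists>u. b u (Y \<rhd> u) \<noteq> 0"
proof (rule ccontr)
  assume "\<not> ?thesis"
  then have z: "b u (Y \<rhd> u) = 0" for u by blast
  have "b (Y \<rhd> u) w = 0" for u w
  proof -
    have "b u (Y \<rhd> w) = b (Y \<rhd> u) w" "b w (Y \<rhd> u) = b (Y \<rhd> u) w"
      using Y(1) by (simp_all add: adjoint_def b_sym[of w])
    then have "2 * b (Y \<rhd> u) w = 0" using z[of "u + w"] by (simp add: b_simps z)
    then show ?thesis using two by simp
  qed
  then have "e \<rhd> Y \<rhd> u = 0" for u by (rule nondegenerate)
  then have "Y = 0" using Y(2) by (intro endo_eqI) (metis app_endo_simps(1,6))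
  then show False using Y(3) by blast
qed

text \<open>A nonzero quadratic form and a nonzero additive map have a common point where both do not
  vanish: \<open>Q(u + w) + Q(u - w) = 2 Q(u) + 2 Q(w)\<close>.\<close>

lemma nonisotropic_vector_avoiding:
  fixes f :: "(nat \<Rightarrow> 'a) \<Rightarrow> 'c::ab_group_add"
  assumes Y: "adjoint Y Y" "e * Y = Y" "Y \<noteq> 0"
    and f: "\<And>u v. f (u + v) = f u + f v" "f w \<noteq> 0"
  shows "\<exists>u. b u (Y \<rhd> u) \<noteq> 0 \<and> f u \<noteq> 0"
proof (rule ccontr)
  assume n: "\<not> ?thesis"
  obtain u where u: "b u (Y \<rhd> u) \<noteq> 0" using nonisotropic_vector[OF Y] by blast
  have f0: "f 0 = 0" using f(1)[of 0 0] by simp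
  have fm: "f (- z) = - f z" for z using f(1)[of z "- z"] f0 by (simp add: eq_neg_iff_add_eq_0 add.commute)
  have fu: "f u = 0" using n u by blast
  have "f (w + u) \<noteq> 0" "f (w - u) \<noteq> 0"
    using f fu f(1)[of w "- u"] by (simp_all add: fm)
  then have "b (w + u) (Y \<rhd> (w + u)) = 0" "b (w - u) (Y \<rhd> (w - u)) = 0" "b w (Y \<rhd> w) = 0"
    using n f(2) by blast+
  then have "2 * b u (Y \<rhd> u) = 0" by (simp add: b_simps algebra_simps)
  then show False using u two by simp
qed

end

section \<open>Self-adjoint and skew-adjoint parts of an isometry\<close>

locale isometry = form_space +
  fixes g g' :: "'a endo"
  assumes g_inv: "g * g' = 1" "g' * g = 1" and g_e: "e * g = g * e"
    and g_iso: "b (g \<rhd> u) (g \<rhd> v) = b u v"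
begin

definition x :: "'a endo" where "x = g + g'"

definition S :: "'a endo" where "S = g - g'"

lemma g'_e: "e * g' = g' * e"
  by (metis g_e g_inv mult.assoc mult.left_neutral mult.right_neutral)

lemma adjoint_g: "adjoint g g'" "adjoint g' g"
proof -
  show "adjoint g g'"
    unfolding adjoint_def
  proof (intro allI)
    fix u v
    have "g \<rhd> g' \<rhd> v = v" using g_inv by (metis app_endo_simps(2,6))
    then show "b (g \<rhd> u) v = b u (g' \<rhd> v)" using g_iso[of u "g' \<rhd> v"] by simp
  qed
  then show "adjoint g' g" by (rule adjoint_sym)
qed

lemma adjoint_x: "adjoint x x"
  using adjoint_add[OF adjoint_g] by (simp add: x_def add.commute)

lemma adjoint_S: "adjoint S (- S)"
  using adjoint_diff[OF adjoint_g] by (simp add: S_def)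

lemma x_S: "x * S = S * x"
  by (simp add: x_def S_def algebra_simps g_inv)

lemma S_S: "S * S = x * x - 4"
  by (simp add: x_def S_def algebra_simps g_inv)

lemma x_e: "e * x = x * e"
  by (simp add: x_def algebra_simps g_e g'_e)

lemma S_e: "e * S = S * e"
  by (simp add: S_def algebra_simps g_e g'_e)

definition act :: "'a poly \<Rightarrow> (nat \<Rightarrow> 'a) \<Rightarrow> nat \<Rightarrow> 'a" where
  "act c u = pev c x \<rhd> u"

lemma act_simps [simp]:
  "act (c * d) u = act c (act d u)" "act (c + d) u = act c u + act d u" "act 1 u = u"
  "act (c - d) u = act c u - act d u" "act (Polynomial.smult r c) u = sc r \<rhd> act c u"
  "act [:r:] u = sc r \<rhd> u" "act 0 u = 0"
  "act c (u + v) = act c u + act c v" "act c (u - v) = act c u - act c v" "act c (- u) = - act c u"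
  "act c 0 = 0" "act c (sc r \<rhd> u) = sc r \<rhd> act c u"
  by (simp_all add: act_def app_sc_commute)

lemma act_commute: "X * x = x * X \<Longrightarrow> X \<rhd> act c u = act c (X \<rhd> u)"
  unfolding act_def by (rule commute_app[OF pev_commute])

lemma act_act_commute: "act c (act d u) = act d (act c u)"
  by (metis act_simps(1) mult.commute)

lemma S_act: "S \<rhd> act c u = act c (S \<rhd> u)"
  by (rule act_commute) (simp add: x_S)

lemma e_act: "e \<rhd> act c u = act c (e \<rhd> u)"
  by (rule act_commute) (simp add: x_e)

lemma adjoint_pev: "adjoint (pev c x) (pev c x)"
proof (induction c)
  case (pCons a c)
  then have "adjoint (sc a + x * pev c x) (sc a + pev c x * x)"
    by (intro adjoint_add adjoint_mult adjoint_sc adjoint_x)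
  then show ?case using pev_commute[of x x c] by simp
qed (simp add: adjoint_0)

lemma b_act: "b (act c u) v = b u (act c v)"
  using adjoint_pev by (simp add: act_def adjoint_def)

lemma b_S: "b (S \<rhd> u) v = - b u (S \<rhd> v)"
  using adjoint_S by (simp add: adjoint_def b_simps)

lemma S_S_app: "S \<rhd> S \<rhd> u = act [:-4, 0, 1:] u"
proof -
  have "S \<rhd> S \<rhd> u = (S * S) \<rhd> u" by simp
  also have "\<dots> = act [:-4, 0, 1:] u"
    by (simp add: S_S act_def sc_numeral)
  finally show ?thesis .
qed

text \<open>c(x)S is skew, so every vector pairs to 0 with its image. This makes F[x]u and F[x]Su
  orthogonal for every u.\<close>

lemma b_S_self: "b u (act c (S \<rhd> u)) = 0"
proof -
  have "b u (act c (S \<rhd> u)) = - b (S \<rhd> u) (act c u)"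
    by (simp add: b_S S_act[symmetric])
  also have "\<dots> = - b u (act c (S \<rhd> u))" by (subst b_sym) (simp add: b_act)
  finally have "2 * b u (act c (S \<rhd> u)) = 0" by (metis add.right_inverse mult_2)
  then show ?thesis using two by simp
qed

subsection \<open>Self-adjoint projections onto cyclic subspaces\<close>

definition cyclic_proj :: "'a endo \<Rightarrow> (nat \<Rightarrow> 'a) \<Rightarrow> bool" where
  "cyclic_proj E v \<longleftrightarrow> sai E \<and> E * x = x * E \<and> (\<forall>u. \<exists>c. E \<rhd> u = act c v) \<and> E \<rhd> v = v"

lemma cyclic_projD:
  assumes "cyclic_proj E v"
  shows "sai E" "E * x = x * E" "\<exists>c. E \<rhd> u = act c v" "E \<rhd> act c u = act c (E \<rhd> u)" "E \<rhd> v = v"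
    "b v (act c (E \<rhd> u)) = b v (act c u)" "e \<rhd> v = v"
proof -
  show E: "sai E" "E * x = x * E" "\<exists>c. E \<rhd> u = act c v" "E \<rhd> v = v"
    using assms unfolding cyclic_proj_def by blast+
  show a: "E \<rhd> act c u = act c (E \<rhd> u)" for c u by (rule act_commute[OF E(2)])
  show "b v (act c (E \<rhd> u)) = b v (act c u)"
    using saiD(7)[OF E(1), of v "act c u"] by (simp add: E(4) a)
  show "e \<rhd> v = v" using saiD(6)[OF E(1), of v] E(4) by simp
qed

lemma cyclic_proj_kill:
  assumes E: "cyclic_proj E v" and z: "\<And>c. b v (act c u) = 0"
  shows "E \<rhd> u = 0"
proof -
  have "b (E \<rhd> u) w = 0" for w
  proof -
    obtain c where "E \<rhd> w = act c v" using cyclic_projD(3)[OF E] by blast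
    then have "b (E \<rhd> u) w = b v (act c u)"
      using saiD(7)[OF cyclic_projD(1)[OF E], of u w] b_act[of c u v] b_sym[of "act c u" v] by simp
    then show ?thesis using z by simp
  qed
  then have "e \<rhd> E \<rhd> u = 0" by (rule nondegenerate)
  then show ?thesis using saiD(6)[OF cyclic_projD(1)[OF E]] by simp
qed

lemma cyclic_proj_orthogonal:
  assumes E: "cyclic_proj E v" and F: "cyclic_proj F w" and z: "\<And>c. b v (act c w) = 0"
  shows "E * F = 0"
proof (rule endo_eqI)
  fix u
  obtain c where "F \<rhd> u = act c w" using cyclic_projD(3)[OF F] by blast
  moreover have "E \<rhd> act c w = 0"
    by (rule cyclic_proj_kill[OF E]) (use z[of "_ * c"] in simp)
  ultimately show "(E * F) \<rhd> u = 0 \<rhd> u" by simp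
qed

text \<open>With pairing by \<open>v\<close> as the functional, both annihilation conditions of the
  Hankel construction coincide since \<open>x\<close> is self-adjoint. The projection is
  self-adjoint because b(Eu, w) = b(Eu, Ew) = b(u, Ew).\<close>

lemma exists_cyclic_proj:
  assumes p: "irreducible p" and v: "e \<rhd> v = v" "act (p ^ k) v = 0" "b v (act (p ^ (k - 1)) v) \<noteq> 0"
  shows "\<exists>E. cyclic_proj E v \<and> has_rank E (degree (p ^ k)) \<and> E \<noteq> 0"
proof -
  interpret hankel x p k v "b v"
    using p v b_act[of "p ^ k" v] by unfold_locales (auto simp: functional_b act_def b_simps)
  have im: "\<exists>c. E \<rhd> u = act c v" for u using E_image by (simp add: act_def)
  have bE: "b (E \<rhd> u) (E \<rhd> w) = b (E \<rhd> u) w" for u w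
    using im[of u] \<phi>_E by (metis act_def b_act)
  have "adjoint E E" unfolding adjoint_def by (metis bE b_sym)
  moreover have "e * E = E"
    by (rule endo_eqI) (use im v(1) in \<open>metis app_endo_simps(6) e_act\<close>)
  moreover have "E * e = E"
  proof (rule endo_eqI)
    fix u
    have "E \<rhd> (u - e \<rhd> u) = 0"
      by (rule E_kill) (metis act_def b_act b_e' b_right(5) diff_self pev_monom)
    then show "(E * e) \<rhd> u = E \<rhd> u" by simp
  qed
  ultimately have "cyclic_proj E v"
    using has_rank_idem[OF rank_E] im E_commute E_v by (auto simp: cyclic_proj_def sai_def)
  then show ?thesis using rank_E E_nonzero by blast
qed

subsection \<open>Inverting pairs\<close>

text \<open>If \<open>(P, N)\<close> is an inverting pair, then \<open>P - N\<close> is an involution on the image of \<open>P + N\<close> that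
  conjugates \<open>g\<close> to its inverse.\<close>

definition inverting_pair :: "'a endo \<Rightarrow> 'a endo \<Rightarrow> bool" where
  "inverting_pair P N \<longleftrightarrow> sai P \<and> sai N \<and> P * N = 0 \<and> P * x = x * P \<and> N * x = x * N \<and>
     S * P = N * S \<and> S * N = P * S"

text \<open>It suffices that \<open>S\<close> maps each image into the other: as \<open>S\<close> is
  skew, the adjoint of P S N = S N reads N S P = N S, and together with N S P = S P this gives S P =
  N S.\<close>

lemma inverting_pairI:
  assumes P: "sai P" "P * x = x * P" and N: "sai N" "N * x = x * N" and o: "P * N = 0"
    and 1: "N * S * P = S * P" and 2: "P * S * N = S * N"
  shows "inverting_pair P N"
proof -
  have swap: "N * S * P = N * S" if N: "sai N" and P: "sai P" and eq: "P * S * N = S * N" for P N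
  proof -
    have "adjoint (N * S * P) (P * (- S * N))" "adjoint (N * S) (- S * N)"
      by (intro adjoint_mult adjoint_S saiD(4) N P)+
    then have "e * (N * S * P) = e * (N * S)"
      using eq by (intro adjoint_unique) (auto simp: mult.assoc)
    then show ?thesis using saiD(2)[OF N] by (simp add: mult.assoc[symmetric])
  qed
  show ?thesis
    using assms swap[OF N(1) P(1) 2] swap[OF P(1) N(1) 1] by (simp add: inverting_pair_def)
qed

lemma inverting_pair_sym: "inverting_pair P N \<Longrightarrow> inverting_pair N P"
  unfolding inverting_pair_def using sai_swap by blast

lemma inverting_pairD:
  assumes "inverting_pair P N"
  shows "sai P" "sai N" "P * N = 0" "N * P = 0" "P * x = x * P" "N * x = x * N"
    "S * P = N * S" "S * N = P * S" "sai (P + N)"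
    "(P + N) * x = x * (P + N)" "(P + N) * S = S * (P + N)"
  using assms sai_swap[of P N] sai_add[of P N]
  by (auto simp: inverting_pair_def algebra_simps)

lemma inverting_pair_add:
  assumes 1: "inverting_pair P N" and 2: "inverting_pair P' N'" and o: "(P + N) * (P' + N') = 0"
  shows "inverting_pair (P + P') (N + N')" "P * P' = 0" "P' * P = 0" "N * N' = 0" "N' * N = 0"
proof -
  note d1 = inverting_pairD[OF 1] and d2 = inverting_pairD[OF 2]
  have z: "A * B = 0" if "A * (P + N) = A" "(P' + N') * B = B" for A B
    by (metis (no_types) that o mult.assoc mult_zero_left mult_zero_right)
  have P: "P * (P + N) = P" "N * (P + N) = N" "(P' + N') * P' = P'" "(P' + N') * N' = N'"
    using d1 d2 by (simp_all add: algebra_simps saiD)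
  show o': "P * P' = 0" "N * N' = 0" using z P by blast+
  show o'': "P' * P = 0" "N' * N = 0" using o' sai_swap d1(1,2) d2(1,2) by blast+
  have c: "P * N' = 0" "N * P' = 0" using z P by blast+
  then have "P' * N = 0" using sai_swap d1(2) d2(1) by blast
  then show "inverting_pair (P + P') (N + N')"
    using d1 d2 o' c by (auto simp: inverting_pair_def distrib_left distrib_right intro: sai_add)
qed

text \<open>In terms of \<open>g\<close> this describes a Jordan block of size 2l - 1 for the
  eigenvalue \<epsilon>, see \<open>jordan_vector_iff_odd_vector\<close>: F[x]v contributes
  dimension \<open>l\<close> and F[x]Sv dimension l - 1.\<close>

definition odd_vector :: "'a \<Rightarrow> nat \<Rightarrow> (nat \<Rightarrow> 'a) \<Rightarrow> bool" where
  "odd_vector \<epsilon> l v \<longleftrightarrow> \<epsilon> * \<epsilon> = 1 \<and> l > 0 \<and> e \<rhd> v = v \<and> act ([:-2 * \<epsilon>, 1:] ^ l) v = 0 \<and>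
     S \<rhd> act ([:-2 * \<epsilon>, 1:] ^ (l - 1)) v = 0 \<and> b v (act ([:-2 * \<epsilon>, 1:] ^ (l - 1)) v) \<noteq> 0"

end

section \<open>Inverting pairs on a primary component of \<open>x\<close>\<close>

context isometry
begin

lemma cyclic_proj_le:
  assumes E: "cyclic_proj E v" and X: "X * x = x * X" "X \<rhd> v = v"
  shows "X * E = E"
proof (rule endo_eqI)
  fix u
  obtain c where "E \<rhd> u = act c v" using cyclic_projD(3)[OF E] by blast
  then show "(X * E) \<rhd> u = E \<rhd> u" using X by (simp add: act_commute)
qed

lemma skew_sandwich:
  assumes E: "cyclic_proj E v"
  shows "E * S * E = 0"
proof (rule endo_eqI)
  fix u
  obtain c where c: "E \<rhd> u = act c v" using cyclic_projD(3)[OF E] by blast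
  have "E \<rhd> S \<rhd> act c v = 0"
  proof (rule cyclic_proj_kill[OF E])
    fix c' show "b v (act c' (S \<rhd> act c v)) = 0"
      using b_S_self[of v "c' * c"] by (simp add: S_act)
  qed
  then show "(E * S * E) \<rhd> u = 0 \<rhd> u" by (simp add: c)
qed

text \<open>Since \<open>S\<^sup>2 = x\<^sup>2 - 4\<close>, on a primary component of \<open>x\<close> either \<open>S\<close> is invertible, or
  \<open>x - 2\<epsilon>\<close> is nilpotent for some \<open>\<epsilon> = 1, -1\<close>; in the second case the largest Jordan block
  of \<open>g\<close> has odd or even size.\<close>

lemma pair_of_invertible:
  assumes E: "sai E" "E * x = x * E" "E * S = S * E"
    and p: "irreducible p" "\<not> p dvd [:-4, 0, 1:]"
    and null: "\<And>u. act (p ^ k) (E \<rhd> u) = 0" and nz: "pev (p ^ (k - 1)) x * E \<noteq> 0"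
  shows "\<exists>P N d. inverting_pair P N \<and> E * P = P \<and> E * N = N \<and> P \<noteq> 0 \<and> has_rank P d \<and> has_rank N d"
proof -
  \<comment> \<open>On the image of \<open>E\<close>, a(x) is an inverse of S^2 = x^2 - 4.\<close>
  obtain a r where ar: "a * [:-4, 0, 1:] + r * p ^ k = 1" using poly_bezout_power[OF p] by blast
  let ?Y = "pev (p ^ (k - 1)) x * E"
  have cE: "E * pev c x = pev c x * E" for c by (rule pev_commute[OF E(2)])
  have "adjoint ?Y (E * pev (p ^ (k - 1)) x)"
    by (intro adjoint_mult adjoint_pev saiD(4)[OF E(1)])
  then have "adjoint ?Y ?Y" by (simp only: cE)
  moreover have "e * ?Y = ?Y"
    using saiD(2)[OF E(1)] by (simp add: cE[symmetric] mult.assoc[symmetric] del: pev_power)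
  ultimately obtain u where u: "b u (?Y \<rhd> u) \<noteq> 0" using nonisotropic_vector nz by blast
  define v where "v = E \<rhd> u"
  have Ev: "E \<rhd> v = v" by (simp add: v_def saiD[OF E(1)])
  have "b v (act (p ^ (k - 1)) v) = b u (?Y \<rhd> u)"
    using saiD(7)[OF E(1), of u] act_commute[OF E(2)] by (simp add: v_def saiD(5)[OF E(1)] act_def[symmetric] del: act_simps(1) pev_power)
  then obtain P where P: "cyclic_proj P v" and rP: "has_rank P (degree (p ^ k))" "P \<noteq> 0"
    using exists_cyclic_proj[OF p(1), of v k] u null[of u] saiD(6)[OF E(1)] unfolding v_def by fastforce
  have EP: "E * P = P" by (rule cyclic_proj_le[OF P E(2) Ev])
  note P' = cyclic_projD[OF P]
  have inv: "act a (S \<rhd> S \<rhd> w) = w" if w: "E \<rhd> w = w" for w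
  proof -
    have "w = act (a * [:-4, 0, 1:] + r * p ^ k) w" by (simp only: ar act_simps)
    also have "\<dots> = act a (S \<rhd> S \<rhd> w) + act r (act (p ^ k) (E \<rhd> w))"
      using w by (simp only: act_simps S_S_app)
    finally show ?thesis using null[of w] by simp
  qed
  have EPw: "E \<rhd> P \<rhd> w = P \<rhd> w" for w using EP by (metis app_endo_simps(6))
  have PSP: "P \<rhd> S \<rhd> P \<rhd> w = 0" for w
    using skew_sandwich[OF P] by (metis app_endo_simps(1,6))
  \<comment> \<open>\<open>S * pev a x\<close> inverts \<open>S\<close> on the image of
    \<open>E\<close>, so \<open>N\<close> is the conjugate of \<open>P\<close> by \<open>S\<close>;
    this also explains the equal ranks.\<close>
  define N where "N = S * P * (S * pev a x)"
  have N: "N \<rhd> w = S \<rhd> P \<rhd> S \<rhd> act a w" for w by (simp add: N_def act_def)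
  have core: "P \<rhd> S \<rhd> act a (S \<rhd> P \<rhd> w) = P \<rhd> w" for w
    using inv[OF EPw, of w] by (simp add: S_act saiD(5)[OF P'(1)])
  have Nx: "N * x = x * N"
    by (rule endo_eqI)
      (simp add: N act_commute[symmetric] commute_app[OF P'(2)] commute_app[OF x_S[symmetric]])
  have "sai N"
    unfolding sai_def
  proof (intro conjI)
    show "N * N = N" by (rule endo_eqI) (simp add: N core)
    have "S \<rhd> e \<rhd> w = e \<rhd> S \<rhd> w" for w using S_e by (metis app_endo_simps(6))
    then show "e * N = N" "N * e = N"
      using saiD(6)[OF P'(1)] saiD(3)[OF P'(1)]
      by (auto intro!: endo_eqI simp: N e_act[symmetric]) (metis app_endo_simps(6))+
    have "adjoint N ((pev a x * (- S)) * (P * (- S)))"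
      unfolding N_def by (intro adjoint_mult adjoint_S adjoint_pev saiD(4)[OF P'(1)])
    moreover have "(pev a x * (- S)) * (P * (- S)) = N"
      by (rule endo_eqI) (simp add: N act_def[symmetric] S_act[symmetric] P'(4)[symmetric])
    ultimately show "adjoint N N" by simp
  qed
  moreover have "P * N = 0"
    by (rule endo_eqI) (simp add: N PSP)
  moreover have "N * S * P = S * P"
    by (rule endo_eqI) (use core in \<open>simp add: N\<close>)
  moreover have "P * S * N = S * N"
    by (rule endo_eqI) (simp add: N S_S_app P'(4) saiD(5)[OF P'(1)])
  ultimately have "inverting_pair P N" using Nx P' by (intro inverting_pairI)
  moreover have "E * N = N"
    by (rule endo_eqI) (simp add: N commute_app[OF E(3)] EPw)
  moreover have "has_rank N (degree (p ^ k))"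
    unfolding N_def
    by (rule has_rank_transport[OF rP(1)], rule endo_eqI) (use core in \<open>simp add: act_def[symmetric] saiD(5)[OF P'(1)]\<close>)
  ultimately show ?thesis using EP rP by blast
qed

lemma linear_square:
  assumes "\<epsilon> * \<epsilon> = (1::'a)"
  shows "[:-4, 0, 1:] = [:-2 * \<epsilon>, 1:] * ([:-2 * \<epsilon>, 1:] + [:4 * \<epsilon>:])"
  using assms by (simp add: algebra_simps)

text \<open>S^2 contains a factor x - 2\<epsilon>, so it kills the socle even where \<open>S\<close>
  does not.\<close>

lemma S_S_socle:
  assumes \<epsilon>: "\<epsilon> * \<epsilon> = 1" and v: "act ([:-2 * \<epsilon>, 1:] ^ l) v = 0" and l: "l > 0"
  shows "S \<rhd> S \<rhd> act ([:-2 * \<epsilon>, 1:] ^ (l - 1)) v = 0"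
proof -
  let ?p = "[:-2 * \<epsilon>, 1:]"
  have "[:-4, 0, 1:] * ?p ^ (l - 1) = (?p + [:4 * \<epsilon>:]) * ?p ^ l"
    using l by (simp only: linear_square[OF \<epsilon>]) (cases l; simp only: power_Suc diff_Suc_1; simp only: mult_ac)
  then have "act ([:-4, 0, 1:] * ?p ^ (l - 1)) v = act ((?p + [:4 * \<epsilon>:]) * ?p ^ l) v" by (simp only:)
  then show ?thesis by (simp only: S_S_app act_simps v)
qed

text \<open>\<open>P\<close> and \<open>N\<close> project onto F[x]v and F[x]Sv; as \<open>S\<close>
  kills the socle of F[x]v, the order of Sv is lower by one. The final clause places the pair below
  any operator that commutes with \<open>x\<close> and \<open>S\<close> and fixes
  \<open>v\<close>.\<close>

lemma pair_of_odd_vector: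
  assumes ov: "odd_vector \<epsilon> l v"
  shows "\<exists>P N. inverting_pair P N \<and> P \<noteq> 0 \<and> has_rank P l \<and> has_rank N (l - 1) \<and>
    (\<forall>X. X * x = x * X \<and> X * S = S * X \<and> X \<rhd> v = v \<longrightarrow> X * P = P \<and> X * N = N)"
proof -
  let ?p = "[:-2 * \<epsilon>, 1:]"
  have \<epsilon>: "\<epsilon> * \<epsilon> = 1" and l: "l > 0" and v: "e \<rhd> v = v" "act (?p ^ l) v = 0"
    "S \<rhd> act (?p ^ (l - 1)) v = 0" "b v (act (?p ^ (l - 1)) v) \<noteq> 0"
    using ov unfolding odd_vector_def by blast+
  obtain P where P: "cyclic_proj P v" "has_rank P l" "P \<noteq> 0"
    using exists_cyclic_proj[OF irreducible_linear_poly v(1,2,4)] by (auto simp: degree_linear_power)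
  note P' = cyclic_projD[OF P(1)]
  have "\<exists>N. cyclic_proj N (S \<rhd> v) \<and> has_rank N (l - 1)"
  proof (cases "l = 1")
    case True
    then have "S \<rhd> v = 0" using v(3) by simp
    then have "cyclic_proj 0 (S \<rhd> v)" by (simp add: cyclic_proj_def sai_0)
    then show ?thesis using True has_rank_0 by auto
  next
    case False
    then obtain m where m: "l = Suc (Suc m)" using l by (metis One_nat_def not0_implies_Suc less_numeral_extra(3))
    have "act (?p ^ (l - 1)) (S \<rhd> v) = 0" using v(3) by (simp only: S_act)
    moreover have "b (S \<rhd> v) (act (?p ^ (l - 1 - 1)) (S \<rhd> v)) = - 4 * \<epsilon> * b v (act (?p ^ (l - 1)) v)"
    proof -
      \<comment> \<open>Moving one \<open>S\<close> across the form gives -S^2 = -(p + 4\<epsilon>)p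
        evaluated at \<open>x\<close>. On v the term p^l dies and 4\<epsilon> p^(l-1)
        remains.\<close>
      have "[:-4, 0, 1:] * ?p ^ m = ?p ^ l + Polynomial.smult (4 * \<epsilon>) (?p ^ (l - 1))"
        unfolding linear_square[OF \<epsilon>] m by (simp only: diff_Suc_1 power_Suc) (simp only: distrib_left distrib_right mult_ac, simp)
      then have "S \<rhd> S \<rhd> act (?p ^ m) v = sc (4 * \<epsilon>) \<rhd> act (?p ^ (l - 1)) v"
        by (metis S_S_app act_simps(1,2,5) add_0 v(2))
      moreover have "b (S \<rhd> v) (act (?p ^ (l - 1 - 1)) (S \<rhd> v)) = - b v (S \<rhd> S \<rhd> act (?p ^ m) v)"
        by (simp only: b_S S_act m diff_Suc_1)
      ultimately show ?thesis by (simp only: b_right mult_minus_left mult_minus_right)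
    qed
    moreover have "4 * \<epsilon> \<noteq> 0" using \<epsilon> two by (auto simp: numeral_eq_iff) (metis mult_2 mult_eq_0_iff numeral_Bit0)
    moreover have "e \<rhd> S \<rhd> v = S \<rhd> v" using v(1) S_e by (metis app_endo_simps(6))
    ultimately have "\<exists>E. cyclic_proj E (S \<rhd> v) \<and> has_rank E (degree (?p ^ (l - 1))) \<and> E \<noteq> 0"
      using v(4) by (intro exists_cyclic_proj irreducible_linear_poly) simp_all
    then show ?thesis by (auto simp: degree_linear_power)
  qed
  then obtain N where N: "cyclic_proj N (S \<rhd> v)" "has_rank N (l - 1)" by blast
  note N' = cyclic_projD[OF N(1)]
  have "P * N = 0" by (rule cyclic_proj_orthogonal[OF P(1) N(1) b_S_self])
  moreover have "N * S * P = S * P"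
  proof (rule endo_eqI)
    fix u
    obtain c where "P \<rhd> u = act c v" using P'(3) by blast
    then show "(N * S * P) \<rhd> u = (S * P) \<rhd> u" by (simp add: S_act N'(4,5))
  qed
  moreover have "P * S * N = S * N"
  proof (rule endo_eqI)
    fix u
    obtain c where "N \<rhd> u = act c (S \<rhd> v)" using N'(3) by blast
    then show "(P * S * N) \<rhd> u = (S * N) \<rhd> u"
      by (simp add: S_act P'(4,5) S_S_app)
  qed
  ultimately have "inverting_pair P N" using P' N' by (intro inverting_pairI)
  moreover have "X * P = P \<and> X * N = N" if "X * x = x * X \<and> X * S = S * X \<and> X \<rhd> v = v" for X
    using cyclic_proj_le[OF P(1), of X] cyclic_proj_le[OF N(1), of X] that by (metis app_endo_simps(6))
  ultimately show ?thesis using P N by blast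
qed

text \<open>The form b(., p^(l-1) .) sees only residues modulo \<open>p\<close>, so it behaves as
  over the field: for isotropic u and nonisotropic v with b(u, v) nonzero, the part of u orthogonal
  to v has value -b(u, v)^2 / b(v, v).\<close>

lemma complement_nonisotropic:
  fixes \<epsilon> :: 'a
  defines "p \<equiv> [:-2 * \<epsilon>, 1:]"
  assumes P: "cyclic_proj P v" and v: "act (p ^ l) v = 0" and l: "l > 0"
    and u: "b u (act (p ^ (l - 1)) u) = 0" "b v (act (p ^ (l - 1)) u) \<noteq> 0"
  shows "b (u - P \<rhd> u) (act (p ^ (l - 1)) (u - P \<rhd> u)) \<noteq> 0"
proof
  note P' = cyclic_projD[OF P]
  let ?\<pi> = "\<lambda>w. act (p ^ (l - 1)) w"
  obtain c where c: "P \<rhd> u = act c v" using P'(3) by blast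
  \<comment> \<open>On the socle c(x) acts through the residue of \<open>c\<close> modulo
    \<open>p\<close>, its value at 2\<epsilon>.\<close>
  define r where "r = poly c (2 * \<epsilon>)"
  have "poly (c - [:r:]) (2 * \<epsilon>) = 0" by (simp add: r_def)
  then obtain c' where c': "c - [:r:] = p * c'" by (metis dvdE poly_eq_0_iff_dvd p_def mult_minus_left)
  have "c * p ^ (l - 1) = (c - [:r:]) * p ^ (l - 1) + Polynomial.smult r (p ^ (l - 1))"
    by (simp add: algebra_simps)
  also have "(c - [:r:]) * p ^ (l - 1) = c' * p ^ l"
    using l by (cases l) (simp_all add: c' mult_ac)
  finally have "act (c * p ^ (l - 1)) v = act (c' * p ^ l + Polynomial.smult r (p ^ (l - 1))) v" by simp
  then have socle: "?\<pi> (P \<rhd> u) = sc r \<rhd> ?\<pi> v"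
    using act_act_commute[of "p ^ (l - 1)" c v] by (simp only: act_simps v c) simp
  assume z: "b (u - P \<rhd> u) (?\<pi> (u - P \<rhd> u)) = 0"
  have "b (P \<rhd> u) (?\<pi> (u - P \<rhd> u)) = 0"
    using saiD(7)[OF P'(1), of u "?\<pi> (u - P \<rhd> u)"] saiD(5)[OF P'(1)]
    by (simp only: P'(4) app_diff diff_self act_simps b_right)
  then have "b (P \<rhd> u) (?\<pi> u) = b (P \<rhd> u) (?\<pi> (P \<rhd> u))"
    by (simp only: act_simps b_right right_minus_eq)
  then have "b u (?\<pi> (P \<rhd> u)) = 0"
    using z u(1) by (simp only: b_left act_simps b_right) simp
  then have "r * b v (?\<pi> u) = 0"
    by (simp only: socle b_right) (metis b_act b_sym)
  then have "r = 0" using u(2) by simp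
  then have "?\<pi> (P \<rhd> u) = 0" by (simp only: socle sc_simps app_endo_simps)
  then have "b v (?\<pi> u) = 0" by (metis P'(6) b_right(3))
  then show False using u(2) by blast
qed

text \<open>If \<open>S\<close> does not kill the socle of F[x]v, then p^(l-1) Sv is nonzero but
  orthogonal to F[x]Sv, so F[x]Sv is degenerate and no partner for F[x]v. The remedy uses
  nonisotropic v1, v2 together with Sv2, Sv1 corrected to vectors z1, z2 orthogonal to v1, v2. The
  image of \<open>P\<close> is generated by v1 and z1, that of \<open>N\<close> by v2 and
  z2.\<close>

lemma pair_of_even_blocks:
  fixes \<epsilon> :: 'a
  defines "p \<equiv> [:-2 * \<epsilon>, 1:]"
  assumes \<epsilon>: "\<epsilon> * \<epsilon> = 1" and l: "l > 0"
    and E: "sai E" "E * x = x * E" "E * S = S * E"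
    and null: "\<And>u. act (p ^ l) (E \<rhd> u) = 0" and nz: "S \<rhd> act (p ^ (l - 1)) (E \<rhd> w) \<noteq> 0"
  shows "\<exists>P N d. inverting_pair P N \<and> E * P = P \<and> E * N = N \<and> P \<noteq> 0 \<and> has_rank P d \<and> has_rank N d"
proof -
  let ?\<pi> = "\<lambda>w. act (p ^ (l - 1)) w"
  have p: "irreducible p" unfolding p_def by (rule irreducible_linear_poly)
  have deg: "degree (p ^ l) = l" unfolding p_def by (rule degree_linear_power)
  have E_act: "E \<rhd> act c u = act c (E \<rhd> u)" for c u by (rule act_commute[OF E(2)])
  have E_S: "E \<rhd> S \<rhd> u = S \<rhd> E \<rhd> u" for u by (rule commute_app[OF E(3)])
  have form: "adjoint (pev c x * F) (pev c x * F)" "e * (pev c x * F) = pev c x * F"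
    if F: "sai F" "F * x = x * F" for F c
  proof -
    have c: "F * pev c x = pev c x * F" by (rule pev_commute[OF F(2)])
    have "adjoint (pev c x * F) (F * pev c x)" by (intro adjoint_mult adjoint_pev saiD(4)[OF F(1)])
    then show "adjoint (pev c x * F) (pev c x * F)" by (simp only: c)
    have "e * (F * pev c x) = F * pev c x" by (simp only: mult.assoc[symmetric] saiD(2)[OF F(1)])
    then show "e * (pev c x * F) = pev c x * F" by (simp only: c)
  qed
  have form_app: "b u ((pev c x * F) \<rhd> u) = b (F \<rhd> u) (act c (F \<rhd> u))"
    if F: "sai F" "F * x = x * F" for F c u
    using saiD(7)[OF F(1), of u] by (simp add: act_commute[OF F(2)] saiD(5)[OF F(1)] act_def[symmetric])

  have "pev (p ^ (l - 1)) x * E \<noteq> 0"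
    using nz by (metis act_def app_endo_simps(1,6) app_zero)
  \<comment> \<open>Two demands at once: v1 must generate a nondegenerate space, and
    \<open>S\<close> must not kill its socle.\<close>
  then obtain u1 where u1: "b u1 ((pev (p ^ (l - 1)) x * E) \<rhd> u1) \<noteq> 0" "S \<rhd> ?\<pi> (E \<rhd> u1) \<noteq> 0"
    using nonisotropic_vector_avoiding[OF form[OF E(1,2)], of "p ^ (l - 1)" "\<lambda>u. S \<rhd> ?\<pi> (E \<rhd> u)" w] nz
    by auto
  define v1 where "v1 = E \<rhd> u1"
  have v1: "E \<rhd> v1 = v1" "e \<rhd> v1 = v1" "act (p ^ l) v1 = 0" "b v1 (?\<pi> v1) \<noteq> 0"
    using u1(1) by (simp_all only: v1_def saiD(5,6)[OF E(1)] null form_app[OF E(1,2)] not_False_eq_True)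
  obtain P1 where P1: "cyclic_proj P1 v1" "has_rank P1 l" "P1 \<noteq> 0"
    using exists_cyclic_proj[OF p v1(2-4)] deg by auto
  note P1' = cyclic_projD[OF P1(1)]
  have EP1: "E * P1 = P1" by (rule cyclic_proj_le[OF P1(1) E(2) v1(1)])

  define F where "F = E - P1"
  have F: "sai F" "F * x = x * F"
    using E P1' sai_diff[OF E(1) P1'(1) EP1] by (simp_all add: F_def algebra_simps)
  have P1F: "P1 \<rhd> F \<rhd> u = 0" for u
    using sai_absorb[OF E(1) P1'(1) EP1] saiD(5)[OF P1'(1)] by (simp add: F_def) (metis app_endo_simps(6))
  have EF: "E \<rhd> F \<rhd> u = F \<rhd> u" for u
    using EP1 saiD(5)[OF E(1)] by (simp add: F_def) (metis app_endo_simps(6))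
  define s1 where "s1 = ?\<pi> (S \<rhd> v1)"
  have s1: "s1 \<noteq> 0" using u1(2) by (simp only: s1_def v1_def S_act not_False_eq_True)
  have Es1: "E \<rhd> s1 = s1" by (simp only: s1_def E_act E_S v1)
  have "P1 \<rhd> S \<rhd> v1 = 0" by (rule cyclic_proj_kill[OF P1(1) b_S_self])
  then have FS: "F \<rhd> S \<rhd> v1 = S \<rhd> v1" by (simp add: F_def E_S v1)
  then have Fs1: "F \<rhd> s1 = s1" by (simp only: s1_def act_commute[OF F(2)])
  have "(pev (p ^ (l - 1)) x * F) \<rhd> S \<rhd> v1 = s1" by (simp only: app_endo_simps FS s1_def act_def)
  then have "pev (p ^ (l - 1)) x * F \<noteq> 0" using s1 by (metis app_endo_simps(1))
  \<comment> \<open>v2 has to be nonisotropic and to pair nontrivially with s1; nondegeneracy shows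
    that the second demand can be met.\<close>
  moreover have "\<exists>w. b s1 w \<noteq> 0"
    using s1 nondegenerate[of s1] saiD(6)[OF E(1), of s1] Es1 by auto
  then obtain w1 where "b s1 (F \<rhd> w1) \<noteq> 0"
    using saiD(7)[OF F(1), of s1] Fs1 by auto
  ultimately obtain u2 where u2: "b u2 ((pev (p ^ (l - 1)) x * F) \<rhd> u2) \<noteq> 0" "b s1 (F \<rhd> u2) \<noteq> 0"
    using nonisotropic_vector_avoiding[OF form[OF F], of "p ^ (l - 1)" "\<lambda>u. b s1 (F \<rhd> u)" w1]
    by (auto simp: b_simps)
  define v2 where "v2 = F \<rhd> u2"
  have v2: "E \<rhd> v2 = v2" "e \<rhd> v2 = v2" "b v2 (?\<pi> v2) \<noteq> 0" "P1 \<rhd> v2 = 0" "b s1 v2 \<noteq> 0"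
    using u2 by (simp_all only: v2_def form_app[OF F] P1F EF saiD(6)[OF F(1)] not_False_eq_True)
  have v2_null: "act (p ^ l) v2 = 0" using null[of v2] v2(1) by simp
  obtain N1 where N1: "cyclic_proj N1 v2" "has_rank N1 l"
    using exists_cyclic_proj[OF p v2(2) v2_null v2(3)] deg by auto
  note N1' = cyclic_projD[OF N1(1)]

  \<comment> \<open>For the form b(., p^(l-1) .) the vectors Sv2 and Sv1 are isotropic; removing
    their components in F[x]v1 and F[x]v2 makes them nonisotropic by
    \<open>complement_nonisotropic\<close>.\<close>
  define z1 where "z1 = S \<rhd> v2 - P1 \<rhd> S \<rhd> v2"
  define z2 where "z2 = S \<rhd> v1 - N1 \<rhd> S \<rhd> v1"
  have E_z: "E \<rhd> z1 = z1" "E \<rhd> z2 = z2"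
    using cyclic_proj_le[OF N1(1) E(2) v2(1)] EP1
    by (simp_all add: z1_def z2_def E_S v1 v2) (metis app_endo_simps(6))+
  have iso: "b (S \<rhd> v) (?\<pi> (S \<rhd> v)) = 0" if "act (p ^ l) v = 0" for v
    using S_S_socle[OF \<epsilon> that[unfolded p_def] l] by (simp only: b_S S_act[symmetric] p_def b_right) simp
  have \<beta>: "b v2 (?\<pi> (S \<rhd> v1)) \<noteq> 0" using v2(5) by (simp only: s1_def b_sym[of v2] not_False_eq_True)
  have "b v1 (?\<pi> (S \<rhd> v2)) = - b (S \<rhd> v1) (?\<pi> v2)" by (simp only: b_S S_act) simp
  also have "\<dots> = - b v2 (?\<pi> (S \<rhd> v1))" 
    using b_act[of "p ^ (l - 1)" "S \<rhd> v1" v2] b_sym[of v2 "?\<pi> (S \<rhd> v1)"] by (simp only:)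
  finally have \<beta>': "b v1 (?\<pi> (S \<rhd> v2)) \<noteq> 0" using \<beta> by simp
  have z1: "b z1 (?\<pi> z1) \<noteq> 0" unfolding z1_def p_def
    by (rule complement_nonisotropic[OF P1(1) v1(3)[unfolded p_def] l
        iso[OF v2_null, unfolded p_def] \<beta>'[unfolded p_def]])
  have z2: "b z2 (?\<pi> z2) \<noteq> 0" unfolding z2_def p_def
    by (rule complement_nonisotropic[OF N1(1) v2_null[unfolded p_def] l
        iso[OF v1(3), unfolded p_def] \<beta>[unfolded p_def]])
  have ez: "e \<rhd> z1 = z1" "e \<rhd> z2 = z2" using E_z saiD(6)[OF E(1)] by metis+
  have z_null: "act (p ^ l) z1 = 0" "act (p ^ l) z2 = 0" using null[of z1] null[of z2] E_z by simp_all
  obtain P2 where P2: "cyclic_proj P2 z1" "has_rank P2 l"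
    using exists_cyclic_proj[OF p ez(1) z_null(1) z1] deg by auto
  obtain N2 where N2: "cyclic_proj N2 z2" "has_rank N2 l"
    using exists_cyclic_proj[OF p ez(2) z_null(2) z2] deg by auto

  have v1_v2: "b v1 (act c v2) = 0" for c using P1'(6)[of c v2] v2(4) by (simp add: b_right)
  have v2_v1: "b v2 (act c v1) = 0" for c using v1_v2[of c] b_sym[of v2] by (simp add: b_act)
  have N1v1: "N1 \<rhd> v1 = 0" by (rule cyclic_proj_kill[OF N1(1) v2_v1])
  \<comment> \<open>Stated for arbitrary data, so that it also applies with the roles of
    \<open>P\<close> and \<open>N\<close> exchanged.\<close>
  have half: "P1 * P2 = 0 \<and> (\<forall>c. b v2 (act c z1) = 0)"
    if P1: "cyclic_proj P1 v1" and P2: "cyclic_proj P2 z1" and z1: "z1 = S \<rhd> v2 - P1 \<rhd> S \<rhd> v2"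
      and o: "\<And>c. b v2 (act c v1) = 0"
    for P1 P2 v1 v2 z1
  proof
    obtain c where c: "P1 \<rhd> S \<rhd> v2 = act c v1" using cyclic_projD(3)[OF P1] by blast
    show "P1 * P2 = 0"
      by (rule cyclic_proj_orthogonal[OF P1 P2]) (simp add: z1 b_right cyclic_projD(6)[OF P1])
    show "\<forall>c. b v2 (act c z1) = 0"
      using o[of "_ * c"] by (simp add: z1 b_right b_S_self c)
  qed
  have h1: "P1 * P2 = 0" "\<And>c. b v2 (act c z1) = 0" using half[OF P1(1) P2(1) z1_def v2_v1] by auto
  have h2: "N1 * N2 = 0" "\<And>c. b v1 (act c z2) = 0" using half[OF N1(1) N2(1) z2_def v1_v2] by auto
  have z1_v2: "b z1 (act c v2) = 0" for c using h1(2)[of c] b_sym[of z1] by (simp add: b_act)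
  have z1_z2: "b z1 (act c z2) = 0" for c
  proof -
    obtain a where a: "N1 \<rhd> S \<rhd> v1 = act a v2" using N1'(3) by blast
    obtain a' where a': "P1 \<rhd> S \<rhd> v2 = act a' v1" using P1'(3) by blast
    \<comment> \<open>Pairing Sv2 with Sv1 reduces through S^2 = x^2 - 4 to pairing v2 with
      v1.\<close>
    have "b (S \<rhd> v2) (act c (S \<rhd> v1)) = - b v2 (act (c * [:-4, 0, 1:]) v1)"
      by (simp only: b_S S_act S_S_app act_simps)
    then have 1: "b (S \<rhd> v2) (act c (S \<rhd> v1)) = 0" by (simp only: v2_v1) simp
    have 2: "b (act a' v1) (act c (S \<rhd> v1)) = 0"
      using b_S_self[of v1 "a' * c"] by (simp add: b_act)
    have 3: "b z1 (act c (act a v2)) = 0" using z1_v2[of "c * a"] by simp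
    have "b z1 (act c (S \<rhd> v1)) = 0" by (simp only: z1_def a' b_left 1 2) simp
    then show ?thesis by (simp only: z2_def a act_simps b_right 3) simp
  qed
  define P where "P = P1 + P2"
  define N where "N = N1 + N2"
  note P2' = cyclic_projD[OF P2(1)] and N2' = cyclic_projD[OF N2(1)]
  have P21: "P2 * P1 = 0" by (rule sai_swap[OF P1'(1) P2'(1) h1(1)])
  have N21: "N2 * N1 = 0" by (rule sai_swap[OF N1'(1) N2'(1) h2(1)])
  have "P * N = 0"
    using cyclic_proj_orthogonal[OF P1(1) N1(1) v1_v2] cyclic_proj_orthogonal[OF P1(1) N2(1) h2(2)]
      cyclic_proj_orthogonal[OF P2(1) N1(1) z1_v2] cyclic_proj_orthogonal[OF P2(1) N2(1) z1_z2]
    by (simp add: P_def N_def algebra_simps)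
  \<comment> \<open>Sv1 is z2 plus an element of F[x]v2, and Sz1 is an element of F[x]v2 minus one
    of F[x]Sv1; so both lie in the image of N1 + N2.\<close>
  moreover have image: "(N1 + N2) * S * (P1 + P2) = S * (P1 + P2)"
    if P1: "cyclic_proj P1 v1" and P2: "cyclic_proj P2 z1" and N1: "cyclic_proj N1 v2"
      and N2: "cyclic_proj N2 z2" and N21: "N2 * N1 = 0" "N1 * N2 = 0"
      and z: "z1 = S \<rhd> v2 - P1 \<rhd> S \<rhd> v2" "z2 = S \<rhd> v1 - N1 \<rhd> S \<rhd> v1"
    for P1 P2 N1 N2 v1 v2 z1 z2
  proof (rule endo_eqI)
    note d = cyclic_projD[OF P1] cyclic_projD[OF P2] cyclic_projD[OF N1] cyclic_projD[OF N2]
    let ?N = "N1 + N2"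
    have N: "?N \<rhd> act c u = act c (?N \<rhd> u)" for c u by (simp add: d)
    have zero: "N2 \<rhd> N1 \<rhd> u = 0" "N1 \<rhd> N2 \<rhd> u = 0" for u
      using N21 by (metis app_endo_simps(1,6))+
    have Nv2: "?N \<rhd> v2 = v2" using zero(1)[of v2] by (simp add: d)
    have Nz2: "?N \<rhd> z2 = z2" using zero(2)[of z2] by (simp add: d)
    have "?N \<rhd> N1 \<rhd> u = N1 \<rhd> u" for u by (simp add: zero saiD(5)[OF d(15)])
    then have NS: "?N \<rhd> S \<rhd> v1 = S \<rhd> v1"
      using Nz2 unfolding z(2) by (simp only: app_diff) simp
    obtain a where a: "P1 \<rhd> S \<rhd> v2 = act a v1" using d(3) by blast
    have NS': "?N \<rhd> S \<rhd> z1 = S \<rhd> z1"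
      by (simp only: z(1) app_diff a S_act S_S_app N NS Nv2)
    fix u
    obtain c c' where "P1 \<rhd> u = act c v1" "P2 \<rhd> u = act c' z1" using d(3)[of u] d(10)[of u] by blast
    then show "(?N * S * (P1 + P2)) \<rhd> u = (S * (P1 + P2)) \<rhd> u"
      by (simp only: app_endo_simps(3,6) app_add S_act) (simp only: N NS NS' app_endo_simps(3)[symmetric])
  qed
  then have "N * S * P = S * P" "P * S * N = S * N"
    unfolding P_def N_def
    using image[OF P1(1) P2(1) N1(1) N2(1) N21 h2(1) z1_def z2_def]
      image[OF N1(1) N2(1) P1(1) P2(1) P21 h1(1) z2_def z1_def] by blast+
  moreover have "sai P" "P * x = x * P" "sai N" "N * x = x * N"
    using P1' P2' N1' N2' h1(1) h2(1) sai_add by (simp_all add: P_def N_def algebra_simps)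
  ultimately have "inverting_pair P N" by (intro inverting_pairI)
  moreover have "has_rank P (l + l)" "has_rank N (l + l)"
    unfolding P_def N_def using P1(2) P2(2) N1(2) N2(2) P21 N21 h1(1) h2(1) by (auto intro: has_rank_add)
  moreover have "E * P = P" "E * N = N"
    using EP1 cyclic_proj_le[OF P2(1) E(2) E_z(1)] cyclic_proj_le[OF N1(1) E(2) v2(1)]
      cyclic_proj_le[OF N2(1) E(2) E_z(2)] by (simp_all add: P_def N_def distrib_left)
  moreover have "P \<noteq> 0"
  proof
    assume "P = 0"
    then have "P1 * P = 0" by simp
    then show False using h1(1) P1(3) saiD(1)[OF P1'(1)] by (simp add: P_def distrib_left)
  qed
  ultimately show ?thesis by blast
qed

text \<open>On a primary component \<open>S\<close> is invertible, or nonzero on the socle, or zero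
  there. Only the last case can give unequal ranks, and it produces an odd vector.\<close>

lemma exists_pair_below:
  assumes E: "sai E" "E * x = x * E" "E * S = S * E" "E \<noteq> 0"
  shows "\<exists>P N d d'. inverting_pair P N \<and> E * P = P \<and> E * N = N \<and> P \<noteq> 0 \<and> has_rank P d \<and> has_rank N d' \<and>
    (d = d' \<or> (\<exists>\<epsilon> l v. odd_vector \<epsilon> l v))"
proof -
  obtain p k c where p: "monic p" "irreducible p" "k > 0"
    and idem: "pev c x * E * (pev c x * E) = pev c x * E"
    and null: "pev (p ^ k) x * (pev c x * E) = 0" "pev (p ^ (k - 1)) x * (pev c x * E) \<noteq> 0"
    using exists_primary_component[OF saiD(1)[OF E(1)] finite_range_sai[OF E(1)] E(2,4)] by blast
  define E1 where "E1 = pev c x * E"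
  have cE: "E * pev c x = pev c x * E" by (rule pev_commute[OF E(2)])
  have E1: "sai E1"
    unfolding sai_def
  proof (intro conjI)
    show "E1 * E1 = E1" using idem by (simp only: E1_def)
    have "e * (E * pev c x) = E * pev c x" by (simp only: mult.assoc[symmetric] saiD(2)[OF E(1)])
    then show "e * E1 = E1" by (simp only: E1_def cE)
    show "E1 * e = E1" by (simp only: E1_def mult.assoc saiD(3)[OF E(1)])
    have "adjoint (pev c x * E) (E * pev c x)" by (intro adjoint_mult adjoint_pev saiD(4)[OF E(1)])
    then show "adjoint E1 E1" by (simp only: E1_def cE)
  qed
  have E1_app: "E1 \<rhd> u = act c (E \<rhd> u)" for u by (simp add: E1_def act_def)
  have E1x: "E1 * x = x * E1"
    by (rule endo_eqI) (simp add: E1_app commute_app[OF E(2)] act_commute)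
  have E1S: "E1 * S = S * E1"
    by (rule endo_eqI) (simp add: E1_app commute_app[OF E(3)] S_act)
  have EE1: "E * E1 = E1" by (simp only: E1_def mult.assoc[symmetric] cE) (simp only: mult.assoc saiD(1)[OF E(1)])
  have null': "act (p ^ k) (E1 \<rhd> u) = 0" for u
    using null(1) unfolding act_def E1_def[symmetric] by (metis app_endo_simps(1,6))
  have le: "E * X = X" if "E1 * X = X" for X using EE1 that by (metis mult.assoc)
  show ?thesis
  proof (cases "p dvd [:-4, 0, 1:]")
    case False
    then show ?thesis
      using pair_of_invertible[OF E1 E1x E1S p(2) False null'] null(2) le unfolding E1_def[symmetric] by blast
  next
    case True
    \<comment> \<open>\<open>p\<close> divides (t - 2)(t + 2). If it missed t - 2, a Bezout identity
      multiplied by t + 2 would show that it divides t + 2.\<close>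
    have "\<exists>\<epsilon>. \<epsilon> * \<epsilon> = 1 \<and> p dvd [:-2 * \<epsilon>, 1:]"
    proof (rule ccontr)
      assume n: "\<not> ?thesis"
      then have "\<not> p dvd [:-2 * 1, 1:]" "\<not> p dvd [:-2 * -1, 1:]" by (metis mult_1, metis minus_mult_minus mult_1)
      then obtain a r where 1: "a * [:-2 * 1, 1:] + r * p = 1" using poly_bezout_irreducible[OF p(2)] by blast
      have "[:-2 * -1, 1:] = a * [:-4, 0, 1:] + r * p * [:-2 * -1, 1::'a:]"
      proof -
        have "[:-2 * -1, 1::'a:] = (a * [:-2 * 1, 1:] + r * p) * [:-2 * -1, 1:]" by (simp only: 1 mult_1)
        also have "\<dots> = a * ([:-2 * 1, 1:] * [:-2 * -1, 1:]) + r * p * [:-2 * -1, 1:]"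
          by (simp only: distrib_right mult.assoc)
        also have "[:-2 * 1, 1:] * [:-2 * -1, 1:] = [:-4, 0, 1::'a:]" by simp
        finally show ?thesis .
      qed
      moreover have "p dvd a * [:-4, 0, 1:] + r * p * [:-2 * -1, 1:]"
        by (intro dvd_add dvd_mult[OF True] dvd_mult2[OF dvd_triv_right])
      ultimately show False using \<open>\<not> p dvd [:-2 * -1, 1:]\<close> by metis
    qed
    then obtain \<epsilon> where \<epsilon>: "\<epsilon> * \<epsilon> = 1" and "p dvd [:-2 * \<epsilon>, 1:]" by blast
    then obtain r where r: "[:-2 * \<epsilon>, 1:] = p * r" by blast
    have "\<not> p dvd 1" using p(2) irreducible_not_unit by blast
    then have r1: "r dvd 1" using irreducibleD[OF irreducible_linear_poly r] by blast
    then obtain s where s: "r = [:s:]" by (metis degree_eq_zeroE is_unit_iff_degree r mult_zero_right pCons_eq_0_iff one_neq_zero)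
    have "lead_coeff (p * r) = s" using p(1) by (simp add: lead_coeff_mult s)
    then have "s = 1" by (simp flip: r)
    then have pe: "p = [:-2 * \<epsilon>, 1:]" using r s by (simp add: one_pCons[symmetric])
    show ?thesis
    proof (cases "\<forall>w. S \<rhd> act (p ^ (k - 1)) (E1 \<rhd> w) = 0")
      case False
      then show ?thesis
        using pair_of_even_blocks[OF \<epsilon> p(3) E1 E1x E1S null'[unfolded pe]] le unfolding pe by blast
    next
      case True
      let ?Y = "pev (p ^ (k - 1)) x * E1"
      have c1: "E1 * pev r x = pev r x * E1" for r by (rule pev_commute[OF E1x])
      have "adjoint ?Y (E1 * pev (p ^ (k - 1)) x)" by (intro adjoint_mult adjoint_pev saiD(4)[OF E1])
      then have "adjoint ?Y ?Y" by (simp only: c1)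
      moreover have "e * (E1 * pev (p ^ (k - 1)) x) = E1 * pev (p ^ (k - 1)) x"
        by (simp only: mult.assoc[symmetric] saiD(2)[OF E1])
      then have "e * ?Y = ?Y" by (simp only: c1)
      ultimately obtain u where u: "b u (?Y \<rhd> u) \<noteq> 0"
        using nonisotropic_vector null(2) unfolding E1_def[symmetric] by blast
      define v where "v = E1 \<rhd> u"
      have "b v (act (p ^ (k - 1)) v) = b u (?Y \<rhd> u)"
        by (simp only: v_def saiD(7)[OF E1, of u] act_commute[OF E1x] saiD(5)[OF E1])
          (simp only: act_def app_endo_simps)
      then have "odd_vector \<epsilon> k v"
        using u True null'[of u] \<epsilon> p(3) saiD(6)[OF E1]
        unfolding odd_vector_def pe by (simp only: v_def simp_thms not_False_eq_True)
      moreover have "E1 \<rhd> v = v" by (simp only: v_def saiD(5)[OF E1])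
      ultimately show ?thesis using pair_of_odd_vector[of \<epsilon> k v] E1x E1S le by blast
    qed
  qed
qed

text \<open>Pairs are split off until nothing is left, the complement of a pair again commuting with
  \<open>x\<close> and \<open>S\<close>. The odd vector may lie anywhere in the space: equality of
  ranks is used only when there are no odd vectors at all.\<close>

theorem exists_inverting_pair:
  assumes "sai E" "E * x = x * E" "E * S = S * E"
  shows "\<exists>P N d d'. inverting_pair P N \<and> E = P + N \<and> has_rank P d \<and> has_rank N d' \<and>
    (d = d' \<or> (\<exists>\<epsilon> l v. odd_vector \<epsilon> l v))"
  using assms
proof (induction "card (range (app E))" arbitrary: E rule: less_induct)
  case less
  note E = less.prems
  show ?case
  proof (cases "E = 0")
    case True
    moreover have "inverting_pair 0 0" by (simp add: inverting_pair_def sai_0)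
    ultimately show ?thesis using has_rank_0 by (metis add_0)
  next
    case False
    obtain P N d d' where 1: "inverting_pair P N" "E * P = P" "E * N = N" "P \<noteq> 0" "has_rank P d" "has_rank N d'"
      "d = d' \<or> (\<exists>\<epsilon> l v. odd_vector \<epsilon> l v)"
      using exists_pair_below[OF E False] by blast
    define F where "F = P + N"
    note d1 = inverting_pairD[OF 1(1)]
    have F: "sai F" "F * x = x * F" "F * S = S * F" "E * F = F" using d1(9-11) 1(2,3) by (simp_all add: F_def distrib_left)
    have FE: "F * E = F" by (rule sai_absorb[OF E(1) F(1,4)])
    have "F \<noteq> 0"
    proof
      assume "F = 0"
      then have "P * F = 0" by simp
      then show False using 1(4) d1(3) saiD(1)[OF d1(1)] by (simp add: F_def distrib_left)
    qed
    have "card (range (app (E - F))) < card (range (app E))"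
      by (rule card_range_diff_less[OF finite_range_sai[OF E(1)] saiD(1)[OF F(1)] F(4) FE \<open>F \<noteq> 0\<close>])
    moreover have "sai (E - F)" "(E - F) * x = x * (E - F)" "(E - F) * S = S * (E - F)"
      using sai_diff[OF E(1) F(1,4)] E F by (simp_all add: algebra_simps)
    ultimately obtain P' N' m m' where 2: "inverting_pair P' N'" "E - F = P' + N'" "has_rank P' m" "has_rank N' m'"
      "m = m' \<or> (\<exists>\<epsilon> l v. odd_vector \<epsilon> l v)"
      using less.hyps[of "E - F"] by blast
    have "(P + N) * (P' + N') = 0"
      using FE saiD(1)[OF F(1)] F(4) by (simp add: 2(2)[symmetric] F_def[symmetric] right_diff_distrib)
    note a = inverting_pair_add[OF 1(1) 2(1) this]
    have "E = (P + P') + (N + N')" using 2(2) by (simp add: F_def algebra_simps)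
    then show ?thesis
      using a has_rank_add[OF 1(5) 2(3) a(2,3)] has_rank_add[OF 1(6) 2(4) a(4,5)] 1(7) 2(5) by metis
  qed
qed

end

section \<open>Matrices as operators\<close>

definition cor :: "nat \<Rightarrow> 'a::field endo" where
  "cor n = Endo (\<lambda>u i. if i < n then u i else 0)"

lemma app_cor: "cor n \<rhd> u = (\<lambda>i. if i < n then u i else 0)"
  unfolding cor_def by (subst app_Endo) (auto simp: fun_eq_iff fun_apply)

definition basis_vec :: "nat \<Rightarrow> nat \<Rightarrow> 'a::field" where
  "basis_vec j = (\<lambda>i. if i = j then 1 else 0)"

lemma basis_vec_apply: "basis_vec j i = (if i = j then 1 else 0)"
  by (simp add: basis_vec_def)

lemma cor_basis_vec: "j < n \<Longrightarrow> cor n \<rhd> basis_vec j = basis_vec j"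
  by (auto simp: app_cor basis_vec_apply)

lemma cor_sum: "cor n \<rhd> u = (\<Sum>j<n. sc (u j) \<rhd> basis_vec j)"
proof
  fix i
  have "(\<Sum>j<n. u j * basis_vec j i) = (\<Sum>j<n. if j = i then u j else 0)"
    by (intro sum.cong) (auto simp: basis_vec_apply)
  then show "(cor n \<rhd> u) i = (\<Sum>j<n. sc (u j) \<rhd> basis_vec j) i"
    by (simp add: app_cor sum_fun_apply)
qed

lemma cor_idem: "cor n * cor n = cor n"
  by (rule endo_eqI) (auto simp: app_cor)

lemma basis_of_cor: "basis_of (cor n) n basis_vec (\<lambda>i u. u i)"
  by (auto simp: basis_of_def functional_coordinate cor_sum[symmetric] basis_vec_apply)

text \<open>The image is parametrized by \<open>d\<close> free coordinates. Counting its points is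
  what makes the rank unique.\<close>

lemma card_range_rank:
  fixes E :: "'a::{field, finite} endo"
  assumes "has_rank E d"
  shows "card (range (app E)) = CARD('a) ^ d"
proof -
  obtain b q where bq: "basis_of E d b q" using assms by (auto simp: has_rank_def)
  let ?f = "\<lambda>f. \<Sum>i<d. sc (f i) \<rhd> b i"
  have coord: "q i (?f f) = f i" if "i < d" for f i
  proof -
    have q: "functional (q i)" using bq that by (simp add: basis_of_def)
    have "q i (?f f) = (\<Sum>j<d. f j * q i (b j))" by (simp add: functional_sum[OF q] functional_simps[OF q])
    also have "\<dots> = (\<Sum>j<d. if j = i then f j else 0)"
      using bq that by (intro sum.cong) (auto simp: basis_of_def)
    finally show ?thesis using that by simp
  qed
  have "bij_betw ?f ({..<d} \<rightarrow>\<^sub>E UNIV) (range (app E))"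
  proof (rule bij_betw_imageI)
    show "inj_on ?f ({..<d} \<rightarrow>\<^sub>E UNIV)"
    proof (rule inj_onI)
      fix f f' assume f: "f \<in> {..<d} \<rightarrow>\<^sub>E UNIV" "f' \<in> {..<d} \<rightarrow>\<^sub>E UNIV" "?f f = ?f f'"
      show "f = f'"
        by (rule PiE_ext[OF f(1,2)]) (metis coord f(3) lessThan_iff)
    qed
    show "?f ` ({..<d} \<rightarrow>\<^sub>E UNIV) = range (app E)"
    proof (intro subset_antisym subsetI)
      fix y assume "y \<in> ?f ` ({..<d} \<rightarrow>\<^sub>E UNIV)"
      then obtain f where "y = ?f f" by blast
      then have "E \<rhd> y = y" using basis_of_fix[OF bq] by (simp add: app_sum app_sc_commute)
      then show "y \<in> range (app E)" by (metis rangeI)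
    next
      fix y assume "y \<in> range (app E)"
      then obtain u where "y = E \<rhd> u" by blast
      then have "y = ?f (restrict (\<lambda>i. q i u) {..<d})" using bq by (simp add: basis_of_def)
      then show "y \<in> ?f ` ({..<d} \<rightarrow>\<^sub>E UNIV)" 
        by (rule image_eqI[of _ ?f "restrict (\<lambda>i. q i u) {..<d}"]) simp
    qed
  qed
  then have "card (range (app E)) = card ({..<d} \<rightarrow>\<^sub>E (UNIV :: 'a set))" by (simp add: bij_betw_same_card)
  then show ?thesis by (simp add: card_PiE)
qed

lemma card_field_gt_1: "1 < CARD('a::{field, finite})"
proof -
  have "card {0, 1 :: 'a} \<le> CARD('a)" by (intro card_mono) auto
  then show ?thesis by simp
qed

lemma has_rank_unique:
  fixes E :: "'a::{field, finite} endo"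
  assumes "has_rank E d" "has_rank E d'"
  shows "d = d'"
  using card_range_rank[OF assms(1)] card_range_rank[OF assms(2)] card_field_gt_1[where 'a = 'a]
  by (metis power_inject_exp)

lemma finite_range_cor: "finite (range (app (cor n :: 'a::{field, finite} endo)))"
proof (rule card_ge_0_finite)
  have "has_rank (cor n :: 'a endo) n" using basis_of_cor by (auto simp: has_rank_def)
  then show "card (range (app (cor n :: 'a endo))) > 0" by (simp add: card_range_rank)
qed

text \<open>Acting as the identity, and not as zero, on later coordinates sends the identity matrix
  to 1, so inverse matrices become inverse operators.\<close>

definition op_of :: "nat \<Rightarrow> 'a::field mat \<Rightarrow> 'a endo" where
  "op_of n M = Endo (\<lambda>u i. if i < n then \<Sum>j<n. M $$ (i, j) * u j else u i)"

lemma app_op_of: "op_of n M \<rhd> u = (\<lambda>i. if i < n then \<Sum>j<n. M $$ (i, j) * u j else u i)"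
  unfolding op_of_def
  by (subst app_Endo) (auto simp: fun_eq_iff fun_apply algebra_simps sum.distrib sum_distrib_left)

definition mat_of :: "nat \<Rightarrow> 'a::field endo \<Rightarrow> 'a mat" where
  "mat_of n X = mat n n (\<lambda>(i, j). (X \<rhd> basis_vec j) i)"

lemma mat_of_carrier [simp]: "mat_of n X \<in> carrier_mat n n" "dim_row (mat_of n X) = n" "dim_col (mat_of n X) = n"
  by (simp_all add: mat_of_def)

lemma mat_of_mult:
  assumes "cor n * Y = Y * cor n"
  shows "mat_of n (X * Y) = mat_of n X * mat_of n Y"
proof (rule eq_matI)
  fix i j assume "i < dim_row (mat_of n X * mat_of n Y)" "j < dim_col (mat_of n X * mat_of n Y)"
  then have ij: "i < n" "j < n" by simp_all
  have "Y \<rhd> basis_vec j = cor n \<rhd> Y \<rhd> basis_vec j"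
    using cor_basis_vec[OF ij(2)] assms by (metis app_endo_simps(6))
  then have "X \<rhd> Y \<rhd> basis_vec j = X \<rhd> cor n \<rhd> Y \<rhd> basis_vec j" by simp
  also have "\<dots> = (\<Sum>k<n. sc ((Y \<rhd> basis_vec j) k) \<rhd> X \<rhd> basis_vec k)"
    by (simp only: cor_sum app_sum app_sc_commute)
  finally have "X \<rhd> Y \<rhd> basis_vec j = (\<Sum>k<n. sc ((Y \<rhd> basis_vec j) k) \<rhd> X \<rhd> basis_vec k)" .
  then show "mat_of n (X * Y) $$ (i, j) = (mat_of n X * mat_of n Y) $$ (i, j)"
    using ij by (simp add: mat_of_def scalar_prod_def sum_fun_apply lessThan_atLeast0 mult.commute)
qed simp_all

lemma mat_of_simps:
  "mat_of n 0 = 0\<^sub>m n n" "mat_of n 1 = 1\<^sub>m n" "mat_of n (cor n) = 1\<^sub>m n"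
  "mat_of n (X + Y) = mat_of n X + mat_of n Y" "mat_of n (X - Y) = mat_of n X - mat_of n Y"
  by (auto intro!: eq_matI simp: mat_of_def fun_apply basis_vec_apply cor_basis_vec)

lemma mat_of_eqD:
  assumes "mat_of n X = mat_of n Y"
  shows "cor n * X * cor n = cor n * Y * cor n"
proof (rule endo_eqI)
  fix u
  have "cor n \<rhd> X \<rhd> basis_vec j = cor n \<rhd> Y \<rhd> basis_vec j" if "j < n" for j
  proof
    fix i
    show "(cor n \<rhd> X \<rhd> basis_vec j) i = (cor n \<rhd> Y \<rhd> basis_vec j) i"
      using arg_cong[OF assms, of "\<lambda>M. M $$ (i, j)"] that
      by (cases "i < n") (simp_all add: app_cor mat_of_def)
  qed
  then show "(cor n * X * cor n) \<rhd> u = (cor n * Y * cor n) \<rhd> u"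
    by (simp add: cor_sum[of n u] app_sum app_sc_commute)
qed

lemma mat_of_op_of: "M \<in> carrier_mat n n \<Longrightarrow> mat_of n (op_of n M) = M"
  by (auto intro!: eq_matI simp: mat_of_def app_op_of basis_vec_apply if_distrib cong: if_cong)

lemma op_of_mult:
  assumes "M \<in> carrier_mat n n" "M' \<in> carrier_mat n n"
  shows "op_of n (M * M') = op_of n M * op_of n M'"
proof (rule endo_eqI, rule ext)
  fix u i
  show "(op_of n (M * M') \<rhd> u) i = ((op_of n M * op_of n M') \<rhd> u) i"
  proof (cases "i < n")
    case True
    have "(op_of n (M * M') \<rhd> u) i = (\<Sum>j<n. (\<Sum>k<n. M $$ (i, k) * M' $$ (k, j)) * u j)"
      using True assms by (simp add: app_op_of scalar_prod_def lessThan_atLeast0)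
    also have "\<dots> = (\<Sum>k<n. \<Sum>j<n. M $$ (i, k) * M' $$ (k, j) * u j)"
      by (subst sum.swap) (simp add: sum_distrib_right)
    also have "\<dots> = ((op_of n M * op_of n M') \<rhd> u) i"
      using True by (simp add: app_op_of sum_distrib_left mult.assoc)
    finally show ?thesis .
  qed (simp add: app_op_of)
qed

lemma op_of_1: "op_of n (1\<^sub>m n :: 'a::field mat) = 1"
proof (rule endo_eqI, rule ext)
  fix u :: "nat \<Rightarrow> 'a" and i
  have "(\<Sum>j<n. 1\<^sub>m n $$ (i, j) * u j) = (\<Sum>j<n. if j = i then u j else 0)" if "i < n"
    using that by (intro sum.cong) auto
  then show "(op_of n (1\<^sub>m n) \<rhd> u) i = (1 \<rhd> u) i" by (simp add: app_op_of)
qed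

lemma op_of_cor: "cor n * op_of n M = op_of n M * cor n"
  by (rule endo_eqI) (auto simp: app_op_of app_cor fun_eq_iff)

lemma op_of_outside: "(1 - cor n) * op_of n M = 1 - cor n"
  by (rule endo_eqI) (auto simp: app_op_of app_cor fun_eq_iff fun_apply)

lemma op_of_eqI:
  assumes "M \<in> carrier_mat n n" "mat_of n X = M" "cor n * X = X * cor n" "(1 - cor n) * X = 1 - cor n"
  shows "op_of n M = X"
proof -
  have "cor n * op_of n M * cor n = cor n * X * cor n"
    by (rule mat_of_eqD) (simp add: mat_of_op_of assms)
  then have "cor n * op_of n M = cor n * X"
    using op_of_cor[of n M] assms(3) cor_idem by (metis mult.assoc)
  moreover have "op_of n M = cor n * op_of n M + (1 - cor n) * op_of n M" "X = cor n * X + (1 - cor n) * X"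
    by (simp_all add: left_diff_distrib)
  ultimately show ?thesis using assms(4) op_of_outside by metis
qed

subsection \<open>Determinants of reflections\<close>

text \<open>Sylvester's determinant identity, from two block-triangular factorizations of the matrix
  with blocks 1, P, Q, 1.\<close>

lemma det_one_minus_mult_swap:
  fixes P Q :: "'a::idom mat"
  assumes P: "P \<in> carrier_mat n d" and Q: "Q \<in> carrier_mat d n"
  shows "det (1\<^sub>m n - P * Q) = det (1\<^sub>m d - Q * P)"
proof -
  let ?L = "four_block_mat (1\<^sub>m n) P (0\<^sub>m d n) (1\<^sub>m d) * four_block_mat (1\<^sub>m n - P * Q) (0\<^sub>m n d) Q (1\<^sub>m d)"
  let ?R = "four_block_mat (1\<^sub>m n) (0\<^sub>m n d) Q (1\<^sub>m d) * four_block_mat (1\<^sub>m n) P (0\<^sub>m d n) (1\<^sub>m d - Q * P)"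
  have PQ: "P * Q \<in> carrier_mat n n" "Q * P \<in> carrier_mat d d" using assms by auto
  have "?L = four_block_mat (1\<^sub>m n) P Q (1\<^sub>m d)"
    by (subst mult_four_block_mat[of _ n n _ d _ d]) (use assms PQ in \<open>auto intro!: cong_four_block_mat eq_matI\<close>)
  also have "\<dots> = ?R"
    by (subst mult_four_block_mat[of _ n n _ d _ d]) (use assms PQ in \<open>auto intro!: cong_four_block_mat eq_matI\<close>)
  finally have eq: "det ?L = det ?R" by simp
  have c: "1\<^sub>m n - P * Q \<in> carrier_mat n n" "1\<^sub>m d - Q * P \<in> carrier_mat d d"
    using PQ by (simp_all add: minus_carrier_mat)
  note u = det_four_block_mat_lower_left_zero[OF one_carrier_mat P refl one_carrier_mat]
    det_four_block_mat_lower_left_zero[OF one_carrier_mat P refl c(2)]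
  note l = det_four_block_mat_upper_right_zero[OF c(1) refl Q one_carrier_mat]
    det_four_block_mat_upper_right_zero[OF one_carrier_mat refl Q one_carrier_mat]
  have "det ?L = det (1\<^sub>m n - P * Q)"
    using P Q c by (subst det_mult[of _ "n + d"]) (auto simp only: u l det_one mult_1 mult_1_right four_block_carrier_mat one_carrier_mat)
  moreover have "det ?R = det (1\<^sub>m d - Q * P)"
    using P Q c by (subst det_mult[of _ "n + d"]) (auto simp only: u l det_one mult_1 mult_1_right four_block_carrier_mat one_carrier_mat)
  ultimately show ?thesis using eq by simp
qed

lemma basis_of_matrices:
  fixes E :: "'a::field endo"
  assumes bq: "basis_of E d b q" and E: "cor n * E = E" "E * cor n = E"
  defines "P \<equiv> mat n d (\<lambda>(i, j). b j i)" and "Q \<equiv> mat d n (\<lambda>(i, j). q i (basis_vec j))"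
  shows "mat_of n E = P * Q" "Q * P = 1\<^sub>m d"
proof -
  have b: "cor n \<rhd> b j = b j" if "j < d" for j
    using basis_of_fix[OF bq that] E(1) by (metis app_endo_simps(6))
  show "Q * P = 1\<^sub>m d"
  proof (rule eq_matI)
    fix i j assume "i < dim_row (1\<^sub>m d :: 'a mat)" "j < dim_col (1\<^sub>m d :: 'a mat)"
    then have ij: "i < d" "j < d" by simp_all
    have q: "functional (q i)" using bq ij by (simp add: basis_of_def)
    have "q i (b j) = q i (\<Sum>k<n. sc (b j k) \<rhd> basis_vec k)"
      using b[OF ij(2)] by (simp add: cor_sum)
    also have "\<dots> = (\<Sum>k<n. q i (basis_vec k) * b j k)"
      by (simp add: functional_sum[OF q] functional_simps[OF q] mult.commute)
    finally have "(Q * P) $$ (i, j) = q i (b j)"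
      using ij by (simp add: P_def Q_def scalar_prod_def lessThan_atLeast0)
    then show "(Q * P) $$ (i, j) = 1\<^sub>m d $$ (i, j)" using bq ij by (simp add: basis_of_def)
  qed (simp_all add: P_def Q_def)
  show "mat_of n E = P * Q"
  proof (rule eq_matI)
    fix i j assume "i < dim_row (P * Q)" "j < dim_col (P * Q)"
    then have ij: "i < n" "j < n" by (simp_all add: P_def Q_def)
    then show "mat_of n E $$ (i, j) = (P * Q) $$ (i, j)"
      using bq by (simp add: mat_of_def P_def Q_def scalar_prod_def lessThan_atLeast0 basis_of_def sum_fun_apply mult.commute)
  qed (simp_all add: P_def Q_def)
qed

text \<open>With E = PQ and QP = 1, the swap identity turns det(1 - 2PQ) into the determinant of 1 -
  2 = -1 in size \<open>d\<close>.\<close>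

lemma det_reflection:
  fixes E :: "'a::field endo"
  assumes "has_rank E d" and E: "cor n * E = E" "E * cor n = E"
  shows "det (mat_of n (1 - (E + E))) = (- 1) ^ d"
proof -
  obtain b q where bq: "basis_of E d b q" using assms(1) by (auto simp: has_rank_def)
  define P where "P = mat n d (\<lambda>(i, j). b j i)"
  define Q where "Q = mat d n (\<lambda>(i, j). q i (basis_vec j))"
  have PQ: "mat_of n E = P * Q" "Q * P = 1\<^sub>m d"
    using basis_of_matrices[OF bq E] by (simp_all add: P_def Q_def)
  have c: "P \<in> carrier_mat n d" "Q \<in> carrier_mat d n" by (simp_all add: P_def Q_def)
  have "det (mat_of n (1 - (E + E))) = det (1\<^sub>m n - (P + P) * Q)"
    using c by (simp add: mat_of_simps PQ(1) add_mult_distrib_mat[of _ n d])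
  also have "\<dots> = det (1\<^sub>m d - Q * (P + P))"
    using c by (intro det_one_minus_mult_swap) auto
  also have "1\<^sub>m d - Q * (P + P) = - 1 \<cdot>\<^sub>m 1\<^sub>m d"
    using c by (subst mult_add_distrib_mat[of _ d n]) (auto simp: PQ(2) intro!: eq_matI)
  finally show ?thesis by (simp add: det_smult)
qed

subsection \<open>Elementary divisors\<close>

lemma similar_mat_of_acts_as:
  fixes A :: "'a::{field, finite} mat"
  assumes A: "A \<in> carrier_mat n n" and ac: "acts_as (op_of n A) (cor n) D"
  shows "similar_mat A D"
proof -
  obtain d b q where bq: "basis_of (cor n) d b q" and D: "D \<in> carrier_mat d d"
    and act: "\<And>j. j < d \<Longrightarrow> op_of n A \<rhd> b j = (\<Sum>i<d. sc (D $$ (i, j)) \<rhd> b i)"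
    using ac unfolding acts_as_def by blast
  have dn: "d = n" using has_rank_unique bq basis_of_cor unfolding has_rank_def by blast
  define P where "P = mat n n (\<lambda>(i, j). b j i)"
  define Q where "Q = mat n n (\<lambda>(i, j). q i (basis_vec j))"
  have PQ: "1\<^sub>m n = P * Q" "Q * P = 1\<^sub>m n"
    using basis_of_matrices[OF bq cor_idem cor_idem] unfolding P_def Q_def dn mat_of_simps by blast+
  have c: "P \<in> carrier_mat n n" "Q \<in> carrier_mat n n" by (simp_all add: P_def Q_def)
  have "A * P = P * D"
  proof (rule eq_matI)
    fix i j assume "i < dim_row (P * D)" "j < dim_col (P * D)"
    then have ij: "i < n" "j < n" using D c dn by simp_all
    have "(A * P) $$ (i, j) = (op_of n A \<rhd> b j) i"
      using ij A by (simp add: app_op_of P_def scalar_prod_def lessThan_atLeast0)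
    also have "\<dots> = (P * D) $$ (i, j)"
      using ij D dn act[of j] by (simp add: P_def scalar_prod_def lessThan_atLeast0 sum_fun_apply mult.commute)
    finally show "(A * P) $$ (i, j) = (P * D) $$ (i, j)" .
  qed (use A D c dn in auto)
  then have "A = P * D * Q"
    using A c PQ(1) assoc_mult_mat[OF A c] by (metis right_mult_one_mat)
  then show ?thesis
    using A D c PQ dn by (intro similar_matI[of A D P Q n]) auto
qed

lemma acts_as_of_similar_mat:
  fixes A :: "'a::field mat"
  assumes A: "A \<in> carrier_mat n n" and sim: "similar_mat A D"
  shows "acts_as (op_of n A) (cor n) D"
proof -
  obtain P Q where "similar_mat_wit A D P Q" using sim by (auto simp: similar_mat_def)
  from similar_mat_witD2[OF A this] have PQ: "P * Q = 1\<^sub>m n" "Q * P = 1\<^sub>m n" "A = P * D * Q"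
    and c: "D \<in> carrier_mat n n" "P \<in> carrier_mat n n" "Q \<in> carrier_mat n n" by auto
  define b where "b j = cor n \<rhd> (\<lambda>i. P $$ (i, j))" for j
  define q where "q i u = (\<Sum>j<n. Q $$ (i, j) * u j)" for i and u :: "nat \<Rightarrow> 'a"
  have AP: "A * P = P * D"
    using PQ(2,3) c A by (simp add: assoc_mult_mat[of _ n n _ n _ n])
  have sumPQ: "(\<Sum>k<n. M $$ (i, k) * N $$ (k, j)) = (M * N) $$ (i, j)"
    if "M \<in> carrier_mat n n" "N \<in> carrier_mat n n" "i < n" "j < n" for M N :: "'a mat" and i j
    using that by (simp add: scalar_prod_def lessThan_atLeast0)
  have "basis_of (cor n) n b q"
    unfolding basis_of_def
  proof (intro conjI allI impI)
    fix i assume "i < n"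
    show "functional (q i)" unfolding q_def[abs_def] by (intro functional_lincomb functional_coordinate)
  next
    fix i j assume ij: "i < n" "j < n"
    have "q i (b j) = (\<Sum>k<n. Q $$ (i, k) * P $$ (k, j))" by (simp add: q_def b_def app_cor)
    then show "q i (b j) = (if i = j then 1 else 0)" using ij c PQ(2) by (simp only: sumPQ) simp
  next
    fix u
    show "cor n \<rhd> u = (\<Sum>i<n. sc (q i u) \<rhd> b i)"
    proof
      fix k
      show "(cor n \<rhd> u) k = (\<Sum>i<n. sc (q i u) \<rhd> b i) k"
      proof (cases "k < n")
        case True
        have "(\<Sum>i<n. q i u * P $$ (k, i)) = (\<Sum>i<n. \<Sum>j<n. P $$ (k, i) * Q $$ (i, j) * u j)"
          by (simp add: q_def sum_distrib_right sum_distrib_left mult_ac)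
        also have "\<dots> = (\<Sum>j<n. (\<Sum>i<n. P $$ (k, i) * Q $$ (i, j)) * u j)"
          by (subst sum.swap) (simp add: sum_distrib_right)
        also have "\<dots> = (\<Sum>j<n. if j = k then u j else 0)"
          using True c PQ(1) by (intro sum.cong) (auto simp only: sumPQ lessThan_iff, auto)
        finally show ?thesis using True by (simp add: app_cor sum_fun_apply b_def)
      qed (simp add: app_cor sum_fun_apply b_def)
    qed
  qed
  moreover have "op_of n A \<rhd> b j = (\<Sum>i<n. sc (D $$ (i, j)) \<rhd> b i)" if j: "j < n" for j
  proof
    fix k
    show "(op_of n A \<rhd> b j) k = (\<Sum>i<n. sc (D $$ (i, j)) \<rhd> b i) k"
    proof (cases "k < n")
      case True
      have "(op_of n A \<rhd> b j) k = (A * P) $$ (k, j)"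
        using True j A c by (simp add: app_op_of b_def app_cor sumPQ)
      also have "\<dots> = (\<Sum>i<n. P $$ (k, i) * D $$ (i, j))" using True j c by (simp add: AP sumPQ)
      finally show ?thesis using True by (simp add: sum_fun_apply b_def app_cor mult.commute)
    qed (simp add: app_op_of b_def app_cor sum_fun_apply)
  qed
  ultimately show ?thesis using c(1) unfolding acts_as_def by blast
qed

text \<open>Commutation with \<open>E\<close> makes the coordinate functionals transform by the same
  matrix as the basis. Block-diagonality then splits the functionals too, so the projection onto
  either part of the basis commutes with \<open>A\<close>.\<close>

lemma acts_as_block_split:
  fixes A :: "'a::field endo"
  assumes ac: "acts_as A E (four_block_mat D1 (0\<^sub>m d1 d2) (0\<^sub>m d2 d1) D2)" and comm: "A * E = E * A"
    and D: "D1 \<in> carrier_mat d1 d1" "D2 \<in> carrier_mat d2 d2"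
  shows "\<exists>E1 E2. acts_as A E1 D1 \<and> A * E1 = E1 * A \<and> E * E1 = E1 \<and> E1 * E = E1 \<and>
    acts_as A E2 D2 \<and> A * E2 = E2 * A \<and> E * E2 = E2 \<and> E2 * E = E2"
proof -
  let ?D = "four_block_mat D1 (0\<^sub>m d1 d2) (0\<^sub>m d2 d1) D2"
  have D': "?D \<in> carrier_mat (d1 + d2) (d1 + d2)" using D by simp
  obtain d b q where "basis_of E d b q" "?D \<in> carrier_mat d d"
    and "\<And>j. j < d \<Longrightarrow> A \<rhd> b j = (\<Sum>i<d. sc (?D $$ (i, j)) \<rhd> b i)"
    using ac unfolding acts_as_def by blast
  moreover have "d = d1 + d2" using calculation(2) D' by auto
  ultimately have bq: "basis_of E (d1 + d2) b q"
    and act: "\<And>j. j < d1 + d2 \<Longrightarrow> A \<rhd> b j = (\<Sum>i<d1 + d2. sc (?D $$ (i, j)) \<rhd> b i)" by auto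
  have split: "(\<Sum>i<d1 + d2. f i) = (\<Sum>i<d1. f i) + (\<Sum>i<d2. f (d1 + i))" for f :: "nat \<Rightarrow> 'b::comm_monoid_add"
    by (induction d2) (auto simp: algebra_simps)
  have f: "functional (q i)" if "i < d1 + d2" for i using bq that by (simp add: basis_of_def)
  have qA: "q i (A \<rhd> u) = (\<Sum>j<d1 + d2. ?D $$ (i, j) * q j u)" if i: "i < d1 + d2" for i u
  proof -
    have "q i (A \<rhd> u) = q i (A \<rhd> E \<rhd> u)"
      using basis_of_coord[OF bq i, of "A \<rhd> u"] commute_app[OF comm] by simp
    also have "A \<rhd> E \<rhd> u = (\<Sum>j<d1 + d2. sc (q j u) \<rhd> A \<rhd> b j)"
      using bq by (simp add: basis_of_def app_sum app_sc_commute)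
    also have "q i \<dots> = (\<Sum>j<d1 + d2. q j u * q i (A \<rhd> b j))"
      by (simp add: functional_sum[OF f[OF i]] functional_simps[OF f[OF i]])
    also have "\<dots> = (\<Sum>j<d1 + d2. ?D $$ (i, j) * q j u)"
    proof (rule sum.cong)
      fix j assume "j \<in> {..<d1 + d2}"
      then have j: "j < d1 + d2" by simp
      have "q i (A \<rhd> b j) = (\<Sum>k<d1 + d2. ?D $$ (k, j) * q i (b k))"
        by (simp only: act[OF j] functional_sum[OF f[OF i]] functional_simps[OF f[OF i]])
      also have "\<dots> = (\<Sum>k<d1 + d2. if k = i then ?D $$ (k, j) else 0)"
        using bq i by (intro sum.cong) (auto simp: basis_of_def)
      also have "\<dots> = ?D $$ (i, j)" using i by (simp only: sum.delta finite_lessThan lessThan_iff if_True)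
      finally show "q j u * q i (A \<rhd> b j) = ?D $$ (i, j) * q j u" by (simp only: mult.commute)
    qed simp
    finally show ?thesis .
  qed
  have sub: "\<exists>E1. acts_as A E1 D1' \<and> A * E1 = E1 * A \<and> E * E1 = E1 \<and> E1 * E = E1"
    if sub: "basis_of E1 d1' b1 q1" "D1' \<in> carrier_mat d1' d1'"
      "\<And>j. j < d1' \<Longrightarrow> A \<rhd> b1 j = (\<Sum>i<d1'. sc (D1' $$ (i, j)) \<rhd> b1 i)"
      "\<And>i u. i < d1' \<Longrightarrow> q1 i (A \<rhd> u) = (\<Sum>j<d1'. D1' $$ (i, j) * q1 j u)"
      "\<And>i. i < d1' \<Longrightarrow> E \<rhd> b1 i = b1 i" "\<And>i u. i < d1' \<Longrightarrow> q1 i (E \<rhd> u) = q1 i u"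
    for E1 d1' b1 q1 D1'
  proof (intro exI conjI)
    show "acts_as A E1 D1'" unfolding acts_as_def using sub by blast
    have E1: "E1 \<rhd> w = (\<Sum>i<d1'. sc (q1 i w) \<rhd> b1 i)" for w using sub(1) by (simp add: basis_of_def)
    show "E * E1 = E1" "E1 * E = E1"
      by (auto intro!: endo_eqI simp: E1 app_sum app_sc_commute sub(5,6))
    show "A * E1 = E1 * A"
    proof (rule endo_eqI)
      fix u
      have sc: "sc r \<rhd> sc r' \<rhd> w = sc (r' * r) \<rhd> w" for r r' w
        by (metis app_endo_simps(6) sc_simps(6) mult.commute)
      have "(A * E1) \<rhd> u = (\<Sum>j<d1'. sc (q1 j u) \<rhd> A \<rhd> b1 j)"
        by (simp only: app_endo_simps(6) E1 app_sum app_sc_commute[of A])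
      also have "\<dots> = (\<Sum>j<d1'. \<Sum>i<d1'. sc (D1' $$ (i, j) * q1 j u) \<rhd> b1 i)"
        by (intro sum.cong refl) (simp only: sub(3) lessThan_iff app_sum sc)
      also have "\<dots> = (\<Sum>i<d1'. \<Sum>j<d1'. sc (D1' $$ (i, j) * q1 j u) \<rhd> b1 i)" by (rule sum.swap)
      also have "\<dots> = (\<Sum>i<d1'. sc (q1 i (A \<rhd> u)) \<rhd> b1 i)"
        by (intro sum.cong refl) (simp only: sub(4) lessThan_iff sc_sum app_sum_endo)
      finally show "(A * E1) \<rhd> u = (E1 * A) \<rhd> u" by (simp add: E1)
    qed
  qed
  have b1: "basis_of (\<Sum>i<d1. rank1 (q i) (b i)) d1 b q"
    using bq f by (auto simp: basis_of_def app_sum_endo app_rank1)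
  have b2: "basis_of (\<Sum>i<d2. rank1 (q (d1 + i)) (b (d1 + i))) d2 (\<lambda>i. b (d1 + i)) (\<lambda>i. q (d1 + i))"
    using bq f by (auto simp: basis_of_def app_sum_endo app_rank1)
  have "A \<rhd> b j = (\<Sum>i<d1. sc (D1 $$ (i, j)) \<rhd> b i)" if "j < d1" for j
    using that D by (simp add: act split)
  moreover have "q i (A \<rhd> u) = (\<Sum>j<d1. D1 $$ (i, j) * q j u)" if "i < d1" for i u
    using that D by (simp add: qA split)
  moreover have "A \<rhd> b (d1 + j) = (\<Sum>i<d2. sc (D2 $$ (i, j)) \<rhd> b (d1 + i))" if "j < d2" for j
    using that D by (simp add: act split)
  moreover have "q (d1 + i) (A \<rhd> u) = (\<Sum>j<d2. D2 $$ (i, j) * q (d1 + j) u)" if "i < d2" for i u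
    using that D by (simp add: qA split)
  moreover have "E \<rhd> b i = b i" "q i (E \<rhd> u) = q i u" if "i < d1 + d2" for i u
    using basis_of_fix[OF bq that] basis_of_coord[OF bq that] by auto
  ultimately show ?thesis
    using sub[OF b1 D(1)] sub[OF b2 D(2)] by simp
qed

lemma acts_as_companion_summand:
  fixes A :: "'a::field endo"
  assumes "acts_as A E (diag_block_mat (map companion_mat ds))" "A * E = E * A" "m \<in> set ds"
  shows "\<exists>F. acts_as A F (companion_mat m) \<and> A * F = F * A \<and> E * F = F \<and> F * E = F"
  using assms
proof (induction ds arbitrary: E)
  case (Cons a ds)
  let ?D = "diag_block_mat (map companion_mat ds)"
  have sq: "dim_col (diag_block_mat (map companion_mat cs)) = dim_row (diag_block_mat (map companion_mat cs))"
    for cs :: "'a poly list"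
    by (induction cs) (auto simp: Let_def companion_mat_def)
  have "acts_as A E (four_block_mat (companion_mat a) (0\<^sub>m (degree a) (dim_row ?D)) (0\<^sub>m (dim_row ?D) (degree a)) ?D)"
    using Cons.prems(1) by (simp add: Let_def sq) (simp add: companion_mat_def)
  moreover have "companion_mat a \<in> carrier_mat (degree a) (degree a)" by (simp add: companion_mat_def)
  moreover have "?D \<in> carrier_mat (dim_row ?D) (dim_row ?D)" using sq by (metis carrier_matI)
  ultimately obtain E1 E2 where 1: "acts_as A E1 (companion_mat a)" "A * E1 = E1 * A" "E * E1 = E1" "E1 * E = E1"
    and 2: "acts_as A E2 ?D" "A * E2 = E2 * A" "E * E2 = E2" "E2 * E = E2"
    using acts_as_block_split[OF _ Cons.prems(2)] by blast
  show ?case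
  proof (cases "m = a")
    case False
    then obtain F where "acts_as A F (companion_mat m)" "A * F = F * A" "E2 * F = F" "F * E2 = F"
      using Cons.IH[OF 2(1,2)] Cons.prems(3) by auto
    then show ?thesis using 2(3,4) by (metis mult.assoc)
  qed (use 1 in blast)
qed simp

text \<open>The first basis vector of a companion block is cyclic, and a suitable coordinate detects
  its socle.\<close>

lemma companion_cyclic_vector:
  fixes A :: "'a::field endo"
  assumes ac: "acts_as A F (companion_mat (p ^ k))" and comm: "A * F = F * A"
    and p: "monic p" "degree p > 0" "k > 0"
  shows "\<exists>v \<phi>. functional \<phi> \<and> F \<rhd> v = v \<and> pev (p ^ k) A \<rhd> v = 0 \<and>
    (\<forall>u. \<phi> (pev (p ^ k) A \<rhd> u) = 0) \<and> (\<forall>u. \<phi> (F \<rhd> u) = \<phi> u) \<and> \<phi> (pev (p ^ (k - 1)) A \<rhd> v) \<noteq> 0"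
proof -
  let ?m = "p ^ k" let ?d = "degree ?m"
  obtain d b q where bq: "basis_of F d b q" and C: "companion_mat ?m \<in> carrier_mat d d"
    and act: "\<And>j. j < d \<Longrightarrow> A \<rhd> b j = (\<Sum>i<d. sc (companion_mat ?m $$ (i, j)) \<rhd> b i)"
    using ac unfolding acts_as_def by blast
  have d: "d = ?d" using carrier_matD(1)[OF C] by (simp add: companion_mat_def)
  have monic: "monic ?m" using p(1) by (rule monic_power)
  have p0: "p \<noteq> 0" using p(1) by auto
  have d0: "d > 0" using p p0 by (simp add: d degree_power_eq)
  have shift: "A \<rhd> b j = b (Suc j)" if "Suc j < d" for j
  proof -
    have "A \<rhd> b j = (\<Sum>i<d. sc (if i = Suc j then 1 else 0) \<rhd> b i)"
      using that by (simp only: act Suc_lessD) (intro sum.cong, auto simp: companion_mat_def d)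
    then show ?thesis using that by (simp add: sum_if_eq_sc)
  qed
  have pow: "A ^ j \<rhd> b 0 = b j" if "j < d" for j
    using that
  proof (induction j)
    case (Suc j)
    then have "A ^ j \<rhd> b 0 = b j" by simp
    then show ?case using shift[OF Suc.prems] by simp
  qed simp
  obtain d' where d': "d = Suc d'" using d0 by (metis not0_implies_Suc less_numeral_extra(3))
  have "A \<rhd> b d' = (\<Sum>i<d. sc (- coeff ?m i) \<rhd> b i)"
    using d' by (subst act) (auto intro!: sum.cong simp: companion_mat_def d[symmetric])
  then have top: "A ^ d \<rhd> b 0 = (\<Sum>i<d. sc (- coeff ?m i) \<rhd> b i)" using pow[of d'] d' by simp
  have null0: "pev ?m A \<rhd> b 0 = 0"
  proof -
    have "pev ?m A \<rhd> b 0 = (\<Sum>i<Suc d. sc (coeff ?m i) \<rhd> A ^ i \<rhd> b 0)"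
      by (subst pev_eq_0_degree[of _ "Suc d"]) (simp_all add: d app_sum_endo del: sum.lessThan_Suc)
    also have "\<dots> = (\<Sum>i<d. sc (coeff ?m i) \<rhd> b i) + A ^ d \<rhd> b 0"
      using monic by (simp add: pow flip: d)
    finally show ?thesis by (simp add: top sum_negf)
  qed
  have nullF: "pev ?m A \<rhd> F \<rhd> u = 0" for u
  proof -
    have "pev ?m A \<rhd> b i = 0" if i: "i < d" for i
    proof -
      have "A ^ i * pev ?m A = pev ?m A * A ^ i"
        by (rule pev_commute) (simp add: power_commutes)
      then have "pev ?m A \<rhd> A ^ i \<rhd> b 0 = A ^ i \<rhd> pev ?m A \<rhd> b 0" by (metis app_endo_simps(6))
      then show ?thesis by (simp only: pow[OF i] null0 app_zero)
    qed
    then show ?thesis using bq by (simp add: basis_of_def app_sum app_sc_commute del: pev_power)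
  qed
  \<comment> \<open>The coordinate at the degree of p^(k-1) reads off the leading coefficient 1 of
    p^(k-1) applied to the cyclic vector.\<close>
  let ?r = "p ^ (k - 1)" let ?i = "degree ?r"
  have i: "?i < d" using p p0 by (simp add: d degree_power_eq)
  let ?\<phi> = "q ?i"
  have f: "functional ?\<phi>" using bq i by (simp add: basis_of_def)
  have F: "?\<phi> (F \<rhd> u) = ?\<phi> u" for u by (rule basis_of_coord[OF bq i])
  have "?\<phi> (pev ?m A \<rhd> u) = 0" for u
  proof -
    have "F \<rhd> pev ?m A \<rhd> u = pev ?m A \<rhd> F \<rhd> u" by (rule commute_app[OF pev_commute]) (simp add: comm)
    then show ?thesis using F[of "pev ?m A \<rhd> u"] nullF[of u] functional_simps(3)[OF f] by simp
  qed
  moreover have "?\<phi> (pev ?r A \<rhd> b 0) = 1"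
  proof -
    have "pev ?r A \<rhd> b 0 = (\<Sum>j<d. sc (coeff ?r j) \<rhd> b j)"
      using i by (subst pev_eq_0_degree[of _ d]) (auto simp: app_sum_endo pow intro!: sum.cong)
    then have "?\<phi> (pev ?r A \<rhd> b 0) = (\<Sum>j<d. coeff ?r j * ?\<phi> (b j))"
      by (simp only: functional_sum[OF f] functional_simps[OF f])
    also have "\<dots> = (\<Sum>j<d. if j = ?i then coeff ?r j else 0)"
      using bq i by (intro sum.cong) (auto simp: basis_of_def)
    also have "\<dots> = coeff ?r ?i" using i by simp
    also have "\<dots> = 1" using p(1) by (rule monic_power)
    finally show ?thesis .
  qed
  ultimately show ?thesis
    using f F null0 basis_of_fix[OF bq d0] by (intro exI[of _ "b 0"] exI[of _ ?\<phi>]) simp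
qed

lemma elementary_divisors_of_acts_as:
  fixes A :: "'a::{field, finite} mat"
  assumes "acts_as (op_of n A) (cor n) D" "A \<in> carrier_mat n n"
    "D = diag_block_mat (map companion_mat ds)" "\<forall>d\<in>set ds. \<exists>p k. monic p \<and> irreducible p \<and> 0 < k \<and> d = p ^ k"
  shows "elementary_divisors A ds"
  using assms similar_mat_of_acts_as unfolding elementary_divisors_def by blast

context isometry
begin

subsection \<open>Odd Jordan blocks of \<open>g\<close> for the eigenvalues \<open>1\<close> and \<open>-1\<close>\<close>

lemma g_sc: "g * sc c = sc c * g" "g' * sc c = sc c * g'"
  by (rule sc_commute)+

lemma g_app: "g \<rhd> g' \<rhd> u = u" "g' \<rhd> g \<rhd> u = u"
  using g_inv by (metis app_endo_simps(2,6))+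

lemma pev_linear: "pev [:- c, 1:] X = X - sc c"
  by simp

lemma x_linear: "pev [:-2 * \<epsilon>, 1:] x = x - sc \<epsilon> - sc \<epsilon>"
proof -
  have "-2 * \<epsilon> = - \<epsilon> + - \<epsilon>"
    using mult_2[of \<epsilon>] by (simp only: minus_mult_left[symmetric] minus_add_distrib)
  then show ?thesis by (simp only: pev_pCons pev_0 sc_simps(1-4)) simp
qed

lemma g_x: "g * x = x * g"
  by (simp add: x_def algebra_simps g_inv)

text \<open>Iterates (g - \<epsilon>)^2 = g(x - 2\<epsilon>), which holds since \<epsilon>^2 = 1 = g
  g'.\<close>

lemma nilpotent_even_power:
  assumes \<epsilon>: "\<epsilon> * \<epsilon> = 1"
  shows "(g - sc \<epsilon>) ^ (2 * m) = g ^ m * pev [:-2 * \<epsilon>, 1:] x ^ m"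
proof (induction m)
  case (Suc m)
  let ?\<pi> = "pev [:-2 * \<epsilon>, 1:] x"
  have s: "sc \<epsilon> * sc \<epsilon> = 1" using \<epsilon> by (simp flip: sc_simps)
  have "(g - sc \<epsilon>) * (g - sc \<epsilon>) = g * ?\<pi>"
    unfolding x_linear by (simp add: x_def algebra_simps g_inv g_sc s)
  then have "(g - sc \<epsilon>) * (g - sc \<epsilon>) * (g ^ m * ?\<pi> ^ m) = g * (?\<pi> * g ^ m) * ?\<pi> ^ m"
    by (simp only: mult.assoc)
  also have "?\<pi> * g ^ m = g ^ m * ?\<pi>"
    using pev_commute[OF g_x] by (metis power_commuting_commutes)
  finally have "(g - sc \<epsilon>) * (g - sc \<epsilon>) * (g ^ m * ?\<pi> ^ m) = g * g ^ m * (?\<pi> * ?\<pi> ^ m)"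
    by (simp only: mult.assoc)
  then show ?case using Suc.IH by (simp add: mult.assoc)
qed simp

lemma g_S: "\<epsilon> * \<epsilon> = 1 \<Longrightarrow> g * S = (g + sc \<epsilon>) * (g - sc \<epsilon>)"
proof -
  assume "\<epsilon> * \<epsilon> = 1"
  then have "sc \<epsilon> * sc \<epsilon> = 1" by (simp flip: sc_simps)
  then show ?thesis by (simp add: S_def algebra_simps g_inv g_sc)
qed

lemma g_power_cancel: "g ^ m \<rhd> u = 0 \<longleftrightarrow> u = 0"
proof
  assume "g ^ m \<rhd> u = 0"
  then show "u = 0"
  proof (induction m arbitrary: u)
    case (Suc m)
    then show ?case using g_app(2)[of "g ^ m \<rhd> u"] by simp
  qed simp
qed simp

text \<open>The pairing condition makes the cyclic \<open>g\<close>-space of \<open>v\<close>, a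
  Jordan block of size \<open>k\<close>, nondegenerate.\<close>

definition jordan_vector :: "'a \<Rightarrow> nat \<Rightarrow> (nat \<Rightarrow> 'a) \<Rightarrow> bool" where
  "jordan_vector \<epsilon> k v \<longleftrightarrow> \<epsilon> * \<epsilon> = 1 \<and> odd k \<and> e \<rhd> v = v \<and>
     (g - sc \<epsilon>) ^ k \<rhd> v = 0 \<and> b v ((g - sc \<epsilon>) ^ (k - 1) \<rhd> v) \<noteq> 0"

lemma odd_power_app:
  assumes \<epsilon>: "\<epsilon> * \<epsilon> = 1"
  shows "(g - sc \<epsilon>) ^ (2 * m) \<rhd> v = g ^ m \<rhd> act ([:-2 * \<epsilon>, 1:] ^ m) v"
    "(g - sc \<epsilon>) ^ Suc (2 * m) \<rhd> v = g ^ m \<rhd> (g - sc \<epsilon>) \<rhd> act ([:-2 * \<epsilon>, 1:] ^ m) v"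
proof -
  show 1: "(g - sc \<epsilon>) ^ (2 * m) \<rhd> v = g ^ m \<rhd> act ([:-2 * \<epsilon>, 1:] ^ m) v"
    by (simp only: nilpotent_even_power[OF \<epsilon>] app_endo_simps act_def pev_power)
  have "g * (g - sc \<epsilon>) = (g - sc \<epsilon>) * g" by (simp add: algebra_simps g_sc)
  then have "(g - sc \<epsilon>) * g ^ m = g ^ m * (g - sc \<epsilon>)" by (metis power_commuting_commutes)
  then have "(g - sc \<epsilon>) \<rhd> g ^ m \<rhd> u = g ^ m \<rhd> (g - sc \<epsilon>) \<rhd> u" for u by (rule commute_app)
  then show "(g - sc \<epsilon>) ^ Suc (2 * m) \<rhd> v = g ^ m \<rhd> (g - sc \<epsilon>) \<rhd> act ([:-2 * \<epsilon>, 1:] ^ m) v"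
    by (simp only: power_Suc app_endo_simps(6) 1)
qed

lemma eigen_power:
  assumes "X \<rhd> u = sc c \<rhd> u"
  shows "X ^ m \<rhd> u = sc (c ^ m) \<rhd> u"
proof (induction m)
  case (Suc m)
  have "X ^ Suc m \<rhd> u = X \<rhd> X ^ m \<rhd> u" by simp
  also have "\<dots> = sc (c ^ m) \<rhd> sc c \<rhd> u" by (simp only: Suc.IH app_sc_commute[of X] assms)
  also have "\<dots> = sc (c ^ Suc m) \<rhd> u" by (simp only: power_Suc2 sc_simps(6) app_endo_simps(6))
  finally show ?case .
qed simp

text \<open>Even powers of g - \<epsilon> are powers of x - 2\<epsilon> up to units. With p = t -
  2\<epsilon> and u = p^m v, the core is that (g - \<epsilon>)u = 0 iff p(x)u = 0 and Su =
  0.\<close>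

lemma jordan_vector_iff_odd_vector:
  "jordan_vector \<epsilon> (Suc (2 * m)) v \<longleftrightarrow> odd_vector \<epsilon> (Suc m) v"
proof (cases "\<epsilon> * \<epsilon> = 1")
  case \<epsilon>: True
  let ?p = "[:-2 * \<epsilon>, 1:]" let ?N = "g - sc \<epsilon>" let ?u = "act (?p ^ m) v"
  have \<epsilon>m: "\<epsilon> ^ m \<noteq> 0" using \<epsilon> by auto
  have gS: "g \<rhd> S \<rhd> ?u = (g + sc \<epsilon>) \<rhd> ?N \<rhd> ?u" by (metis g_S[OF \<epsilon>] app_endo_simps(6))
  have key: "?N \<rhd> ?u = 0 \<longleftrightarrow> act (?p ^ Suc m) v = 0 \<and> S \<rhd> ?u = 0"
  proof
    assume z: "?N \<rhd> ?u = 0"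
    have "?N ^ (2 * Suc m) \<rhd> v = ?N \<rhd> ?N ^ Suc (2 * m) \<rhd> v"
      by (simp only: app_endo_simps(6)[symmetric] power_Suc[symmetric]) simp
    also have "\<dots> = 0" by (simp only: odd_power_app(2)[OF \<epsilon>] z app_zero)
    finally have "g ^ Suc m \<rhd> act (?p ^ Suc m) v = 0" by (simp only: odd_power_app(1)[OF \<epsilon>])
    then have "act (?p ^ Suc m) v = 0" by (simp only: g_power_cancel)
    moreover have "g ^ 1 \<rhd> S \<rhd> ?u = 0" using gS by (simp only: z app_zero power_one_right)
    then have "S \<rhd> ?u = 0" by (simp only: g_power_cancel)
    ultimately show "act (?p ^ Suc m) v = 0 \<and> S \<rhd> ?u = 0" by blast
  next
    assume "act (?p ^ Suc m) v = 0 \<and> S \<rhd> ?u = 0"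
    then have 1: "act ?p ?u = 0" and 2: "S \<rhd> ?u = 0" by (simp_all only: power_Suc act_simps)
    \<comment> \<open>Su = 0 gives w the eigenvalue -\<epsilon> for \<open>g\<close>, hence
      -2\<epsilon> for \<open>x\<close>, whereas p(x)u = 0 gives it the eigenvalue 2\<epsilon>; so
      4\<epsilon>w = 0.\<close>
    define w where "w = ?N \<rhd> ?u"
    have N_x: "?N * x = x * ?N" by (simp add: left_diff_distrib right_diff_distrib g_x sc_commute)
    have "act ?p w = 0" using act_commute[OF N_x, of ?p ?u] 1 by (simp only: app_zero w_def)
    then have "x \<rhd> w - sc \<epsilon> \<rhd> w - sc \<epsilon> \<rhd> w = 0" unfolding act_def x_linear by simp
    then have xw: "x \<rhd> w = sc (2 * \<epsilon>) \<rhd> w"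
      by (simp only: mult_2 diff_diff_eq sc_simps(4) app_endo_simps(3) right_minus_eq)
    have "(g + sc \<epsilon>) \<rhd> w = 0" using gS by (simp only: 2 app_zero w_def)
    then have gw: "g \<rhd> w = sc (- \<epsilon>) \<rhd> w" by (simp add: eq_neg_iff_add_eq_0)
    have "w = g' \<rhd> sc (- \<epsilon>) \<rhd> w" by (metis gw g_app(2))
    then have "sc (- \<epsilon>) \<rhd> w = sc (- \<epsilon>) \<rhd> sc (- \<epsilon>) \<rhd> g' \<rhd> w" by (metis app_sc_commute)
    also have "sc (- \<epsilon>) \<rhd> sc (- \<epsilon>) \<rhd> g' \<rhd> w = sc (- \<epsilon> * - \<epsilon>) \<rhd> g' \<rhd> w" by (simp only: sc_simps(6) app_endo_simps(6))
    also have "\<dots> = g' \<rhd> w" by (simp add: \<epsilon> del: sc_simps(6))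
    finally have "x \<rhd> w = sc (- \<epsilon> + - \<epsilon>) \<rhd> w" using gw by (simp only: x_def app_endo_simps sc_simps)
    then have "sc (2 * \<epsilon> - (- \<epsilon> + - \<epsilon>)) \<rhd> w = 0" using xw by (simp only: sc_simps(5) app_endo_simps right_minus_eq)
    moreover have "2 * \<epsilon> - (- \<epsilon> + - \<epsilon>) = 2 * 2 * \<epsilon>" by simp
    then have "2 * \<epsilon> - (- \<epsilon> + - \<epsilon>) \<noteq> 0" using two \<epsilon> by (metis mult_eq_0_iff zero_neq_one)
    ultimately show "?N \<rhd> ?u = 0" unfolding w_def[symmetric] by (simp only: sc_eq_0_iff simp_thms)
  qed
  have "?N ^ Suc (2 * m) \<rhd> v = 0 \<longleftrightarrow> ?N \<rhd> ?u = 0"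
    by (simp only: odd_power_app(2)[OF \<epsilon>] g_power_cancel)
  moreover have "b v (?N ^ (2 * m) \<rhd> v) = \<epsilon> ^ m * b v ?u" if "?N \<rhd> ?u = 0"
  proof -
    have "g \<rhd> ?u = sc \<epsilon> \<rhd> ?u" using that by (simp only: app_endo_simps(4) right_minus_eq)
    then show ?thesis by (simp only: odd_power_app(1)[OF \<epsilon>] eigen_power b_right)
  qed
  moreover have "jordan_vector \<epsilon> (Suc (2 * m)) v \<longleftrightarrow>
      e \<rhd> v = v \<and> ?N ^ Suc (2 * m) \<rhd> v = 0 \<and> b v (?N ^ (2 * m) \<rhd> v) \<noteq> 0"
  proof -
    have "odd (Suc (2 * m))" by simp
    then show ?thesis unfolding jordan_vector_def diff_Suc_1 using \<epsilon> by blast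
  qed
  moreover have "odd_vector \<epsilon> (Suc m) v \<longleftrightarrow>
      e \<rhd> v = v \<and> act (?p ^ Suc m) v = 0 \<and> S \<rhd> ?u = 0 \<and> b v ?u \<noteq> 0"
    unfolding odd_vector_def diff_Suc_1 using \<epsilon> zero_less_Suc by blast
  ultimately show ?thesis using key \<epsilon>m by (metis mult_eq_0_iff)
qed (simp add: jordan_vector_def odd_vector_def)

text \<open>The adjoint of g - \<epsilon> is g' - \<epsilon> = -\<epsilon> g'(g - \<epsilon>), a
  unit times g - \<epsilon>.\<close>

lemma adjoint_nilpotent:
  assumes \<epsilon>: "\<epsilon> * \<epsilon> = 1"
  shows "b ((g - sc \<epsilon>) ^ k \<rhd> v) u = b v (sc ((- \<epsilon>) ^ k) \<rhd> g' ^ k \<rhd> (g - sc \<epsilon>) ^ k \<rhd> u)"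
proof -
  let ?N = "g - sc \<epsilon>"
  have s: "sc \<epsilon> * sc \<epsilon> = 1" using \<epsilon> by (simp flip: sc_simps)
  have "adjoint ?N (g' - sc \<epsilon>)" by (intro adjoint_diff adjoint_g adjoint_sc)
  then have "adjoint (?N ^ k) ((g' - sc \<epsilon>) ^ k)" by (rule adjoint_power)
  moreover have "(g' - sc \<epsilon>) ^ k = sc ((- \<epsilon>) ^ k) * (g' ^ k * ?N ^ k)"
  proof (induction k)
    case (Suc k)
    have 1: "g' - sc \<epsilon> = sc (- \<epsilon>) * (g' * ?N)"
      by (simp add: algebra_simps g_inv g_sc) (simp add: s flip: mult.assoc)
    have gN: "g' * ?N = ?N * g'" by (simp add: algebra_simps g_inv g_sc)
    have 2: "(g' * ?N) * sc c = sc c * (g' * ?N)" for c by (rule sc_commute)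
    have 3: "?N * g' ^ k = g' ^ k * ?N" using gN by (metis power_commuting_commutes)
    have "(g' - sc \<epsilon>) ^ Suc k = (g' - sc \<epsilon>) * (sc ((- \<epsilon>) ^ k) * (g' ^ k * ?N ^ k))"
      by (simp only: power_Suc Suc.IH)
    also have "\<dots> = sc (- \<epsilon>) * ((g' * ?N) * sc ((- \<epsilon>) ^ k)) * (g' ^ k * ?N ^ k)"
      by (simp only: 1 mult.assoc)
    also have "\<dots> = sc (- \<epsilon>) * (sc ((- \<epsilon>) ^ k) * (g' * (?N * g' ^ k) * ?N ^ k))"
      by (simp only: 2) (simp only: mult.assoc)
    also have "\<dots> = sc ((- \<epsilon>) ^ Suc k) * (g' ^ Suc k * ?N ^ Suc k)"
      by (simp only: 3 power_Suc sc_simps(6) mult.assoc)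
    finally show ?case .
  qed simp
  ultimately show ?thesis by (simp add: adjoint_def)
qed

lemma N_e: "e * (g - sc \<epsilon>) ^ k = (g - sc \<epsilon>) ^ k * e"
proof -
  have "e * (g - sc \<epsilon>) = (g - sc \<epsilon>) * e" by (simp add: algebra_simps g_e sc_commute)
  then show ?thesis by (metis power_commuting_commutes)
qed

lemma jordan_vector_kills:
  assumes "\<epsilon> * \<epsilon> = 1" "(g - sc \<epsilon>) ^ k \<rhd> v = 0"
  shows "b v ((g - sc \<epsilon>) ^ k \<rhd> u) = 0"
proof -
  have "b v ((g - sc \<epsilon>) ^ k \<rhd> u) = b ((g - sc \<epsilon>) ^ k \<rhd> u) v" by (rule b_sym)
  then show ?thesis using assms adjoint_nilpotent[OF assms(1), of k u v] by (simp add: b_right)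
qed

text \<open>For odd \<open>k\<close> the form b(., (g - \<epsilon>)^(k-1) .) is symmetric on the
  kernel of (g - \<epsilon>)^k. If it pairs w and v nontrivially, one of v, w, v + w is
  nonisotropic.\<close>

lemma exists_jordan_vector:
  assumes \<epsilon>: "\<epsilon> * \<epsilon> = 1" and k: "odd k" and v: "e \<rhd> v = v" "(g - sc \<epsilon>) ^ k \<rhd> v = 0"
    and w: "e \<rhd> w = w" "\<And>u. b w ((g - sc \<epsilon>) ^ k \<rhd> u) = 0" and vw: "b w ((g - sc \<epsilon>) ^ (k - 1) \<rhd> v) \<noteq> 0"
  shows "\<exists>v. jordan_vector \<epsilon> k v"
proof (rule ccontr)
  assume n: "\<not> ?thesis"
  let ?N = "g - sc \<epsilon>"
  have comm: "sc c \<rhd> g' ^ k \<rhd> ?N ^ k \<rhd> u = ?N ^ k \<rhd> sc c \<rhd> g' ^ k \<rhd> u" for c u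
  proof -
    have "g' * ?N = ?N * g'" by (simp add: algebra_simps g_inv g_sc)
    then have "g' ^ k * ?N ^ k = ?N ^ k * g' ^ k" by (metis power_commuting_commutes)
    then have "g' ^ k \<rhd> ?N ^ k \<rhd> u = ?N ^ k \<rhd> g' ^ k \<rhd> u" by (rule commute_app)
    then show ?thesis by (simp only: app_sc_commute[of "?N ^ k"])
  qed
  \<comment> \<open>Pairing with w kills the image of ?N^k, so w lies in its kernel.\<close>
  have "b (?N ^ k \<rhd> w) u = 0" for u
    by (simp only: adjoint_nilpotent[OF \<epsilon>] comm w(2))
  then have "e \<rhd> ?N ^ k \<rhd> w = 0" by (rule nondegenerate)
  then have Nw: "?N ^ k \<rhd> w = 0" using commute_app[OF N_e, of \<epsilon> k w] w(1) by simp
  have z: "b y (?N ^ (k - 1) \<rhd> y) = 0" if "e \<rhd> y = y" "?N ^ k \<rhd> y = 0" for y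
    using n that \<epsilon> k unfolding jordan_vector_def by blast
  let ?m = "k - 1" let ?u = "?N ^ ?m \<rhd> v"
  have even: "even ?m" and kS: "k = Suc ?m" using k by (auto elim: oddE)
  have "?N \<rhd> ?u = 0" using v(2) kS by (metis app_endo_simps(6) power_Suc)
  then have gu: "g \<rhd> ?u = sc \<epsilon> \<rhd> ?u" by simp
  have "g' \<rhd> ?u = sc (\<epsilon> * \<epsilon>) \<rhd> g' \<rhd> ?u" by (simp only: \<epsilon> sc_simps(2) app_endo_simps(2))
  also have "\<dots> = sc \<epsilon> \<rhd> g' \<rhd> g \<rhd> ?u"
    by (simp only: gu sc_simps(6) app_endo_simps(6) app_sc_commute[of g'])
  finally have g'u: "g' \<rhd> ?u = sc \<epsilon> \<rhd> ?u" by (simp only: g_app)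
  note g'm = eigen_power[OF g'u]
  have "b v (?N ^ ?m \<rhd> w) = b (?N ^ ?m \<rhd> w) v" by (rule b_sym)
  also have "\<dots> = (- \<epsilon>) ^ ?m * (\<epsilon> ^ ?m * b w ?u)" by (simp only: adjoint_nilpotent[OF \<epsilon>] g'm b_right)
  \<comment> \<open>Here the parity of \<open>k\<close> enters: the sign (-1)^(k-1) would make the
    form alternating for even \<open>k\<close>.\<close>
  also have "\<dots> = (- (\<epsilon> * \<epsilon>)) ^ ?m * b w ?u" by (simp only: power_mult_distrib[symmetric] mult.assoc[symmetric] mult_minus_left)
  also have "\<dots> = b w ?u" using even by (simp add: \<epsilon>)
  finally have sym: "b v (?N ^ ?m \<rhd> w) = b w ?u" .
  have "b (v + w) (?N ^ ?m \<rhd> (v + w)) = 0" using v w(1) Nw by (intro z) simp_all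
  then have "2 * b w ?u = 0"
    using z[OF v] z[OF w(1) Nw] sym by (simp add: b_simps)
  then show False using vw two by simp
qed

end

section \<open>Special orthogonal groups\<close>

text \<open>Shifting the sum over all field elements by 1 shows that the field order is 0 in the
  field; being odd, it would be 1 if 2 = 0.\<close>

lemma two_nonzero:
  assumes "odd CARD('a::{field, finite})"
  shows "(2::'a) \<noteq> 0"
proof
  assume two: "(2::'a) = 0"
  obtain m where m: "CARD('a) = 2 * m + 1" using assms by (rule oddE)
  have "bij (\<lambda>x::'a. x + 1)"
    by (rule bijI'[of _]) (auto intro: exI[of _ "_ - 1"])
  then have "(\<Sum>x\<in>UNIV. x + 1) = (\<Sum>x\<in>UNIV. x :: 'a)"
    using sum.reindex_bij_betw[of "\<lambda>x::'a. x + 1" UNIV UNIV "\<lambda>x. x"] by simp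
  then have "of_nat CARD('a) = (0::'a)" by (simp add: sum.distrib)
  then have "of_nat m * (2::'a) + 1 = 0" by (simp add: m mult.commute add.commute)
  then show False using two by simp
qed

section \<open>Matrix groups as isometries of a form on sequences\<close>

definition form_of :: "nat \<Rightarrow> 'a::field mat \<Rightarrow> (nat \<Rightarrow> 'a) \<Rightarrow> (nat \<Rightarrow> 'a) \<Rightarrow> 'a" where
  "form_of n B u v = (\<Sum>i<n. u i * (\<Sum>j<n. B $$ (i, j) * v j))"

lemma form_of_bform: "B \<in> carrier_mat n n \<Longrightarrow> form_of n B u v = bform B (vec n u) (vec n v)"
  by (simp add: form_of_def bform_def scalar_prod_def lessThan_atLeast0)

lemma mult_mat_vec_op_of: "M \<in> carrier_mat n n \<Longrightarrow> M *\<^sub>v vec n u = vec n (op_of n M \<rhd> u)"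
  by (auto intro!: eq_vecI simp: app_op_of scalar_prod_def lessThan_atLeast0)

lemma vec_of_fun: "x \<in> carrier_vec n \<Longrightarrow> x = vec n (\<lambda>i. x $ i)"
  by (auto intro!: eq_vecI)

lemma bform_preserved_iff:
  assumes "B \<in> carrier_mat n n" "M \<in> carrier_mat n n"
  shows "(\<forall>x\<in>carrier_vec n. \<forall>y\<in>carrier_vec n. bform B (M *\<^sub>v x) (M *\<^sub>v y) = bform B x y) \<longleftrightarrow>
    (\<forall>u v. form_of n B (op_of n M \<rhd> u) (op_of n M \<rhd> v) = form_of n B u v)"
proof
  assume "\<forall>x\<in>carrier_vec n. \<forall>y\<in>carrier_vec n. bform B (M *\<^sub>v x) (M *\<^sub>v y) = bform B x y"
  then show "\<forall>u v. form_of n B (op_of n M \<rhd> u) (op_of n M \<rhd> v) = form_of n B u v"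
    by (simp add: form_of_bform[OF assms(1)] mult_mat_vec_op_of[OF assms(2), symmetric])
next
  assume *: "\<forall>u v. form_of n B (op_of n M \<rhd> u) (op_of n M \<rhd> v) = form_of n B u v"
  show "\<forall>x\<in>carrier_vec n. \<forall>y\<in>carrier_vec n. bform B (M *\<^sub>v x) (M *\<^sub>v y) = bform B x y"
  proof (intro ballI)
    fix x y :: "'a vec" assume "x \<in> carrier_vec n" "y \<in> carrier_vec n"
    then obtain u v where "x = vec n u" "y = vec n v" using vec_of_fun by metis
    then show "bform B (M *\<^sub>v x) (M *\<^sub>v y) = bform B x y"
      using * by (simp add: form_of_bform[OF assms(1), symmetric] mult_mat_vec_op_of[OF assms(2)])
  qed
qed

lemma form_space_form_of:
  fixes B :: "'a::{field, finite} mat"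
  assumes odd: "odd CARD('a)" and B: "nondegenerate_symmetric_form n B"
  shows "form_space (cor n) (form_of n B)"
proof
  have Bc: "B \<in> carrier_mat n n" using B by (simp add: nondegenerate_symmetric_form_def)
  show "(2::'a) \<noteq> 0" by (rule two_nonzero[OF odd])
  show "form_of n B (u + v) w = form_of n B u w + form_of n B v w" for u v w
    by (simp add: form_of_def fun_apply distrib_right sum.distrib)
  show "form_of n B (sc c \<rhd> u) w = c * form_of n B u w" for c u w
    by (simp add: form_of_def sum_distrib_left mult.assoc)
  show "form_of n B u v = form_of n B v u" for u v
    using B by (simp add: form_of_bform[OF Bc] nondegenerate_symmetric_form_def)
  show "cor n * cor n = (cor n :: 'a endo)" by (rule cor_idem)
  show "finite (range (app (cor n :: 'a endo)))" by (rule finite_range_cor)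
  show "form_of n B (cor n \<rhd> u) v = form_of n B u v" for u v
    by (simp add: form_of_def app_cor)
  show "cor n \<rhd> u = 0" if z: "\<And>v. form_of n B u v = 0" for u
  proof -
    have "bform B (vec n u) y = 0" if "y \<in> carrier_vec n" for y
      using z[of "\<lambda>i. y $ i"] vec_of_fun[OF that] by (simp add: form_of_bform[OF Bc])
    then have "vec n u = 0\<^sub>v n" using B unfolding nondegenerate_symmetric_form_def by (metis vec_carrier)
    then have "u i = 0" if "i < n" for i using that by (metis index_vec index_zero_vec(1))
    then show ?thesis by (auto simp: app_cor fun_apply)
  qed
qed

lemma SO_group_simps:
  "x \<otimes>\<^bsub>SO_group n B\<^esub> y = x * y" "\<one>\<^bsub>SO_group n B\<^esub> = 1\<^sub>m n"
  by (simp_all add: SO_group_def O_group_def GL_group_simps)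

lemma SO_group_carrier_iff:
  fixes B :: "'a::field mat"
  shows "h \<in> carrier (SO_group n B) \<longleftrightarrow> h \<in> carrier_mat n n \<and> det h = 1 \<and>
    (\<forall>x\<in>carrier_vec n. \<forall>y\<in>carrier_vec n. bform B (h *\<^sub>v x) (h *\<^sub>v y) = bform B x y)"
proof -
  have "h \<in> carrier (GL_group TYPE('a) n)" if "h \<in> carrier_mat n n" "det h = 1"
    using det_non_zero_imp_unit[OF that(1), of "()"] that(2) by (simp add: GL_group_simps)
  then show ?thesis using GL_group_carrierD by (auto simp: SO_group_def O_group_def)
qed

lemma inverts_iff:
  assumes g: "g \<in> carrier (SO_group n B)" and h: "h \<in> carrier (SO_group n B)"
  shows "h \<otimes>\<^bsub>SO_group n B\<^esub> g \<otimes>\<^bsub>SO_group n B\<^esub> inv\<^bsub>SO_group n B\<^esub> h = inv\<^bsub>SO_group n B\<^esub> g \<longleftrightarrow> g * h * g = h"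
proof -
  interpret group "SO_group n B" by (rule SO_group_is_group)
  have "h \<otimes>\<^bsub>SO_group n B\<^esub> g \<otimes>\<^bsub>SO_group n B\<^esub> inv\<^bsub>SO_group n B\<^esub> h = inv\<^bsub>SO_group n B\<^esub> g \<longleftrightarrow>
      g \<otimes>\<^bsub>SO_group n B\<^esub> h \<otimes>\<^bsub>SO_group n B\<^esub> g = h"
    using g h by (metis inv_closed inv_solve_left inv_solve_right m_assoc m_closed)
  then show ?thesis by (simp add: SO_group_simps)
qed

locale so_element =
  fixes n :: nat and B g :: "'a::{field, finite} mat"
  assumes odd_card: "odd CARD('a)" and B: "nondegenerate_symmetric_form n B"
    and g: "g \<in> carrier (SO_group n B)"
begin

abbreviation "gi \<equiv> inv\<^bsub>SO_group n B\<^esub> g"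

lemma B_carrier: "B \<in> carrier_mat n n"
  using B by (simp add: nondegenerate_symmetric_form_def)

lemma gi: "gi \<in> carrier (SO_group n B)" "g * gi = 1\<^sub>m n" "gi * g = 1\<^sub>m n"
proof -
  interpret G: group "SO_group n B" by (rule SO_group_is_group)
  show "gi \<in> carrier (SO_group n B)" using g by simp
  show "g * gi = 1\<^sub>m n" "gi * g = 1\<^sub>m n"
    using G.r_inv[OF g] G.l_inv[OF g] by (simp_all add: SO_group_simps)
qed

lemma SO_carrier: "h \<in> carrier (SO_group n B) \<Longrightarrow> h \<in> carrier_mat n n"
  by (simp add: SO_group_carrier_iff)

lemma SO_iff:
  "h \<in> carrier (SO_group n B) \<longleftrightarrow> h \<in> carrier_mat n n \<and> det h = 1 \<and>
    (\<forall>u v. form_of n B (op_of n h \<rhd> u) (op_of n h \<rhd> v) = form_of n B u v)"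
  using bform_preserved_iff[OF B_carrier] by (auto simp: SO_group_carrier_iff)

sublocale form_space "cor n" "form_of n B"
  by (rule form_space_form_of[OF odd_card B])

sublocale isometry "cor n" "form_of n B" "op_of n g" "op_of n gi"
proof
  show "op_of n g * op_of n gi = 1" "op_of n gi * op_of n g = 1"
    using gi SO_carrier g by (simp_all add: op_of_1 flip: op_of_mult)
  show "cor n * op_of n g = op_of n g * cor n" by (rule op_of_cor)
  show "form_of n B (op_of n g \<rhd> u) (op_of n g \<rhd> v) = form_of n B u v" for u v
    using g by (simp add: SO_iff)
qed

abbreviation "odd_block \<equiv> \<exists>\<epsilon> l v. odd_vector \<epsilon> l v"

lemma halve: "X + X = Y + Y \<Longrightarrow> X = Y" for X Y :: "'a endo"
proof (rule endo_eqI, rule ext)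
  fix u i assume "X + X = Y + Y"
  then have "(X \<rhd> u) i + (X \<rhd> u) i = (Y \<rhd> u) i + (Y \<rhd> u) i"
    by (metis app_endo_simps(3) plus_fun_apply)
  then have "2 * (X \<rhd> u) i = 2 * (Y \<rhd> u) i" by (simp only: mult_2)
  then show "(X \<rhd> u) i = (Y \<rhd> u) i" using two by simp
qed

lemma S_corner: "cor n * S = S" "S * cor n = S"
proof -
  have "(1 - cor n) * S = 0" by (simp add: S_def right_diff_distrib op_of_outside)
  then show "cor n * S = S" by (simp add: left_diff_distrib)
  then show "S * cor n = S" using S_e by simp
qed

text \<open>The involution R = 1 - 2N commutes with x = g + g' and, on account of P + N = 1 on the
  first \<open>n\<close> coordinates, anticommutes with S = g - g'. Adding the relations gives 2Rg =
  2g'R.\<close>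

lemma involution_of_pair:
  assumes P: "inverting_pair P N" "P + N = cor n" and rank: "has_rank N d"
  shows "\<exists>h\<in>carrier_mat n n. h * h = 1\<^sub>m n \<and> g * h * g = h \<and> det h = (- 1) ^ d \<and>
    (\<forall>u v. form_of n B (op_of n h \<rhd> u) (op_of n h \<rhd> v) = form_of n B u v)"
proof -
  note d = inverting_pairD[OF P(1)]
  define R where "R = 1 - (N + N)"
  have N: "N * N = N" "cor n * N = N" "N * cor n = N" by (rule saiD[OF d(2)])+
  have RR: "R * R = 1" by (simp add: R_def algebra_simps N)
  have R_cor: "cor n * R = R * cor n" by (simp add: R_def algebra_simps N)
  have R_out: "(1 - cor n) * R = 1 - cor n" by (simp add: R_def algebra_simps N)
  have Rx: "R * x = x * R" by (simp add: R_def algebra_simps d)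
  have "R * S + S * R = S + S - ((N + P) * S + (N + P) * S)" by (simp add: R_def algebra_simps d)
  also have "N + P = cor n" using P(2) by (simp add: add.commute)
  finally have RS: "R * S = - (S * R)" by (simp add: S_corner eq_neg_iff_add_eq_0)
  let ?g = "op_of n g" and ?gi = "op_of n gi"
  have "R * ?g + R * ?g = R * x + R * S" by (simp add: x_def S_def algebra_simps)
  also have "\<dots> = ?gi * R + ?gi * R" unfolding Rx RS by (simp add: x_def S_def algebra_simps)
  finally have Rg: "R * ?g = ?gi * R" by (rule halve)
  have gRg: "?g * R * ?g = R" by (simp only: mult.assoc Rg) (simp add: mult.assoc[symmetric] g_inv)
  define h where "h = mat_of n R"
  have gc: "g \<in> carrier_mat n n" using g by (rule SO_carrier)
  have hc: "h \<in> carrier_mat n n" by (simp add: h_def)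
  have oph: "op_of n h = R" by (rule op_of_eqI[OF hc h_def[symmetric] R_cor R_out])
  have "h * h = 1\<^sub>m n" by (simp add: h_def RR mat_of_simps flip: mat_of_mult[OF R_cor])
  moreover have "g * h * g = mat_of n (?g * R * ?g)"
    using gc by (simp add: mat_of_mult op_of_cor R_cor mat_of_op_of h_def)
  then have "g * h * g = h" by (simp add: gRg h_def)
  moreover have "det h = (- 1) ^ d" unfolding h_def R_def by (rule det_reflection[OF rank N(2,3)])
  moreover have "form_of n B (R \<rhd> u) (R \<rhd> v) = form_of n B u v" for u v
  proof -
    have "adjoint R R" unfolding R_def by (intro adjoint_diff adjoint_1 adjoint_add saiD(4)[OF d(2)])
    moreover have "R \<rhd> R \<rhd> v = v" by (metis RR app_endo_simps(2,6))
    ultimately show ?thesis by (simp add: adjoint_def)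
  qed
  ultimately show ?thesis using hc oph by auto
qed

lemma strongly_real_of_odd_block:
  assumes odd_block
  shows "strongly_real_in (SO_group n B) g"
proof -
  obtain \<epsilon> l v where ov: "odd_vector \<epsilon> l v" using assms by blast
  then have l: "l > 0" and v: "cor n \<rhd> v = v" by (auto simp: odd_vector_def)
  obtain P N where 1: "inverting_pair P N" "has_rank P l" "has_rank N (l - 1)"
    and le: "cor n * P = P" "cor n * N = N"
    using pair_of_odd_vector[OF ov] x_e S_e v by blast
  note d = inverting_pairD[OF 1(1)]
  define F where "F = cor n - (P + N)"
  have E: "cor n * (P + N) = P + N" using le by (simp add: distrib_left)
  have E': "(P + N) * (P + N) = P + N" by (rule saiD(1)[OF d(9)])
  have F: "sai F" "F * x = x * F" "F * S = S * F"
    using sai_diff[OF sai_e d(9) E] d(10,11) x_e S_e by (simp_all add: F_def left_diff_distrib right_diff_distrib)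
  obtain P' N' a a' where 2: "inverting_pair P' N'" "F = P' + N'" "has_rank P' a" "has_rank N' a'"
    using exists_inverting_pair[OF F] by blast
  have o: "(P + N) * (P' + N') = 0"
    using saiD(3)[OF d(9)] E' unfolding 2(2)[symmetric] F_def right_diff_distrib by simp
  have o': "(N + P) * (P' + N') = 0" using o by (simp add: add.commute)
  note a1 = inverting_pair_add[OF 1(1) 2(1) o]
  note a2 = inverting_pair_add[OF inverting_pair_sym[OF 1(1)] 2(1) o']
  have sum: "(P + P') + (N + N') = cor n" "(N + P') + (P + N') = cor n"
    using 2(2) by (simp_all add: F_def algebra_simps)
  \<comment> \<open>The -1-eigenspaces of the two arrangements have dimensions (l - 1) + a' and l +
    a', so one of them is even.\<close>
  have "\<exists>P N d. inverting_pair P N \<and> P + N = cor n \<and> has_rank N d \<and> even d"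
  proof (cases "even (l + a')")
    case True
    then show ?thesis using a2(1) sum(2) has_rank_add[OF 1(2) 2(4) a2(4,5)] by blast
  next
    case False
    then have "even ((l - 1) + a')" using l by auto
    then show ?thesis using a1(1) sum(1) has_rank_add[OF 1(3) 2(4) a1(4,5)] by blast
  qed
  then obtain P0 N0 d0 where pair: "inverting_pair P0 N0" "P0 + N0 = cor n" "has_rank N0 d0" and "even d0"
    by blast
  obtain h where "h \<in> carrier_mat n n" "h * h = 1\<^sub>m n" "g * h * g = h" "det h = (- 1) ^ d0"
    "\<forall>u v. form_of n B (op_of n h \<rhd> u) (op_of n h \<rhd> v) = form_of n B u v"
    using involution_of_pair[OF pair] by blast
  moreover have "(- 1) ^ d0 = (1::'a)" using \<open>even d0\<close> by simp
  moreover have "h [^]\<^bsub>SO_group n B\<^esub> (2::nat) = h * h"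
    using \<open>h \<in> carrier_mat n n\<close> by (simp add: numeral_2_eq_2 nat_pow_def SO_group_simps)
  ultimately show ?thesis
    using inverts_iff[OF g] by (auto simp: strongly_real_in_def SO_iff SO_group_simps)
qed

lemma det_form: "det B \<noteq> 0"
proof
  assume "det B = 0"
  then obtain w where w: "w \<in> carrier_vec n" "w \<noteq> 0\<^sub>v n" "B *\<^sub>v w = 0\<^sub>v n"
    using det_0_iff_vec_prod_zero_field[OF B_carrier] by auto
  have "bform B w y = 0" if "y \<in> carrier_vec n" for y
  proof -
    have "bform B w y = bform B y w" using B that w(1) by (simp add: nondegenerate_symmetric_form_def)
    then show ?thesis using w(3) that by (simp add: bform_def)
  qed
  then show False using B w by (auto simp: nondegenerate_symmetric_form_def)
qed

text \<open>From M^T B M = B follows M^T B (1 + M) = (1 + M)^T B. Without eigenvalue -1 the factor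
  det(1 + M) is nonzero and cancels, as does det B.\<close>

lemma det_isometry:
  assumes U: "cor n * U = U * cor n" "\<And>u v. form_of n B (U \<rhd> u) (U \<rhd> v) = form_of n B u v"
    and no_eigen: "\<And>v. cor n \<rhd> v = v \<Longrightarrow> U \<rhd> v = - v \<Longrightarrow> v = 0"
  shows "det (mat_of n U) = 1"
proof -
  define M where "M = mat_of n U"
  have M: "M \<in> carrier_mat n n" by (simp add: M_def)
  have entry: "(transpose_mat M * B * M) $$ (i, j) = B $$ (i, j)" if ij: "i < n" "j < n" for i j
  proof -
    have "(transpose_mat M * B * M) $$ (i, j) = (transpose_mat M * (B * M)) $$ (i, j)"
      using M B_carrier by (simp add: assoc_mult_mat[of _ n n _ n _ n])
    also have "\<dots> = form_of n B (U \<rhd> basis_vec i) (U \<rhd> basis_vec j)"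
      using ij B_carrier by (simp add: M_def mat_of_def scalar_prod_def form_of_def lessThan_atLeast0)
    also have "\<dots> = form_of n B (basis_vec i) (basis_vec j)" by (rule U(2))
    also have "\<dots> = B $$ (i, j)"
    proof -
      have "(\<Sum>l<n. B $$ (k, l) * basis_vec j l) = (\<Sum>l<n. if l = j then B $$ (k, l) else 0)" for k
        by (intro sum.cong) (auto simp: basis_vec_apply)
      then have "form_of n B (basis_vec i) (basis_vec j) = (\<Sum>k<n. if k = i then B $$ (k, j) else 0)"
        unfolding form_of_def using ij by (intro sum.cong) (auto simp: basis_vec_apply)
      then show ?thesis using ij by simp
    qed
    finally show ?thesis .
  qed
  have MBM: "transpose_mat M * B * M = B"
  proof (rule eq_matI)
    fix i j assume "i < dim_row B" "j < dim_col B"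
    then show "(transpose_mat M * B * M) $$ (i, j) = B $$ (i, j)" using B_carrier by (intro entry) auto
  qed (use M B_carrier in auto)
  have "det (1\<^sub>m n + M) \<noteq> 0"
  proof
    assume "det (1\<^sub>m n + M) = 0"
    moreover have "1\<^sub>m n + M \<in> carrier_mat n n" using M by simp
    ultimately obtain w where w: "w \<in> carrier_vec n" "w \<noteq> 0\<^sub>v n" "(1\<^sub>m n + M) *\<^sub>v w = 0\<^sub>v n"
      using det_0_iff_vec_prod_zero_field by blast
    define u where "u = cor n \<rhd> (\<lambda>i. w $ i)"
    have u: "cor n \<rhd> u = u" using idempotent_app[OF cor_idem] by (simp add: u_def)
    have wu: "w = vec n u" using w(1) by (auto intro!: eq_vecI simp: u_def app_cor)
    have "U \<rhd> u = - u"
    proof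
      fix i
      have cU: "cor n \<rhd> U \<rhd> u = U \<rhd> u" using commute_app[OF U(1), of u] u by simp
      show "(U \<rhd> u) i = (- u) i"
      proof (cases "i < n")
        case True
        have "U \<rhd> u = U \<rhd> cor n \<rhd> u" by (simp only: u)
        also have "\<dots> = (\<Sum>j<n. sc (u j) \<rhd> U \<rhd> basis_vec j)"
          by (simp only: cor_sum app_sum app_sc_commute[of U])
        finally have "(U \<rhd> u) i = (\<Sum>j<n. M $$ (i, j) * u j)"
          using True by (simp add: sum_fun_apply M_def mat_of_def mult.commute)
        moreover have "((1\<^sub>m n + M) *\<^sub>v w) $ i = u i + (\<Sum>j<n. M $$ (i, j) * u j)"
        proof -
          have "((1\<^sub>m n + M) *\<^sub>v w) = 1\<^sub>m n *\<^sub>v w + M *\<^sub>v w"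
            using M w(1) by (intro add_mult_distrib_mat_vec[of _ n n]) auto
          then show ?thesis using True M w(1)
            by (simp add: wu scalar_prod_def lessThan_atLeast0)
        qed
        ultimately show ?thesis using w(3) True by (simp add: fun_apply eq_neg_iff_add_eq_0 add.commute)
      next
        case False
        then have "(cor n \<rhd> U \<rhd> u) i = 0" "(cor n \<rhd> u) i = 0" by (simp_all add: app_cor)
        then show ?thesis by (simp add: cU u fun_apply)
      qed
    qed
    then have "u = 0" by (rule no_eigen[OF u])
    then have "w = 0\<^sub>v n" by (auto intro!: eq_vecI simp: wu fun_apply)
    then show False using w(2) by simp
  qed
  moreover have "transpose_mat M * (B * (1\<^sub>m n + M)) = transpose_mat (1\<^sub>m n + M) * B"
  proof -
    have "transpose_mat M * (B * (1\<^sub>m n + M)) = transpose_mat M * B + transpose_mat M * (B * M)"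
      using M B_carrier by (simp add: mult_add_distrib_mat[of _ n n _ n])
    also have "transpose_mat M * (B * M) = B"
      using MBM M B_carrier by (simp add: assoc_mult_mat[of _ n n _ n _ n])
    also have "transpose_mat M * B + B = (transpose_mat M + 1\<^sub>m n) * B"
      using M B_carrier by (simp add: add_mult_distrib_mat[of _ n n])
    also have "transpose_mat M + 1\<^sub>m n = transpose_mat (1\<^sub>m n + M)"
      using M by (intro eq_matI) auto
    finally show ?thesis .
  qed
  then have "det (transpose_mat M * (B * (1\<^sub>m n + M))) = det (transpose_mat (1\<^sub>m n + M) * B)" by simp
  then have "det M * (det B * det (1\<^sub>m n + M)) = det (1\<^sub>m n + M) * det B"
    using M B_carrier by (simp add: det_mult[of _ n] det_transpose[of _ n])
  ultimately show ?thesis using det_form unfolding M_def[symmetric] by simp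
qed

end

lemma odd_part_exists: "t > 0 \<Longrightarrow> \<exists>a m. t = 2 ^ a * m \<and> odd m" for t :: nat
proof (induction t rule: less_induct)
  case (less t)
  show ?case
  proof (cases "even t")
    case True
    then obtain t' where t: "t = 2 * t'" by blast
    have "t' < t" "0 < t'" using t less.prems by auto
    then obtain a m where "t' = 2 ^ a * m" "odd m" using less.IH[of t'] by blast
    then show ?thesis using t by (intro exI[of _ "Suc a"] exI[of _ m]) simp
  next
    case False
    then show ?thesis by (intro exI[of _ 0] exI[of _ t]) simp
  qed
qed

lemma left_inverse_power: "Y * X = 1 \<Longrightarrow> Y ^ i * X ^ i = 1" for X Y :: "'a::monoid_mult"
proof (induction i)
  case (Suc i)
  have "Y ^ Suc i * X ^ Suc i = Y ^ i * (Y * X) * X ^ i" by (simp only: power_Suc2[of Y] power_Suc[of X] mult.assoc)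
  then show ?case using Suc by simp
qed simp

section \<open>Averaging over a cyclic group, and determinants in the centralizer of
  \<open>g\<close>\<close>

context so_element
begin

lemma corner_power: "cor n * X = X * cor n \<Longrightarrow> cor n * X ^ i = X ^ i * cor n" for X :: "'a endo"
  by (rule power_commuting_commutes[symmetric]) simp

lemma det_mat_of_power:
  fixes X :: "'a endo"
  assumes X: "cor n * X = X * cor n"
  shows "det (mat_of n (X ^ m)) = det (mat_of n X) ^ m"
proof (induction m)
  case (Suc m)
  have "mat_of n (X ^ Suc m) = mat_of n X * mat_of n (X ^ m)"
    by (simp add: mat_of_mult[OF corner_power[OF X]])
  then show ?case using Suc by (simp add: det_mult[of _ n])
qed (simp add: mat_of_simps)

text \<open>If W^K is the identity on the first \<open>n\<close> coordinates and \<open>K\<close> is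
  invertible in the field, this is a projection onto the vectors there that \<open>W\<close>
  fixes.\<close>

definition avg :: "nat \<Rightarrow> 'a endo \<Rightarrow> 'a endo" where
  "avg K W = sc (1 / of_nat K) * (cor n * (\<Sum>i<K. W ^ i))"

lemma avg_commute:
  assumes "X * W = W * X" "X * cor n = cor n * X"
  shows "X * avg K W = avg K W * X"
proof -
  have "X * (\<Sum>i<K. W ^ i) = (\<Sum>i<K. W ^ i) * X"
    unfolding sum_distrib_left sum_distrib_right
    using assms(1) by (intro sum.cong refl) (metis power_commuting_commutes)
  then have "X * (cor n * (\<Sum>i<K. W ^ i)) = cor n * (\<Sum>i<K. W ^ i) * X"
    using assms(2) by (metis mult.assoc)
  then show ?thesis by (simp only: avg_def sc_left_commute mult.assoc)
qed

lemma avg_fixed: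
  assumes W: "cor n * W = W * cor n" "cor n * W ^ K = cor n"
  shows "W * avg K W = avg K W" "cor n * avg K W = avg K W" "avg K W * cor n = avg K W"
proof -
  let ?s = "\<Sum>i<K. W ^ i"
  have "W * ?s = (\<Sum>i<K. W ^ Suc i)" by (simp add: sum_distrib_left)
  moreover have "1 + (\<Sum>i<K. W ^ Suc i) = ?s + W ^ K"
    using sum.lessThan_Suc_shift[of "\<lambda>i. W ^ i" K] by simp
  ultimately have "W * ?s = ?s + W ^ K - 1" by (simp add: eq_diff_eq add.commute)
  then have "cor n * (W * ?s) = cor n * ?s"
    by (simp only: distrib_left right_diff_distrib W(2)) simp
  then have "W * (cor n * ?s) = cor n * ?s" using W(1) by (metis mult.assoc)
  then show "W * avg K W = avg K W" by (simp only: avg_def sc_left_commute)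
  show 1: "cor n * avg K W = avg K W"
    by (simp only: avg_def sc_left_commute) (simp only: mult.assoc[symmetric] cor_idem)
  have "cor n * avg K W = avg K W * cor n" by (rule avg_commute[OF W(1)]) simp
  then show "avg K W * cor n = avg K W" using 1 by simp
qed

lemma avg_app_fixed:
  assumes v: "W \<rhd> v = v" "cor n \<rhd> v = v" and K: "of_nat K \<noteq> (0::'a)"
  shows "avg K W \<rhd> v = v"
proof -
  have Wi: "W ^ i \<rhd> v = v" for i
    using eigen_power[of W v 1 i] v(1) by simp
  have "(\<Sum>i<k. W ^ i) \<rhd> v = sc (of_nat k) \<rhd> v" for k
  proof (induction k)
    case (Suc k)
    have "(\<Sum>i<Suc k. W ^ i) \<rhd> v = (\<Sum>i<k. W ^ i) \<rhd> v + v" by (simp add: Wi)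
    also have "\<dots> = sc (of_nat (Suc k)) \<rhd> v"
      by (simp only: Suc.IH of_nat_Suc sc_simps(2,4) app_endo_simps(2,3) add.commute)
    finally show ?case .
  qed simp
  then have "avg K W \<rhd> v = sc (1 / of_nat K * of_nat K) \<rhd> v"
    by (simp only: avg_def app_endo_simps(6) app_sc_commute[of "cor n"] v(2) sc_simps(6))
  then show ?thesis using K by (simp del: sc_simps(6))
qed

lemma avg_absorb:
  assumes "W * X = X" "cor n * X = X" "of_nat K \<noteq> (0::'a)"
  shows "avg K W * X = X"
  by (rule endo_eqI) (metis assms app_endo_simps(6) avg_app_fixed)

text \<open>\<open>W\<close> and its inverse fix the same vectors, so
  \<open>avg K W * avg K Wi = avg K Wi\<close>. The left side is an operator times its adjoint,
  hence self-adjoint; so the adjoint of \<open>avg K W\<close> is self-adjoint and equals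
  it.\<close>

lemma sai_avg:
  assumes W: "cor n * W = W * cor n" "cor n * W ^ K = cor n" and K: "of_nat K \<noteq> (0::'a)"
    and adj: "adjoint W Wi" "W * Wi = 1" "Wi * W = 1"
  shows "sai (avg K W)"
proof -
  have Wi_cor: "cor n * Wi = Wi * cor n"
    using W(1) adj(2,3) by (metis mult.assoc mult.left_neutral mult.right_neutral)
  have "cor n * Wi ^ K = cor n * W ^ K * Wi ^ K" by (simp only: W(2))
  also have "\<dots> = cor n" by (simp only: mult.assoc left_inverse_power[OF adj(2)] mult_1_right)
  finally have WiK: "cor n * Wi ^ K = cor n" .
  note f = avg_fixed[OF W] and fi = avg_fixed[OF Wi_cor WiK]
  have "W * avg K Wi = avg K Wi" using fi(1) adj(2) by (metis mult.assoc mult.left_neutral)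
  then have 1: "avg K W * avg K Wi = avg K Wi" by (rule avg_absorb[OF _ fi(2) K])
  have sum: "adjoint (\<Sum>i<k. W ^ i) (\<Sum>i<k. Wi ^ i)" for k
    by (induction k) (auto intro: adjoint_0 adjoint_add adjoint_power[OF adj(1)])
  have "adjoint (avg K W) ((\<Sum>i<K. Wi ^ i) * cor n * sc (1 / of_nat K))"
    unfolding avg_def by (intro adjoint_mult adjoint_sc adjoint_e sum)
  moreover have "(\<Sum>i<K. Wi ^ i) * cor n * sc (1 / of_nat K) = avg K Wi"
  proof -
    have "(\<Sum>i<K. Wi ^ i) * cor n = cor n * (\<Sum>i<K. Wi ^ i)"
      unfolding sum_distrib_left sum_distrib_right
      by (intro sum.cong refl) (simp add: corner_power[OF Wi_cor])
    then show ?thesis by (simp only: avg_def sc_commute[of _ "1 / of_nat K"])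
  qed
  ultimately have a: "adjoint (avg K W) (avg K Wi)" by simp
  then have "adjoint (avg K W * avg K Wi) (avg K W * avg K Wi)" by (intro adjoint_mult adjoint_sym[OF a])
  then have a': "adjoint (avg K Wi) (avg K Wi)" by (simp only: 1)
  have "cor n * avg K W = cor n * avg K Wi" by (rule adjoint_unique[OF a a'])
  then have "avg K W = avg K Wi" by (simp only: f fi)
  then show ?thesis using 1 f a by (simp add: sai_def)
qed

text \<open>Two elements inverting \<open>g\<close> differ by an isometry \<open>z\<close> commuting with \<open>g\<close>. If \<open>z\<close> had determinant
  \<open>-1\<close>, an odd power of \<open>z\<close> would have \<open>2\<close>-power order and a \<open>-1\<close>-eigenspace of odd dimension; this
  space is \<open>g\<close>-invariant and nondegenerate.\<close>

lemma det_centralizer: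
  assumes no: "\<not> odd_block"
    and Z: "cor n * Z = Z * cor n" "Z * op_of n g = op_of n g * Z"
    and adj: "adjoint Z Zi" "Z * Zi = 1" "Zi * Z = 1"
  shows "det (mat_of n Z) \<noteq> - 1"
proof
  assume det: "det (mat_of n Z) = - 1"
  have Zi_pow: "Zi ^ i * Z ^ i = 1" "Z ^ i * Zi ^ i = 1" for i
    using left_inverse_power adj(2,3) by blast+
  obtain i j where ij: "i < j" "cor n * Z ^ i = cor n * Z ^ j"
    using power_repeats[OF cor_idem finite_range_cor Z(1)] by blast
  define t where "t = j - i"
  have t0: "t > 0" using ij(1) by (simp add: t_def)
  have "Z ^ j = Z ^ i * Z ^ t" using ij(1) by (simp add: t_def flip: power_add)
  then have "Z ^ i * (cor n * Z ^ t) = Z ^ i * cor n"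
    using ij(2) corner_power[OF Z(1), of i] by (metis mult.assoc)
  then have "Zi ^ i * Z ^ i * (cor n * Z ^ t) = Zi ^ i * Z ^ i * cor n" by (simp only: mult.assoc)
  then have Zt: "cor n * Z ^ t = cor n" by (simp only: Zi_pow mult_1_left)
  \<comment> \<open>The odd power Z^m still has determinant -1, and its order on the first
    \<open>n\<close> coordinates divides 2^a, which is invertible in the field as averaging
    requires.\<close>
  obtain a m where am: "t = 2 ^ a * m" "odd m" using odd_part_exists[OF t0] by blast
  define V where "V = Z ^ m"
  have V_cor: "cor n * V = V * cor n" unfolding V_def by (rule corner_power[OF Z(1)])
  have det_V: "det (mat_of n V) = - 1" using am(2) by (simp add: V_def det_mat_of_power[OF Z(1)] det)
  \<comment> \<open>Needed to make \<open>K\<close> even, so that -V and V have the same K-th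
    power.\<close>
  have "a \<noteq> 0"
  proof
    assume "a = 0"
    then have "cor n * V = cor n" using Zt am(1) by (simp add: V_def)
    then have "mat_of n (V * cor n) = 1\<^sub>m n" using V_cor by (simp add: mat_of_simps)
    then have "mat_of n V = 1\<^sub>m n" by (simp add: mat_of_mult mat_of_simps)
    then have "(1::'a) = - 1" using det_V by simp
    then have "(2::'a) = 0" by (simp add: eq_neg_iff_add_eq_0)
    then show False using two by simp
  qed
  define K :: nat where "K = 2 ^ a"
  have K: "of_nat K \<noteq> (0::'a)" "even K" using two \<open>a \<noteq> 0\<close> by (simp_all add: K_def)
  have "(- V) ^ K = Z ^ t" using K(2) by (simp add: V_def K_def am(1) uminus_power_if flip: power_mult) (simp add: mult.commute)
  then have WK: "cor n * (- V) ^ K = cor n" using Zt by simp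
  have W_cor: "cor n * (- V) = (- V) * cor n" using V_cor by simp
  have Vg: "V * op_of n g = op_of n g * V"
    unfolding V_def using Z(2) by (metis power_commuting_commutes)
  have adj_V: "adjoint V (Zi ^ m)" unfolding V_def by (rule adjoint_power[OF adj(1)])
  \<comment> \<open>Fixed vectors of -V are the -1-eigenvectors of \<open>V\<close>.\<close>
  define E where "E = avg K (- V)"
  have E: "sai E"
    unfolding E_def
    by (rule sai_avg[OF W_cor WK K(1), of "- (Zi ^ m)"])
      (use adj_V Zi_pow in \<open>simp_all add: V_def adjoint_minus\<close>)
  have gE: "op_of n g * E = E * op_of n g"
    unfolding E_def using Vg by (intro avg_commute) (simp_all add: op_of_cor)
  have "op_of n gi * V = op_of n gi * (V * op_of n g) * op_of n gi"
    by (simp only: mult.assoc g_inv mult_1_right)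
  also have "\<dots> = op_of n gi * (op_of n g * V) * op_of n gi" by (simp only: Vg)
  also have "\<dots> = V * op_of n gi" by (simp only: mult.assoc[symmetric] g_inv mult_1_left)
  finally have "op_of n gi * V = V * op_of n gi" .
  then have giE: "op_of n gi * E = E * op_of n gi"
    unfolding E_def by (intro avg_commute) (simp_all add: op_of_cor)
  have "E * x = x * E" "E * S = S * E" using gE giE by (simp_all add: x_def S_def algebra_simps)
  \<comment> \<open>The eigenspace is invariant under \<open>x\<close> and \<open>S\<close>, so the
    absence of odd vectors forces its dimension to be even.\<close>
  then obtain P N d where PN: "inverting_pair P N" "E = P + N" "has_rank P d" "has_rank N d"
    using exists_inverting_pair[OF E] no by blast
  then have "has_rank E (d + d)" using inverting_pairD(3,4)[OF PN(1)] by (auto intro: has_rank_add)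
  define Q where "Q = 1 - (E + E)"
  have Q_cor: "cor n * Q = Q * cor n" using saiD(2,3)[OF E] by (simp add: Q_def algebra_simps)
  have "det (mat_of n Q) = (- 1) ^ (d + d)"
    unfolding Q_def by (rule det_reflection[OF \<open>has_rank E (d + d)\<close> saiD(2,3)[OF E]])
  then have "det (mat_of n Q) = 1" by (simp add: power_add flip: power_mult_distrib)
  then have "det (mat_of n (V * Q)) = - 1"
    using det_V by (simp add: mat_of_mult[OF Q_cor] det_mult[of _ n])
  \<comment> \<open>\<open>Q\<close> reverses the sign on the -1-eigenspace of \<open>V\<close>, so
    \<open>V * Q\<close> no longer has the eigenvalue -1.\<close>
  moreover have "det (mat_of n (V * Q)) = 1"
  proof (rule det_isometry)
    show "cor n * (V * Q) = V * Q * cor n" using V_cor Q_cor by (metis mult.assoc)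
    show "form_of n B ((V * Q) \<rhd> u) ((V * Q) \<rhd> v) = form_of n B u v" for u v
    proof -
      have QQ: "Q * Q = 1" using saiD(1)[OF E] by (simp add: Q_def algebra_simps)
      have "adjoint Q Q" unfolding Q_def by (intro adjoint_diff adjoint_1 adjoint_add saiD(4)[OF E])
      then have "adjoint (V * Q) (Q * Zi ^ m)" by (intro adjoint_mult adj_V)
      moreover have "Q * Zi ^ m * (V * Q) = Q * (Zi ^ m * V) * Q" by (simp only: mult.assoc)
      then have "Q * Zi ^ m * (V * Q) = 1" by (simp add: V_def Zi_pow QQ)
      then have "(Q * Zi ^ m) \<rhd> (V * Q) \<rhd> v = v" by (metis app_endo_simps(2,6))
      ultimately show ?thesis by (simp only: adjoint_def)
    qed
    fix v assume v: "cor n \<rhd> v = v" "(V * Q) \<rhd> v = - v"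
    have "(- V) * E = E" unfolding E_def by (rule avg_fixed(1)[OF W_cor WK])
    then have "- (V \<rhd> E \<rhd> w) = E \<rhd> w" for w by (metis app_endo_simps(5,6))
    then have VE: "V \<rhd> E \<rhd> w = - (E \<rhd> w)" for w by (metis minus_minus)
    have EV: "E \<rhd> V \<rhd> w = V \<rhd> E \<rhd> w" for w
      by (rule commute_app[symmetric]) (simp add: E_def avg_commute V_cor)
    have "V \<rhd> (v - (E \<rhd> v + E \<rhd> v)) = - v" using v(2) by (simp only: Q_def app_endo_simps)
    then have 1: "V \<rhd> v + (E \<rhd> v + E \<rhd> v) = - v"
      by (simp only: app_diff app_add VE minus_add_distrib[symmetric] diff_minus_eq_add)
    \<comment> \<open>Projecting Vv + 2Ev = -v by \<open>E\<close> gives Ev = 0. Then v is a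
      -1-eigenvector of \<open>V\<close>, so Ev = v.\<close>
    then have "E \<rhd> (V \<rhd> v + (E \<rhd> v + E \<rhd> v)) = E \<rhd> (- v)" by (simp only:)
    then have "- (E \<rhd> v) + (E \<rhd> v + E \<rhd> v) = - (E \<rhd> v)"
      by (simp only: app_add app_minus EV VE saiD(5)[OF E])
    then have "E \<rhd> v + E \<rhd> v = 0" by (metis add.right_neutral add_left_cancel)
    then have Ev2: "sc (1 + 1) \<rhd> E \<rhd> v = 0" by (simp only: sc_simps(2,4) app_endo_simps)
    then have Ev: "E \<rhd> v = 0" using two by simp
    then have "- V \<rhd> v = v" using 1 by (simp add: minus_equation_iff)
    then have "E \<rhd> v = v" unfolding E_def by (rule avg_app_fixed[OF _ v(1) K(1)])
    then show "v = 0" using Ev by simp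
  qed
  ultimately have "(2::'a) = 0" by (simp add: eq_neg_iff_add_eq_0)
  then show False using two by simp
qed

lemma not_real_without_odd_block:
  assumes no: "\<not> odd_block" and n: "n mod 4 = 2" and h: "h \<in> carrier (SO_group n B)" "g * h * g = h"
  shows False
proof -
  obtain P N d where PN: "inverting_pair P N" "cor n = P + N" "has_rank P d" "has_rank N d"
    using exists_inverting_pair[OF sai_e x_e S_e] no by blast
  have "has_rank (cor n :: 'a endo) (d + d)"
    by (subst PN(2)) (rule has_rank_add[OF PN(3,4) inverting_pairD(3,4)[OF PN(1)]])
  moreover have "has_rank (cor n :: 'a endo) n" using basis_of_cor by (auto simp: has_rank_def)
  ultimately have "d + d = n" by (rule has_rank_unique)
  then have "odd d" using n by presburger
  obtain h0 where h0: "h0 \<in> carrier_mat n n" "h0 * h0 = 1\<^sub>m n" "g * h0 * g = h0" "det h0 = (- 1) ^ d"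
    "\<forall>u v. form_of n B (op_of n h0 \<rhd> u) (op_of n h0 \<rhd> v) = form_of n B u v"
    using involution_of_pair[OF PN(1) PN(2)[symmetric] PN(4)] by blast
  interpret G: group "SO_group n B" by (rule SO_group_is_group)
  define hi where "hi = inv\<^bsub>SO_group n B\<^esub> h"
  have hi: "hi \<in> carrier_mat n n" "h * hi = 1\<^sub>m n" "hi * h = 1\<^sub>m n"
    using G.r_inv[OF h(1)] G.l_inv[OF h(1)] SO_carrier[of hi] h(1) by (simp_all add: hi_def SO_group_simps)
  have hc: "h \<in> carrier_mat n n" and gc: "g \<in> carrier_mat n n" using h(1) g SO_carrier by auto
  define R where "R = op_of n h0"
  define T where "T = op_of n h"
  define Ti where "Ti = op_of n hi"
  let ?g = "op_of n g" and ?gi = "op_of n gi"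
  have RR: "R * R = 1" unfolding R_def by (simp add: h0 op_of_1 flip: op_of_mult)
  have TT: "T * Ti = 1" "Ti * T = 1" unfolding T_def Ti_def using hc hi by (simp_all add: op_of_1 flip: op_of_mult)
  have conj: "?g * op_of n k * ?g = op_of n k" if "k \<in> carrier_mat n n" "g * k * g = k" for k
    using that gc by (simp flip: op_of_mult)
  have gTg: "?g * T * ?g = T" and gRg: "?g * R * ?g = R"
    unfolding T_def R_def using conj hc h(2) h0(1,3) by blast+
  have "T * ?g = ?gi * (?g * T * ?g)" by (simp only: mult.assoc[symmetric] g_inv mult_1_left)
  then have Tg: "T * ?g = ?gi * T" by (simp only: gTg)
  have "?g * R = (?g * R * ?g) * ?gi" by (simp only: mult.assoc g_inv mult_1_right)
  then have gR: "?g * R = R * ?gi" by (simp only: gRg)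
  \<comment> \<open>\<open>T\<close> and \<open>R\<close> both invert \<open>g\<close>, so their
    product centralizes it; the determinant of the product is (-1)^d with d = n/2 odd.\<close>
  have "R * T * ?g = R * ?gi * T" by (simp only: mult.assoc Tg)
  also have "\<dots> = ?g * (R * T)" by (simp only: gR[symmetric] mult.assoc)
  finally have Zg: "R * T * ?g = ?g * (R * T)" .
  have inv: "R * T * (Ti * R) = 1" "Ti * R * (R * T) = 1"
  proof -
    have "R * T * (Ti * R) = R * (T * Ti) * R" "Ti * R * (R * T) = Ti * (R * R) * T" by (simp_all only: mult.assoc)
    then show "R * T * (Ti * R) = 1" "Ti * R * (R * T) = 1" by (simp_all add: TT RR)
  qed
  have iso: "form_of n B ((R * T) \<rhd> u) ((R * T) \<rhd> v) = form_of n B u v" for u v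
    using h0(5) h(1) by (simp add: R_def T_def SO_iff)
  have adj: "adjoint (R * T) (Ti * R)"
    unfolding adjoint_def
  proof (intro allI)
    fix u v
    have "(R * T) \<rhd> (Ti * R) \<rhd> v = v" using inv(1) by (metis app_endo_simps(2,6))
    then show "form_of n B ((R * T) \<rhd> u) v = form_of n B u ((Ti * R) \<rhd> v)" using iso[of u "(Ti * R) \<rhd> v"] by simp
  qed
  have T_cor: "cor n * T = T * cor n" and R_cor: "cor n * R = R * cor n" unfolding T_def R_def by (rule op_of_cor)+
  have "cor n * (R * T) = R * T * cor n" using T_cor R_cor by (metis mult.assoc)
  then have "det (mat_of n (R * T)) \<noteq> - 1" by (rule det_centralizer[OF no _ Zg adj inv])
  moreover have "mat_of n (R * T) = h0 * h"
    using hc h0(1) by (simp add: mat_of_mult[OF T_cor]) (simp add: R_def T_def mat_of_op_of)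
  moreover have "det (h0 * h) = - 1"
    using h0(1,4) hc h(1) \<open>odd d\<close> by (simp add: det_mult[of _ n] SO_iff)
  ultimately show False by simp
qed

text \<open>Solved with the inverse Gram matrix. It turns the coordinate functional of a companion
  block into pairing with a vector.\<close>

lemma functional_represented:
  assumes \<phi>: "functional \<phi>" "\<And>u. \<phi> (cor n \<rhd> u) = \<phi> u"
  shows "\<exists>w. cor n \<rhd> w = w \<and> (\<forall>u. \<phi> u = form_of n B w u)"
proof -
  obtain Bi where Bi: "Bi \<in> carrier_mat n n" "Bi * B = 1\<^sub>m n"
    using det_non_zero_imp_unit[OF B_carrier det_form, of "()"] by (auto simp: Units_def ring_mat_def)
  have BiB: "(\<Sum>i<n. Bi $$ (k, i) * B $$ (i, j)) = (if k = j then 1 else 0)" if "k < n" "j < n" for k j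
    using arg_cong[OF Bi(2), of "\<lambda>M. M $$ (k, j)"] that Bi(1) B_carrier
    by (simp add: scalar_prod_def lessThan_atLeast0)
  define w where "w = cor n \<rhd> (\<lambda>i. \<Sum>k<n. \<phi> (basis_vec k) * Bi $$ (k, i))"
  have "form_of n B w u = \<phi> u" for u
  proof -
    have "form_of n B w u = (\<Sum>i<n. \<Sum>k<n. \<Sum>j<n. \<phi> (basis_vec k) * u j * (Bi $$ (k, i) * B $$ (i, j)))"
      by (simp add: form_of_def w_def app_cor sum_distrib_left sum_distrib_right mult_ac)
    also have "\<dots> = (\<Sum>k<n. \<Sum>j<n. \<phi> (basis_vec k) * u j * (\<Sum>i<n. Bi $$ (k, i) * B $$ (i, j)))"
      by (subst sum.swap, rule sum.cong[OF refl], subst sum.swap) (simp add: sum_distrib_left)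
    also have "\<dots> = (\<Sum>k<n. \<Sum>j<n. if j = k then \<phi> (basis_vec k) * u j else 0)"
      by (intro sum.cong refl) (simp add: BiB)
    also have "\<dots> = (\<Sum>k<n. u k * \<phi> (basis_vec k))" by (intro sum.cong refl) simp
    also have "\<dots> = \<phi> (cor n \<rhd> u)"
      by (simp add: cor_sum functional_sum[OF \<phi>(1)] functional_simps[OF \<phi>(1)])
    finally show ?thesis by (simp add: \<phi>(2))
  qed
  moreover have "cor n \<rhd> w = w" unfolding w_def by (rule idempotent_app[OF cor_idem])
  ultimately show ?thesis by metis
qed

text \<open>Pairing with \<open>v\<close> is a Hankel functional for \<open>g\<close>, so the block
  of \<open>v\<close> splits off as a \<open>g\<close>-invariant summand; its complement is
  decomposed without reference to the form.\<close>

lemma elementary_divisor_of_jordan_vector: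
  assumes "jordan_vector \<epsilon> k v"
  shows "elementary_divisor g ([:- \<epsilon>, 1:] ^ k)"
proof -
  let ?g = "op_of n g" and ?p = "[:- \<epsilon>, 1:]"
  have \<epsilon>: "\<epsilon> * \<epsilon> = 1" and k: "odd k" and v: "cor n \<rhd> v = v" "(?g - sc \<epsilon>) ^ k \<rhd> v = 0"
    "form_of n B v ((?g - sc \<epsilon>) ^ (k - 1) \<rhd> v) \<noteq> 0"
    using assms unfolding jordan_vector_def by blast+
  interpret H: hankel ?g ?p k v "form_of n B v"
    by unfold_locales
      (use v jordan_vector_kills[OF \<epsilon> v(2)] in \<open>simp_all only: functional_b irreducible_linear_poly pev_power pev_linear not_False_eq_True\<close>)
  define F where "F = H.E"
  have gF: "?g * F = F * ?g" unfolding F_def by (rule H.E_commute)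
  have corF: "cor n * F = F"
  proof (rule endo_eqI)
    fix u
    obtain c where "F \<rhd> u = pev c ?g \<rhd> v" using H.E_image unfolding F_def by blast
    moreover have "cor n \<rhd> pev c ?g \<rhd> v = pev c ?g \<rhd> cor n \<rhd> v"
      by (rule commute_app[OF pev_commute[OF op_of_cor]])
    ultimately show "(cor n * F) \<rhd> u = F \<rhd> u" using v(1) by simp
  qed
  have Fcor: "F * cor n = F"
  proof (rule endo_eqI)
    fix u
    have "F \<rhd> (u - cor n \<rhd> u) = 0"
      unfolding F_def
    proof (rule H.E_kill)
      fix j
      have "?g ^ j \<rhd> cor n \<rhd> u = cor n \<rhd> ?g ^ j \<rhd> u"
        by (rule commute_app[symmetric], rule corner_power[OF op_of_cor])
      then show "form_of n B v (?g ^ j \<rhd> (u - cor n \<rhd> u)) = 0" by (simp add: b_right b_e')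
    qed
    then show "(F * cor n) \<rhd> u = F \<rhd> u" by simp
  qed
  have FF: "F * F = F" unfolding F_def by (rule has_rank_idem[OF H.rank_E])
  have "(cor n - F) * (cor n - F) = cor n - F" by (simp add: algebra_simps cor_idem corF Fcor FF)
  moreover have "finite (range (app (cor n - F)))" by (rule finite_range_diff[OF finite_range_cor corF])
  moreover have "(cor n - F) * ?g = ?g * (cor n - F)" by (simp add: algebra_simps gF op_of_cor)
  ultimately obtain ds where ds: "\<forall>d\<in>set ds. \<exists>p k. monic p \<and> irreducible p \<and> 0 < k \<and> d = p ^ k"
    and ac: "acts_as ?g (cor n - F) (diag_block_mat (map companion_mat ds))"
    using acts_as_companions by blast
  have "acts_as ?g F (companion_mat (?p ^ k))" unfolding F_def by (rule H.acts_as_companion) simp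
  moreover have "F * (cor n - F) = 0" "(cor n - F) * F = 0" by (simp_all add: algebra_simps corF Fcor FF)
  ultimately have "acts_as ?g (cor n) (diag_block_mat (map companion_mat (?p ^ k # ds)))"
    using acts_as_add[OF _ ac, of F] by (simp add: Let_def)
  moreover have "\<forall>d\<in>set (?p ^ k # ds). \<exists>p k. monic p \<and> irreducible p \<and> 0 < k \<and> d = p ^ k"
  proof -
    have "\<exists>p j. monic p \<and> irreducible p \<and> 0 < j \<and> ?p ^ k = p ^ j"
      by (rule exI[of _ ?p], rule exI[of _ k]) (use k irreducible_linear_poly in \<open>auto elim: oddE\<close>)
    then show ?thesis using ds by simp
  qed
  ultimately have "elementary_divisors g (?p ^ k # ds)"
    using elementary_divisors_of_acts_as SO_carrier[OF g] by blast
  then show ?thesis unfolding elementary_divisor_def by auto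
qed

text \<open>Similarity ignores the form, so the given summand may be degenerate. Its socle is
  detected by pairing with some other vector w, and \<open>exists_jordan_vector\<close> combines v
  and w.\<close>

lemma jordan_vector_of_elementary_divisor:
  assumes ed: "elementary_divisor g ([:- \<epsilon>, 1:] ^ k)" and \<epsilon>: "\<epsilon> * \<epsilon> = 1" and k: "odd k"
  shows "\<exists>v. jordan_vector \<epsilon> k v"
proof -
  let ?g = "op_of n g" and ?p = "[:- \<epsilon>, 1:]"
  obtain ds where sim: "similar_mat g (diag_block_mat (map companion_mat ds))" and ds: "?p ^ k \<in> set ds"
    using ed unfolding elementary_divisor_def elementary_divisors_def by blast
  have "acts_as ?g (cor n) (diag_block_mat (map companion_mat ds))"
    by (rule acts_as_of_similar_mat[OF SO_carrier[OF g] sim])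
  then obtain F where F: "acts_as ?g F (companion_mat (?p ^ k))" "?g * F = F * ?g" "cor n * F = F" "F * cor n = F"
    using acts_as_companion_summand[OF _ op_of_cor[symmetric] ds] by blast
  have "monic ?p" "degree ?p > 0" "k > 0" using k by (auto elim: oddE)
  then obtain v \<phi> where \<phi>: "functional \<phi>" and v: "F \<rhd> v = v" "pev (?p ^ k) ?g \<rhd> v = 0"
    and kill: "\<And>u. \<phi> (pev (?p ^ k) ?g \<rhd> u) = 0" and \<phi>F: "\<And>u. \<phi> (F \<rhd> u) = \<phi> u"
    and nz: "\<phi> (pev (?p ^ (k - 1)) ?g \<rhd> v) \<noteq> 0"
    using companion_cyclic_vector[OF F(1,2)] by blast
  have "\<phi> (cor n \<rhd> u) = \<phi> u" for u using \<phi>F F(4) by (metis app_endo_simps(6))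
  then obtain w where w: "cor n \<rhd> w = w" "\<And>u. \<phi> u = form_of n B w u"
    using functional_represented[OF \<phi>] by blast
  have "cor n \<rhd> v = v" using v(1) F(3) by (metis app_endo_simps(6))
  moreover have "(?g - sc \<epsilon>) ^ k \<rhd> v = 0" using v(2) by (simp only: pev_power pev_linear)
  moreover have "form_of n B w ((?g - sc \<epsilon>) ^ k \<rhd> u) = 0" for u
    using kill[of u] by (simp only: pev_power pev_linear w(2))
  moreover have "form_of n B w ((?g - sc \<epsilon>) ^ (k - 1) \<rhd> v) \<noteq> 0"
    using nz by (simp only: pev_power pev_linear w(2) not_False_eq_True)
  ultimately show ?thesis by (intro exists_jordan_vector[OF \<epsilon> k _ _ w(1)])
qed

lemma odd_block_iff_elementary_divisor:
  "odd_block \<longleftrightarrow> (\<exists>k. odd k \<and>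
     (elementary_divisor g ([:-1, 1:] ^ k) \<or> elementary_divisor g ([:1, 1:] ^ k)))"
proof
  assume odd_block
  then obtain \<epsilon> l v where ov: "odd_vector \<epsilon> l v" by blast
  then obtain m where "l = Suc m" unfolding odd_vector_def using gr0_implies_Suc by blast
  then have jv: "jordan_vector \<epsilon> (Suc (2 * m)) v" using ov jordan_vector_iff_odd_vector by blast
  then have "\<epsilon> * \<epsilon> = 1" by (simp add: jordan_vector_def)
  then have "\<epsilon> = 1 \<or> \<epsilon> = - 1" by (simp add: square_eq_1_iff)
  moreover have "odd (Suc (2 * m))" by simp
  ultimately show "\<exists>k. odd k \<and> (elementary_divisor g ([:-1, 1:] ^ k) \<or> elementary_divisor g ([:1, 1:] ^ k))"
    using elementary_divisor_of_jordan_vector[OF jv] by (metis minus_minus)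
next
  assume "\<exists>k. odd k \<and> (elementary_divisor g ([:-1, 1:] ^ k) \<or> elementary_divisor g ([:1, 1:] ^ k))"
  then obtain k \<epsilon> where k: "odd k" and \<epsilon>: "\<epsilon> * \<epsilon> = 1" and ed: "elementary_divisor g ([:- \<epsilon>, 1:] ^ k)"
    by (metis minus_minus minus_mult_minus mult_1)
  obtain m where m: "k = Suc (2 * m)" using k by (metis oddE Suc_eq_plus1)
  obtain v where "jordan_vector \<epsilon> k v" using jordan_vector_of_elementary_divisor[OF ed \<epsilon> k] by blast
  then show odd_block unfolding m jordan_vector_iff_odd_vector by blast
qed

end

theorem theorem7p2:
  fixes B g :: "'a::{field, finite} mat" and n q :: nat
  assumes "CARD('a) = q"
    and "odd q"
    and "n mod 4 = 2"
    and "nondegenerate_symmetric_form n B"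
    and "g \<in> carrier (SO_group n B)"
  shows "(real_in (SO_group n B) g \<longleftrightarrow> strongly_real_in (SO_group n B) g) \<and>
    (real_in (SO_group n B) g \<longleftrightarrow>
      (\<exists>k. odd k \<and>
        (elementary_divisor g ([:-1, 1:] ^ k) \<or> elementary_divisor g ([:1, 1:] ^ k))))"
proof -
  interpret so_element n B g using assms by unfold_locales auto
  have "odd_block" if "real_in (SO_group n B) g"
    using that not_real_without_odd_block[OF _ assms(3)] inverts_iff[OF assms(5)]
    unfolding real_in_def by blast
  moreover have "real_in (SO_group n B) g" if "strongly_real_in (SO_group n B) g"
    using that unfolding real_in_def strongly_real_in_def by blast
  ultimately show ?thesis
    using strongly_real_of_odd_block odd_block_iff_elementary_divisor by blast
qed

end
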